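(* Let $n\ge1$ be an integer. Let $X_1=(\Omega_1,\Sigma_1,\mu_1)$ and $X_2=(\Omega_2,\Sigma_2,\mu_2)$ be two finite measure spaces, where $\Omega_1$ is a Polish space and $\Sigma_1$ is its Borel $\sigma$-algebra. Let $A:L^2(X_1,\mathbb{R}^n)\to L^2(X_2,\mathbb{R}^n)$ be a continuous linear operator such that (i) $\|A\|\le 1$; (ii) for every $v_0\in\mathbb{R}^n$, $A$ sends the constant function $\Omega_1\ni s\mapsto v_0$ to the constant function $\Omega_2\ni t\mapsto v_0$. Let $\{f_s\}_{s\in\Omega_1}$ and $\{g_t\}_{t\in\Omega_2}$ be two families of continuous real-valued functions on $\mathbb{R}^n$ such that (iii) $(s,x)\mapsto f_s(x)$ is $\Sigma_1\otimes\mathcal{B}_{\mathbb{R}^n}$-measurable and $(t,x)\mapsto g_t(x)$ is $\Sigma_2\otimes\mathcal{B}_{\mathbb{R}^n}$-measurable; (iv) the functions $s\mapsto\log\bigl(\int_{\mathbb{R}^n}e^{-f_s(x)}\,dx\bigr)$ and $t\mapsto\log\bigl(\int_{\mathbb{R}^n}e^{-g_t(x)}\,dx\bigr)$ are semi-integrable with respect to $\mu_1$ and $\mu_2$ respectively; (v) either all $f_s$ and $g_t$ are non-negative, or, more generally, $f_s(x)\ge-\ell_1(s)$ and $g_t(x)\ge-\ell_2(t)$ for all $s,t,x$, where $\ell_1,\ell_2\ge0$ are functions on $\Omega_1,\Omega_2$ that are $\mu_1$-, $\mu_2$-integrable respectively; (vi) there are non-negative measurable functions $a(s),b(s)$ on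 $\Omega_1$ such that $f_s(x)\le a(s)e^{b(s)|x|}$ for all $s\in\Omega_1$, $x\in\mathbb{R}^n$. Suppose that for every $\alpha\in L^2(X_1,\mathbb{R}^n)$, \[ \int_{\Omega_2}g_t\bigl((A\alpha)(t)\bigr)\,d\mu_2(t)\le\int_{\Omega_1}f_s(\alpha(s))\,d\mu_1(s). \] Then for every $\tau>0$, with $\gamma=\gamma_{n,\tau}$, \[ \int_{\Omega_2}-\log\Bigl(\int_{\mathbb{R}^n}e^{-g_t(x)}\,d\gamma(x)\Bigr)\,d\mu_2(t)\le\int_{\Omega_1}-\log\Bigl(\int_{\mathbb{R}^n}e^{-f_s(x)}\,d\gamma(x)\Bigr)\,d\mu_1(s). \]
   Context: $\gamma_{n,\tau}$ is the isotropic Gaussian probability measure on $\mathbb{R}^n$ with $d\gamma_{n,\tau}(x)=e^{-|x|^2/(2\tau)}\,dx/(2\pi\tau)^{n/2}$. $|\cdot|$ is the Euclidean norm on $\mathbb{R}^n$, $\mathcal{B}_{\mathbb{R}^n}$ is the Borel $\sigma$-algebra of $\mathbb{R}^n$. The $L^2$-norms of $\mathbb{R}^n$-valued functions are computed with respect to $|\cdot|$ and the measures $\mu_1,\mu_2$, and $\|A\|$ is the corresponding operator norm. An extended-real measurable function $F$ on a measure space with measure $\mu$ is called $\mu$-semi-integrable if at least one of $F^+=\max(F,0)$, $F^-=\max(-F,0)$ is $\mu$-integrable; its integral is then well defined in $[-\infty,+\infty]$. Conventions: $\log(+\infty)=+\infty$, $\log 0=-\infty$. *)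

theory Defs
  imports "HOL-Analysis.Analysis"
begin

(* Elements of L^2 are handled through representatives: an operator between the
   L^2 spaces acts on square-integrable functions and respects a.e. equality. *)

definition L2_fun :: "'a measure \<Rightarrow> ('a \<Rightarrow> 'v::euclidean_space) set" where
  "L2_fun M = {\<alpha> \<in> borel_measurable M. integrable M (\<lambda>x. (norm (\<alpha> x))\<^sup>2)}"

definition norm_L2 :: "'a measure \<Rightarrow> ('a \<Rightarrow> 'v::euclidean_space) \<Rightarrow> real" where
  "norm_L2 M \<alpha> = sqrt (\<integral>x. (norm (\<alpha> x))\<^sup>2 \<partial>M)"

(* The analogue of bounded_linear for maps L^2(M) -> L^2(N); equalities in L^2(N) are a.e. *)
definition bounded_linear_L2 ::
  "'a measure \<Rightarrow> 'b measure \<Rightarrow> (('a \<Rightarrow> 'v::euclidean_space) \<Rightarrow> ('b \<Rightarrow> 'w::euclidean_space)) \<Rightarrow> bool" where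
  "bounded_linear_L2 M N A \<longleftrightarrow>
     (\<forall>\<alpha>\<in>L2_fun M. A \<alpha> \<in> L2_fun N) \<and>
     (\<forall>\<alpha>\<in>L2_fun M. \<forall>\<beta>\<in>L2_fun M. (AE x in M. \<alpha> x = \<beta> x) \<longrightarrow> (AE y in N. A \<alpha> y = A \<beta> y)) \<and>
     (\<forall>\<alpha>\<in>L2_fun M. \<forall>\<beta>\<in>L2_fun M. AE y in N. A (\<lambda>x. \<alpha> x + \<beta> x) y = A \<alpha> y + A \<beta> y) \<and>
     (\<forall>c. \<forall>\<alpha>\<in>L2_fun M. AE y in N. A (\<lambda>x. c *\<^sub>R \<alpha> x) y = c *\<^sub>R A \<alpha> y) \<and>
     (\<exists>K. \<forall>\<alpha>\<in>L2_fun M. norm_L2 N (A \<alpha>) \<le> norm_L2 M \<alpha> * K)"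

(* As in onorm, the quotient is 0 when the denominator vanishes. *)
definition onorm_L2 ::
  "'a measure \<Rightarrow> 'b measure \<Rightarrow> (('a \<Rightarrow> 'v::euclidean_space) \<Rightarrow> ('b \<Rightarrow> 'w::euclidean_space)) \<Rightarrow> real" where
  "onorm_L2 M N A = (SUP \<alpha>\<in>L2_fun M. norm_L2 N (A \<alpha>) / norm_L2 M \<alpha>)"

(* e2ennreal truncates at 0, so e2ennreal (F x) and e2ennreal (- F x) are the
   positive and negative parts of F x. *)
definition semi_integrable :: "'a measure \<Rightarrow> ('a \<Rightarrow> ereal) \<Rightarrow> bool" where
  "semi_integrable M F \<longleftrightarrow> F \<in> borel_measurable M \<and>
     ((\<integral>\<^sup>+x. e2ennreal (F x) \<partial>M) < \<infinity> \<or> (\<integral>\<^sup>+x. e2ennreal (- F x) \<partial>M) < \<infinity>)"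

(* Meaningful for semi-integrable F only. *)
definition ext_integral :: "'a measure \<Rightarrow> ('a \<Rightarrow> ereal) \<Rightarrow> ereal" where
  "ext_integral M F =
     enn2ereal (\<integral>\<^sup>+x. e2ennreal (F x) \<partial>M) - enn2ereal (\<integral>\<^sup>+x. e2ennreal (- F x) \<partial>M)"

definition ln_ennreal :: "ennreal \<Rightarrow> ereal" where
  "ln_ennreal u = (if u = 0 then -\<infinity> else if u = \<infinity> then \<infinity> else ereal (ln (enn2real u)))"

definition gaussian :: "real \<Rightarrow> (real ^ 'n::finite) measure" where
  "gaussian \<tau> = density lborel
     (\<lambda>x. ennreal (exp (- (norm x)\<^sup>2 / (2 * \<tau>)) / (2 * pi * \<tau>) powr (real CARD('n) / 2)))"

end

theory Submission
  imports Defs "HOL-Probability.Probability"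
begin

text \<open>Write \<open>V\<^sub>h f x = -ln \<integral> exp (-f (x + z)) d\<gamma>\<^sub>h(z)\<close>, \<open>P\<^sub>h f x = \<integral> f (x + z) d\<gamma>\<^sub>h(z)\<close> and
  \<open>Q\<^sub>h f x = inf\<^sub>y f y + \<bar>x - y\<bar>\<^sup>2 / 2h\<close>. The integral inequality between \<open>g\<close> and \<open>f\<close> passes to the pair
  \<open>(Q\<^sub>h g, Q\<^sub>h f)\<close> because \<open>A\<close> is a contraction, and to \<open>(P\<^sub>h g, P\<^sub>h f)\<close> because \<open>A\<close> preserves constants.
  Gibbs' variational principle gives \<open>V\<^sub>h g \<le> Q\<^sub>h P\<^sub>h g\<close> exactly, and if the second differences of \<open>f\<close> are bounded by
  \<open>L\<bar>y\<bar>\<^sup>2\<close> then \<open>Q\<^sub>h P\<^sub>h f \<le> V\<^sub>h f + C h\<^sup>2\<close>. As \<open>V\<close> is a semigroup, \<open>\<tau> / h\<close> such steps carry the inequality from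
  \<open>(g, f)\<close> to \<open>(V\<^sub>\<tau> g, V\<^sub>\<tau> f)\<close> with total error \<open>O(h)\<close>.

  The regularity of \<open>f\<close> comes from one initial application of \<open>Q\<^sub>\<delta>\<close>: \<open>Q\<^sub>\<delta> f\<close> is approximated from above by soft minima
  of finitely many quadratics \<open>f y + \<bar>x - y\<bar>\<^sup>2 / 2\<delta>\<close>, whose second differences stay bounded along \<open>V\<close>. Finally
  \<open>V Q\<^sub>\<delta> f \<le> V f\<close>, while \<open>V Q\<^sub>\<delta> g\<close> tends to \<open>V g\<close> as \<open>\<delta>\<close> tends to 0.\<close>

subsection \<open>Gaussian measures\<close>

text \<open>Nothing is known about \<open>A\<close> pointwise, so only two operations are compatible
  with it: averaging over translates, and infimal convolution with a quadratic cost. Alternating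
  them is a splitting scheme for dV/dt = (1/2) Laplace V - (1/2) |grad V|^2, the viscous
  Hamilton-Jacobi equation solved by \<open>log_heat\<close>. The error of one step is pointwise; it
  has to be integrated over \<open>M1\<close> and summed over the steps. Hence one constant L must
  serve all parameters s and all times, and this fixes the order of limits: with \<delta> and the
  number m of quadratics fixed, L depends on neither s nor time, so the step size goes to 0 first,
  then m to infinity, then \<delta> to 0. The limit in m passes under the integral over
  \<open>M1\<close> by a majorant linear in \<open>log_heat \<tau> (f s) 0\<close>. It comes from a
  point of the dense sequence at which both \<open>f s\<close> and the distance to the origin are
  controlled by that value. Near-minimisers are selected by least index in a fixed dense sequence,
  which keeps the selections measurable.\<close>

definition gauss_dens :: "real \<Rightarrow> real ^ 'n::finite \<Rightarrow> real" where
  "gauss_dens \<tau> x = exp (- (norm x)\<^sup>2 / (2 * \<tau>)) / (2 * pi * \<tau>) powr (real CARD('n) / 2)"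

lemma gauss_dens_measurable [measurable]: "gauss_dens \<tau> \<in> borel_measurable borel"
  unfolding gauss_dens_def by measurable

lemma gauss_dens_nonneg [simp]: "gauss_dens \<tau> x \<ge> 0"
  by (simp add: gauss_dens_def)

lemma sets_gaussian [measurable_cong, simp]: "sets (gaussian \<tau>) = sets borel"
  by (simp add: gaussian_def)

lemma space_gaussian [simp]: "space (gaussian \<tau>) = UNIV"
  by (simp add: gaussian_def)

lemma nn_integral_gaussian:
  fixes \<phi> :: "real ^ 'n::finite \<Rightarrow> ennreal"
  assumes [measurable]: "\<phi> \<in> borel_measurable borel"
  shows "(\<integral>\<^sup>+x. \<phi> x \<partial>gaussian \<tau>) = (\<integral>\<^sup>+x. ennreal (gauss_dens \<tau> x) * \<phi> x \<partial>lborel)"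
  unfolding gaussian_def gauss_dens_def by (subst nn_integral_density) auto

lemma nn_integral_lborel_affine:
  fixes \<phi> :: "'a::euclidean_space \<Rightarrow> ennreal"
  assumes [measurable]: "\<phi> \<in> borel_measurable borel" and c: "c \<noteq> 0"
  shows "(\<integral>\<^sup>+x. \<phi> x \<partial>lborel) = ennreal (\<bar>c\<bar> ^ DIM('a)) * (\<integral>\<^sup>+x. \<phi> (t + c *\<^sub>R x) \<partial>lborel)"
  by (subst lborel_affine[OF c, of t]) (simp add: nn_integral_density nn_integral_distr nn_integral_cmult)

lemma nn_integral_lborel_translate:
  fixes \<phi> :: "'a::euclidean_space \<Rightarrow> ennreal"
  assumes [measurable]: "\<phi> \<in> borel_measurable borel"
  shows "(\<integral>\<^sup>+x. \<phi> (a + x) \<partial>lborel) = (\<integral>\<^sup>+x. \<phi> x \<partial>lborel)"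
  using nn_integral_lborel_affine[of \<phi> 1 a] by simp

lemma nn_integral_lborel_uminus:
  fixes \<phi> :: "'a::euclidean_space \<Rightarrow> ennreal"
  assumes [measurable]: "\<phi> \<in> borel_measurable borel"
  shows "(\<integral>\<^sup>+x. \<phi> (- x) \<partial>lborel) = (\<integral>\<^sup>+x. \<phi> x \<partial>lborel)"
  using nn_integral_lborel_affine[of \<phi> "-1" 0] by simp

text \<open>The exponential of a squared norm factors over the coordinates, which reduces the
  normalisation of \<open>gauss_dens\<close> to the one-dimensional normal law.\<close>

lemma gauss_dens_prod:
  fixes x :: "real ^ 'n::finite"
  assumes "\<tau> > 0"
  shows "gauss_dens \<tau> x = (\<Prod>b\<in>Basis. normal_density 0 (sqrt \<tau>) (x \<bullet> b))"
proof -
  have "(\<Prod>b\<in>(Basis :: (real ^ 'n) set). normal_density 0 (sqrt \<tau>) (x \<bullet> b))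
     = (1 / sqrt (2 * pi * \<tau>)) ^ CARD('n) * exp (\<Sum>b\<in>Basis. - (x \<bullet> b)\<^sup>2 / (2 * \<tau>))"
    using assms by (simp add: normal_density_def prod.distrib exp_sum power_divide prod_dividef)
  also have "(\<Sum>b\<in>Basis. - (x \<bullet> b)\<^sup>2 / (2 * \<tau>)) = - (norm x)\<^sup>2 / (2 * \<tau>)"
    by (simp add: norm_eq_sqrt_inner euclidean_inner[of x x] sum_nonneg power2_eq_square
        sum_divide_distrib sum_negf)
  also have "(1 / sqrt (2 * pi * \<tau>)) ^ CARD('n) = 1 / (2 * pi * \<tau>) powr (real CARD('n) / 2)"
    using assms by (simp add: power_divide powr_half_sqrt[symmetric] powr_realpow[symmetric] powr_powr)
  finally show ?thesis by (simp add: gauss_dens_def)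
qed

lemma nn_integral_gauss_dens:
  assumes "\<tau> > 0"
  shows "(\<integral>\<^sup>+x. ennreal (gauss_dens \<tau> x) \<partial>(lborel :: (real ^ 'n::finite) measure)) = 1"
proof -
  have 1: "(\<integral>\<^sup>+x. ennreal (normal_density 0 (sqrt \<tau>) x) \<partial>lborel) = 1"
    using assms by (subst nn_integral_eq_integral) auto
  show ?thesis
    using assms by (simp add: gauss_dens_prod flip: prod_ennreal) (subst nn_integral_lborel_prod, auto simp: 1)
qed

lemma prob_space_gaussian: "\<tau> > 0 \<Longrightarrow> prob_space (gaussian \<tau>)"
  using nn_integral_gaussian[of "\<lambda>_. 1" \<tau>] by (intro prob_spaceI) (simp add: nn_integral_gauss_dens)

section \<open>Translation and convolution of Gaussian measures\<close>

lemma nn_integral_gaussian_translate: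
  fixes \<phi> :: "real ^ 'n::finite \<Rightarrow> ennreal"
  assumes [measurable]: "\<phi> \<in> borel_measurable borel"
  shows "(\<integral>\<^sup>+z. \<phi> (x + z) \<partial>gaussian \<tau>) = (\<integral>\<^sup>+w. ennreal (gauss_dens \<tau> (w - x)) * \<phi> w \<partial>lborel)"
  by (subst nn_integral_lborel_translate[symmetric, of _ x]) (auto simp: nn_integral_gaussian)

lemma gauss_dens_shift:
  assumes "\<tau> > 0"
  shows "gauss_dens \<tau> (y + z - x) = gauss_dens \<tau> z * exp (- (z \<bullet> (y - x)) / \<tau> - (norm (y - x))\<^sup>2 / (2 * \<tau>))"
proof -
  have "(norm (y + z - x))\<^sup>2 = (norm z)\<^sup>2 + 2 * (z \<bullet> (y - x)) + (norm (y - x))\<^sup>2"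
    by (simp add: power2_norm_eq_inner algebra_simps inner_commute)
  then have "- (norm (y + z - x))\<^sup>2 / (2 * \<tau>)
    = - (norm z)\<^sup>2 / (2 * \<tau>) + (- (z \<bullet> (y - x)) / \<tau> - (norm (y - x))\<^sup>2 / (2 * \<tau>))"
    using assms by (simp add: field_simps)
  then show ?thesis
    unfolding gauss_dens_def by (simp only: exp_add times_divide_eq_left)
qed

text \<open>The Cameron-Martin formula: recentring at \<open>y\<close> is paid for by an exponential
  weight. Both estimates of one time step use it to compare \<open>log_heat\<close> at
  \<open>x\<close> with averages around another point.\<close>

lemma nn_integral_gaussian_shift:
  fixes \<phi> :: "real ^ 'n::finite \<Rightarrow> ennreal"
  assumes [measurable]: "\<phi> \<in> borel_measurable borel" and "\<tau> > 0"
  shows "(\<integral>\<^sup>+z. \<phi> (x + z) \<partial>gaussian \<tau>)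
    = (\<integral>\<^sup>+z. ennreal (exp (- (z \<bullet> (y - x)) / \<tau> - (norm (y - x))\<^sup>2 / (2 * \<tau>))) * \<phi> (y + z) \<partial>gaussian \<tau>)"
proof -
  have "(\<integral>\<^sup>+z. \<phi> (x + z) \<partial>gaussian \<tau>) = (\<integral>\<^sup>+z. ennreal (gauss_dens \<tau> (y + z - x)) * \<phi> (y + z) \<partial>lborel)"
    by (subst nn_integral_lborel_translate[of _ y]) (auto simp: nn_integral_gaussian_translate)
  then show ?thesis
    using assms by (simp add: gauss_dens_shift nn_integral_gaussian ennreal_mult mult.assoc)
qed

text \<open>The exponent is half of the one in the density, so the product is a multiple of the
  density of variance \<open>2 * \<tau>\<close>, and the constant is the ratio of the
  normalisations. This weight absorbs the remainder of one time step and reappears in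
  \<open>log_heat_concentration\<close>.\<close>

lemma nn_integral_gaussian_exp_square:
  assumes "\<tau> > 0"
  shows "(\<integral>\<^sup>+z. ennreal (exp ((norm z)\<^sup>2 / (4 * \<tau>))) \<partial>(gaussian \<tau> :: (real ^ 'n::finite) measure))
     = ennreal (2 powr (real CARD('n) / 2))"
proof -
  have "gauss_dens \<tau> z * exp ((norm z)\<^sup>2 / (4 * \<tau>)) = 2 powr (real CARD('n) / 2) * gauss_dens (2 * \<tau>) z"
    for z :: "real ^ 'n"
  proof -
    have *: "(2 * pi * (2 * \<tau>)) powr (real CARD('n) / 2)
      = 2 powr (real CARD('n) / 2) * (2 * pi * \<tau>) powr (real CARD('n) / 2)"
      using assms by (subst powr_mult[symmetric]) (auto simp: mult_ac)
    have "- (norm z)\<^sup>2 / (2 * \<tau>) + (norm z)\<^sup>2 / (4 * \<tau>) = - (norm z)\<^sup>2 / (2 * (2 * \<tau>))"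
      using assms by (simp add: field_simps)
    then show ?thesis
      unfolding gauss_dens_def * by (simp flip: exp_add)
  qed
  then have "(\<integral>\<^sup>+z. ennreal (exp ((norm z)\<^sup>2 / (4 * \<tau>))) \<partial>(gaussian \<tau> :: (real ^ 'n) measure))
     = (\<integral>\<^sup>+z. ennreal (2 powr (real CARD('n) / 2)) * ennreal (gauss_dens (2 * \<tau>) z) \<partial>(lborel :: (real ^ 'n) measure))"
    by (simp add: nn_integral_gaussian flip: ennreal_mult)
  then show ?thesis
    using assms by (simp add: nn_integral_cmult nn_integral_gauss_dens)
qed

text \<open>Completing the square in \<open>y\<close>. The identity serves twice: integrated over
  \<open>y\<close> it gives the convolution of Gaussians, and unintegrated it describes the heat
  flow of a perturbed quadratic.\<close>

lemma gauss_dens_mult: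
  fixes x y :: "real ^ 'n::finite"
  assumes "s > 0" "t > 0"
  shows "gauss_dens s (x - y) * gauss_dens t y
     = gauss_dens (s + t) x * gauss_dens (s * t / (s + t)) (y - (t / (s + t)) *\<^sub>R x)"
proof -
  have "(norm (x - y))\<^sup>2 / (2 * s) + (norm y)\<^sup>2 / (2 * t)
    = (norm x)\<^sup>2 / (2 * (s + t)) + (norm (y - (t / (s + t)) *\<^sub>R x))\<^sup>2 / (2 * (s * t / (s + t)))"
  proof -
    define X Y Z where "X = x \<bullet> x" and "Y = y \<bullet> y" and "Z = x \<bullet> y"
    have *: "(norm (x - y))\<^sup>2 = X + Y - 2 * Z" "(norm y)\<^sup>2 = Y" "(norm x)\<^sup>2 = X"
      "(norm (y - (t / (s + t)) *\<^sub>R x))\<^sup>2 = Y - 2 * (t / (s + t)) * Z + (t / (s + t))\<^sup>2 * X"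
      unfolding power2_norm_eq_inner X_def Y_def Z_def
      by (simp_all add: algebra_simps inner_commute power2_eq_square)
    \<comment> \<open>Naming the sum clears the nested denominators: after \<open>s = r - t\<close>
      a polynomial identity remains.\<close>
    define r where "r = s + t"
    have r: "r > 0" "s = r - t" "r - t > 0" using assms by (auto simp: r_def)
    show ?thesis
      unfolding * using r assms(2) unfolding r_def[symmetric] r(2)
      by (simp add: divide_simps) algebra
  qed
  then have E: "- (norm (x - y))\<^sup>2 / (2 * s) + - (norm y)\<^sup>2 / (2 * t)
    = - (norm x)\<^sup>2 / (2 * (s + t)) + - (norm (y - (t / (s + t)) *\<^sub>R x))\<^sup>2 / (2 * (s * t / (s + t)))"
    by simp
  have "(2 * pi * s) powr (real CARD('n) / 2) * (2 * pi * t) powr (real CARD('n) / 2)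
    = (2 * pi * (s + t)) powr (real CARD('n) / 2) * (2 * pi * (s * t / (s + t))) powr (real CARD('n) / 2)"
    
  proof -
    have "(2 * pi * s) * (2 * pi * t) = (2 * pi * (s + t)) * (2 * pi * (s * t / (s + t)))"
      using assms by (simp add: field_simps)
    then show ?thesis
      using assms by (simp only: powr_mult[symmetric])
  qed
  with E show ?thesis
    unfolding gauss_dens_def by (simp only: times_divide_times_eq exp_add[symmetric])
qed

lemma gaussian_semigroup:
  fixes \<phi> :: "real ^ 'n::finite \<Rightarrow> ennreal"
  assumes [measurable]: "\<phi> \<in> borel_measurable borel" and st: "s > 0" "t > 0"
  shows "(\<integral>\<^sup>+z. (\<integral>\<^sup>+w. \<phi> (z + w) \<partial>gaussian t) \<partial>gaussian s) = (\<integral>\<^sup>+z. \<phi> z \<partial>gaussian (s + t))"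
proof -
  have *: "(\<integral>\<^sup>+z. ennreal (gauss_dens s z) * ennreal (gauss_dens t (w - z)) \<partial>lborel) = ennreal (gauss_dens (s + t) w)"
    for w :: "real ^ 'n"
  proof -
    have "(\<integral>\<^sup>+z. ennreal (gauss_dens s z) * ennreal (gauss_dens t (w - z)) \<partial>lborel)
      = (\<integral>\<^sup>+z. ennreal (gauss_dens (t + s) w) * ennreal (gauss_dens (t * s / (t + s)) (z - (s / (t + s)) *\<^sub>R w)) \<partial>lborel)"
      using gauss_dens_mult[OF st(2,1), of w] by (simp add: mult.commute flip: ennreal_mult)
    also have "\<dots> = ennreal (gauss_dens (t + s) w) * (\<integral>\<^sup>+z. ennreal (gauss_dens (t * s / (t + s)) (- ((s / (t + s)) *\<^sub>R w) + z)) \<partial>lborel)"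
      by (simp add: nn_integral_cmult)
    also have "\<dots> = ennreal (gauss_dens (t + s) w)"
      using st by (subst nn_integral_lborel_translate) (auto simp: nn_integral_gauss_dens)
    finally show ?thesis by (simp add: add.commute)
  qed
  have "(\<integral>\<^sup>+z. (\<integral>\<^sup>+w. \<phi> (z + w) \<partial>gaussian t) \<partial>gaussian s)
    = (\<integral>\<^sup>+z. ennreal (gauss_dens s z) * (\<integral>\<^sup>+w. ennreal (gauss_dens t (w - z)) * \<phi> w \<partial>lborel) \<partial>lborel)"
    by (subst nn_integral_gaussian_translate) (auto simp: nn_integral_gaussian)
  also have "\<dots> = (\<integral>\<^sup>+z. \<integral>\<^sup>+w. ennreal (gauss_dens s z) * (ennreal (gauss_dens t (w - z)) * \<phi> w) \<partial>lborel \<partial>lborel)"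
    by (simp add: nn_integral_cmult)
  also have "\<dots> = (\<integral>\<^sup>+w. \<integral>\<^sup>+z. ennreal (gauss_dens s z) * (ennreal (gauss_dens t (w - z)) * \<phi> w) \<partial>lborel \<partial>lborel)"
    by (rule lborel_pair.Fubini') measurable
  also have "\<dots> = (\<integral>\<^sup>+w. ennreal (gauss_dens (s + t) w) * \<phi> w \<partial>lborel)"
    by (simp add: mult.assoc[symmetric] nn_integral_multc *)
  finally show ?thesis by (simp add: nn_integral_gaussian)
qed

section \<open>Symmetry and moments\<close>

lemma nn_integral_gaussian_uminus:
  fixes \<phi> :: "real ^ 'n::finite \<Rightarrow> ennreal"
  assumes [measurable]: "\<phi> \<in> borel_measurable borel"
  shows "(\<integral>\<^sup>+x. \<phi> (- x) \<partial>gaussian \<tau>) = (\<integral>\<^sup>+x. \<phi> x \<partial>gaussian \<tau>)"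
  by (simp add: nn_integral_gaussian gauss_dens_def nn_integral_lborel_uminus[of "\<lambda>x. ennreal (exp (- (norm x)\<^sup>2 / (2 * \<tau>)) / (2 * pi * \<tau>) powr (real CARD('n) / 2)) * \<phi> x", simplified])

lemma distr_gaussian_uminus: "distr (gaussian \<tau>) borel uminus = (gaussian \<tau> :: (real ^ 'n::finite) measure)"
proof (rule measure_eqI)
  fix A :: "(real ^ 'n) set" assume "A \<in> sets (distr (gaussian \<tau>) borel uminus)"
  then have [measurable]: "A \<in> sets borel" by simp
  have "emeasure (distr (gaussian \<tau>) borel uminus) A = (\<integral>\<^sup>+x. indicator A x \<partial>distr (gaussian \<tau>) borel uminus)"
    by (subst nn_integral_indicator) auto
  also have "\<dots> = (\<integral>\<^sup>+x. indicator A x \<partial>gaussian \<tau>)"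
    by (subst nn_integral_distr) (auto simp: nn_integral_gaussian_uminus[of "indicator A"] simp del: nn_integral_indicator)
  also have "\<dots> = emeasure (gaussian \<tau>) A"
    by (subst nn_integral_indicator) auto
  finally show "emeasure (distr (gaussian \<tau>) borel uminus) A = emeasure (gaussian \<tau>) A" .
qed simp

lemma integrable_gaussian_exp_square:
  assumes "\<tau> > 0"
  shows "integrable (gaussian \<tau> :: (real ^ 'n::finite) measure) (\<lambda>z. exp ((norm z)\<^sup>2 / (4 * \<tau>)))"
    and "(\<integral>z. exp ((norm z)\<^sup>2 / (4 * \<tau>)) \<partial>(gaussian \<tau> :: (real ^ 'n::finite) measure)) = 2 powr (real CARD('n) / 2)"
proof -
  show "integrable (gaussian \<tau> :: (real ^ 'n::finite) measure) (\<lambda>z. exp ((norm z)\<^sup>2 / (4 * \<tau>)))"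
    using assms by (intro integrableI_bounded) (auto simp: nn_integral_gaussian_exp_square)
  show "(\<integral>z. exp ((norm z)\<^sup>2 / (4 * \<tau>)) \<partial>(gaussian \<tau> :: (real ^ 'n::finite) measure)) = 2 powr (real CARD('n) / 2)"
    using assms by (simp add: integral_eq_nn_integral nn_integral_gaussian_exp_square)
qed

lemma integrable_gaussian_norm_square:
  assumes "\<tau> > 0"
  shows "integrable (gaussian \<tau> :: (real ^ 'n::finite) measure) (\<lambda>z. (norm z)\<^sup>2)"
proof (rule Bochner_Integration.integrable_bound)
  show "integrable (gaussian \<tau> :: (real ^ 'n::finite) measure) (\<lambda>z. 4 * \<tau> * exp ((norm z)\<^sup>2 / (4 * \<tau>)))"
    by (intro integrable_mult_right integrable_gaussian_exp_square(1) assms)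
  have "(norm z)\<^sup>2 \<le> 4 * \<tau> * exp ((norm z)\<^sup>2 / (4 * \<tau>))" for z :: "real ^ 'n"
    using exp_ge_add_one_self[of "(norm z)\<^sup>2 / (4 * \<tau>)"] assms by (simp add: field_simps)
  then show "AE z in (gaussian \<tau> :: (real ^ 'n) measure). norm ((norm z)\<^sup>2) \<le> norm (4 * \<tau> * exp ((norm z)\<^sup>2 / (4 * \<tau>)))"
    using assms by auto
qed simp

lemma integrable_gaussian_norm:
  assumes "\<tau> > 0"
  shows "integrable (gaussian \<tau> :: (real ^ 'n::finite) measure) norm"
proof (rule Bochner_Integration.integrable_bound)
  interpret prob_space "gaussian \<tau> :: (real ^ 'n::finite) measure" by (rule prob_space_gaussian[OF assms])
  show "integrable (gaussian \<tau> :: (real ^ 'n::finite) measure) (\<lambda>z. 1 + (norm z)\<^sup>2)"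
    by (intro Bochner_Integration.integrable_add integrable_const integrable_gaussian_norm_square assms)
  have "x \<le> 1 + x\<^sup>2" for x :: real
    using zero_le_power2[of "x - 1/2"] by (simp add: power2_eq_square algebra_simps)
  then show "AE z in (gaussian \<tau> :: (real ^ 'n) measure). norm (norm z) \<le> norm (1 + (norm z)\<^sup>2)"
    by (auto simp: abs_of_nonneg)
qed simp

lemma gaussian_inner:
  fixes v :: "real ^ 'n::finite"
  assumes "\<tau> > 0"
  shows "integrable (gaussian \<tau>) (\<lambda>z. z \<bullet> v)" and "(\<integral>z. z \<bullet> v \<partial>gaussian \<tau>) = 0"
proof -
  show "integrable (gaussian \<tau>) (\<lambda>z. z \<bullet> v)"
    by (rule Bochner_Integration.integrable_bound[OF integrable_mult_left[OF integrable_gaussian_norm[OF assms], of "norm v"]])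
      (auto simp: Cauchy_Schwarz_ineq2)
  have "(\<integral>z. z \<bullet> v \<partial>gaussian \<tau>) = (\<integral>z. z \<bullet> v \<partial>distr (gaussian \<tau>) borel uminus)"
    by (simp add: distr_gaussian_uminus)
  also have "\<dots> = - (\<integral>z. z \<bullet> v \<partial>gaussian \<tau>)"
    by (subst integral_distr) auto
  finally show "(\<integral>z. z \<bullet> v \<partial>gaussian \<tau>) = 0" by simp
qed

subsection \<open>The logarithmic heat flow\<close>

definition log_heat :: "real \<Rightarrow> (real ^ 'n::finite \<Rightarrow> real) \<Rightarrow> real ^ 'n \<Rightarrow> real" where
  "log_heat h f x = - ln (\<integral>z. exp (- f (x + z)) \<partial>gaussian h)"

lemma integral_gaussian_shift:
  fixes \<phi> :: "real ^ 'n::finite \<Rightarrow> real"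
  assumes [measurable]: "\<phi> \<in> borel_measurable borel" and nn: "\<And>z. \<phi> z \<ge> 0" and h: "h > 0"
    and int: "integrable (gaussian h) (\<lambda>z. \<phi> (x + z))"
  shows "integrable (gaussian h) (\<lambda>z. exp (- (z \<bullet> (y - x)) / h - (norm (y - x))\<^sup>2 / (2 * h)) * \<phi> (y + z))"
    and "(\<integral>z. \<phi> (x + z) \<partial>gaussian h)
      = (\<integral>z. exp (- (z \<bullet> (y - x)) / h - (norm (y - x))\<^sup>2 / (2 * h)) * \<phi> (y + z) \<partial>gaussian h)"
proof -
  have eq: "(\<integral>\<^sup>+z. ennreal (\<phi> (x + z)) \<partial>gaussian h)
      = (\<integral>\<^sup>+z. ennreal (exp (- (z \<bullet> (y - x)) / h - (norm (y - x))\<^sup>2 / (2 * h)) * \<phi> (y + z)) \<partial>gaussian h)"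
    using nn_integral_gaussian_shift[of "\<lambda>z. ennreal (\<phi> z)" h x y] h nn by (simp add: ennreal_mult)
  then show "(\<integral>z. \<phi> (x + z) \<partial>gaussian h)
      = (\<integral>z. exp (- (z \<bullet> (y - x)) / h - (norm (y - x))\<^sup>2 / (2 * h)) * \<phi> (y + z) \<partial>gaussian h)"
    using nn by (simp add: integral_eq_nn_integral)
  have "(\<integral>\<^sup>+z. ennreal (\<phi> (x + z)) \<partial>gaussian h) < \<infinity>"
    using int nn by (simp add: integrable_iff_bounded)
  then show "integrable (gaussian h) (\<lambda>z. exp (- (z \<bullet> (y - x)) / h - (norm (y - x))\<^sup>2 / (2 * h)) * \<phi> (y + z))"
    using nn unfolding eq by (intro integrableI_bounded) (auto simp: abs_of_nonneg)
qed

lemma integrable_exp_neg: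
  fixes f :: "real ^ 'n::finite \<Rightarrow> real"
  assumes "f \<in> borel_measurable borel" and "\<And>x. f x \<ge> 0" and "h > 0"
  shows "integrable (gaussian h) (\<lambda>z. exp (- f (x + z)))"
proof -
  note [measurable] = assms(1)
  interpret prob_space "gaussian h :: (real ^ 'n) measure" by (rule prob_space_gaussian[OF assms(3)])
  show ?thesis
    by (rule integrable_const_bound[where B=1]) (use assms in auto)
qed

lemma exp_log_heat:
  fixes f :: "real ^ 'n::finite \<Rightarrow> real"
  assumes "f \<in> borel_measurable borel" and "\<And>x. f x \<ge> 0" and "h > 0"
  shows "exp (- log_heat h f x) = (\<integral>z. exp (- f (x + z)) \<partial>gaussian h)"
    and "(\<integral>z. exp (- f (x + z)) \<partial>gaussian h) > 0"
proof -
  note [measurable] = assms(1)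
  interpret prob_space "gaussian h :: (real ^ 'n) measure" by (rule prob_space_gaussian[OF assms(3)])
  have int: "integrable (gaussian h) (\<lambda>z. exp (- f (x + z)))"
    by (rule integrable_exp_neg[OF assms])
  have "(\<integral>z. exp (- f (x + z)) \<partial>gaussian h) \<noteq> 0"
  proof
    assume "(\<integral>z. exp (- f (x + z)) \<partial>gaussian h) = 0"
    then have "AE z in (gaussian h :: (real ^ 'n) measure). exp (- f (x + z)) = 0"
      using int by (subst (asm) integral_nonneg_eq_0_iff_AE) auto
    then show False by simp
  qed
  moreover have "(\<integral>z. exp (- f (x + z)) \<partial>gaussian h) \<ge> 0"
    by (rule integral_nonneg_AE) simp
  ultimately show pos: "(\<integral>z. exp (- f (x + z)) \<partial>gaussian h) > 0"
    by linarith
  then show "exp (- log_heat h f x) = (\<integral>z. exp (- f (x + z)) \<partial>gaussian h)"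
    by (simp add: log_heat_def)
qed

lemma log_heat_nonneg:
  fixes f :: "real ^ 'n::finite \<Rightarrow> real"
  assumes "f \<in> borel_measurable borel" and "\<And>x. f x \<ge> 0" and "h > 0"
  shows "log_heat h f x \<ge> 0"
proof -
  note [measurable] = assms(1)
  interpret prob_space "gaussian h :: (real ^ 'n) measure" by (rule prob_space_gaussian[OF assms(3)])
  have "(\<integral>z. exp (- f (x + z)) \<partial>gaussian h) \<le> (\<integral>z. 1 \<partial>(gaussian h :: (real ^ 'n) measure))"
    by (rule integral_mono) (use assms integrable_exp_neg[OF assms] in auto)
  then have "exp (- log_heat h f x) \<le> 1"
    using exp_log_heat[OF assms] by (simp add: prob_space[simplified])
  then show ?thesis by simp
qed

lemma log_heat_mono:
  fixes f g :: "real ^ 'n::finite \<Rightarrow> real"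
  assumes "f \<in> borel_measurable borel" and "\<And>x. f x \<ge> 0" and "h > 0"
    and "g \<in> borel_measurable borel" and "\<And>x. f x \<le> g x"
  shows "log_heat h f x \<le> log_heat h g x"
proof -
  have g: "g x \<ge> 0" for x using assms(2,5)[of x] by linarith
  have "exp (- log_heat h g x) \<le> exp (- log_heat h f x)"
    using assms g by (auto simp: exp_log_heat intro!: integral_mono integrable_exp_neg)
  then show ?thesis by simp
qed

lemma borel_measurable_log_heat [measurable (raw)]:
  fixes f :: "'a \<Rightarrow> real ^ 'n::finite \<Rightarrow> real"
  assumes [measurable]: "case_prod f \<in> borel_measurable (M \<Otimes>\<^sub>M borel)" "g \<in> borel_measurable M" and h: "h > 0"
  shows "(\<lambda>s. log_heat h (f s) (g s)) \<in> borel_measurable M"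
proof -
  interpret prob_space "gaussian h :: (real ^ 'n) measure" by (rule prob_space_gaussian[OF h])
  have [measurable]: "(\<lambda>p. f (fst p) (g (fst p) + snd p)) \<in> borel_measurable (M \<Otimes>\<^sub>M gaussian h)"
    by measurable
  show ?thesis
    unfolding log_heat_def by measurable
qed

lemma continuous_on_log_heat:
  fixes f :: "real ^ 'n::finite \<Rightarrow> real"
  assumes f: "continuous_on UNIV f" "\<And>x. f x \<ge> 0" and h: "h > 0"
  shows "continuous_on UNIV (log_heat h f)"
proof -
  have [measurable]: "f \<in> borel_measurable borel"
    using f(1) by (rule borel_measurable_continuous_onI)
  interpret prob_space "gaussian h :: (real ^ 'n) measure" by (rule prob_space_gaussian[OF h])
  have "isCont (\<lambda>x. \<integral>z. exp (- f (x + z)) \<partial>gaussian h) x" for x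
  proof (rule continuous_at_sequentiallyI)
    fix u assume u: "u \<longlonglongrightarrow> x"
    show "(\<lambda>n. \<integral>z. exp (- f (u n + z)) \<partial>gaussian h) \<longlonglongrightarrow> (\<integral>z. exp (- f (x + z)) \<partial>gaussian h)"
    proof (rule integral_dominated_convergence[where w="\<lambda>_. 1"])
      show "AE z in (gaussian h :: (real ^ 'n) measure). (\<lambda>n. exp (- f (u n + z))) \<longlonglongrightarrow> exp (- f (x + z))"
        using f(1) u by (auto intro!: tendsto_intros continuous_on_tendsto_compose[where f=f])
    qed (use f in auto)
  qed
  moreover have "(\<integral>z. exp (- f (x + z)) \<partial>gaussian h) > 0" for x
    by (rule exp_log_heat) (use f h in auto)
  ultimately show ?thesis
    unfolding log_heat_def by (auto simp: continuous_on_eq_continuous_at intro!: continuous_intros)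
       (metis less_irrefl)
qed

text \<open>The outer exponential undoes the inner logarithm, so this is
  \<open>gaussian_semigroup\<close> applied to exp (-f).\<close>

lemma log_heat_semigroup:
  fixes f :: "real ^ 'n::finite \<Rightarrow> real"
  assumes f[measurable]: "f \<in> borel_measurable borel" and nn: "\<And>x. f x \<ge> 0" and st: "s > 0" "t > 0"
  shows "log_heat s (log_heat t f) x = log_heat (s + t) f x"
proof -
  have E: "ennreal (exp (- log_heat u f y)) = (\<integral>\<^sup>+z. ennreal (exp (- f (y + z))) \<partial>gaussian u)" if "u > 0" for u y
    using that f nn by (subst exp_log_heat) (auto simp: integrable_exp_neg nn_integral_eq_integral)
  have m[measurable]: "log_heat t f \<in> borel_measurable borel"
    using st by measurable
  have "ennreal (exp (- log_heat s (log_heat t f) x)) = (\<integral>\<^sup>+z. ennreal (exp (- log_heat t f (x + z))) \<partial>gaussian s)"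
    using m st nn by (subst exp_log_heat) (auto simp: integrable_exp_neg nn_integral_eq_integral log_heat_nonneg)
  also have "\<dots> = (\<integral>\<^sup>+z. (\<integral>\<^sup>+w. ennreal (exp (- f (x + (z + w)))) \<partial>gaussian t) \<partial>gaussian s)"
    using st by (simp add: E add.assoc)
  also have "\<dots> = ennreal (exp (- log_heat (s + t) f x))"
    using gaussian_semigroup[of "\<lambda>z. ennreal (exp (- f (x + z)))" s t] st by (simp add: E)
  finally show ?thesis by simp
qed

text \<open>Gibbs' variational principle with the test measure \<open>\<gamma>\<^sub>h\<close> translated by \<open>y - x\<close>.\<close>

lemma log_heat_le:
  fixes f :: "real ^ 'n::finite \<Rightarrow> real"
  assumes f[measurable]: "f \<in> borel_measurable borel" and nn: "\<And>x. f x \<ge> 0" and h: "h > 0"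
  shows "ennreal (log_heat h f x) \<le> (\<integral>\<^sup>+z. ennreal (f (y + z)) \<partial>gaussian h) + ennreal ((norm (x - y))\<^sup>2 / (2 * h))"
proof (cases "(\<integral>\<^sup>+z. ennreal (f (y + z)) \<partial>gaussian h) = \<infinity>")
  case False
  interpret prob_space "gaussian h :: (real ^ 'n) measure" by (rule prob_space_gaussian[OF h])
  have int: "integrable (gaussian h) (\<lambda>z. f (y + z))"
    using False nn by (intro integrableI_bounded) (auto simp: abs_of_nonneg top.not_eq_extremum)
  \<comment> \<open>The logarithm of the integrand after recentring at \<open>y\<close>. Its linear
    term has mean zero, so its mean is minus the right-hand side of the claim.\<close>
  define a where "a z = - (z \<bullet> (y - x)) / h - (norm (y - x))\<^sup>2 / (2 * h) - f (y + z)" for z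
  have a: "integrable (gaussian h) a" "(\<integral>z. a z \<partial>gaussian h) = - (norm (y - x))\<^sup>2 / (2 * h) - (\<integral>z. f (y + z) \<partial>gaussian h)"
    unfolding a_def using int gaussian_inner[OF h, of "y - x"] by (simp_all add: prob_space[simplified])
  define m where "m = (\<integral>z. a z \<partial>gaussian h)"
  have me: "(\<lambda>z. exp (- f z)) \<in> borel_measurable borel" by measurable
  have *: "exp (- (z \<bullet> (y - x)) / h - (norm (y - x))\<^sup>2 / (2 * h)) * exp (- f (y + z)) = exp (a z)" for z
    unfolding a_def by (simp flip: exp_add)
  note sh = integral_gaussian_shift[OF me exp_ge_zero h integrable_exp_neg[OF f nn h], where x=x and y=y, unfolded *]
  \<comment> \<open>Jensen's inequality, by the tangent of exp at the mean \<open>m\<close>.\<close>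
  have "exp m = (\<integral>z. exp m * (1 + a z - m) \<partial>gaussian h)"
    using a by (simp add: m_def prob_space[simplified])
  also have "\<dots> \<le> (\<integral>z. exp (a z) \<partial>gaussian h)"
  proof (rule integral_mono)
    show "integrable (gaussian h) (\<lambda>z. exp (a z))"
      by (rule sh(1))
    fix z
    have "exp m * (1 + (a z - m)) \<le> exp m * exp (a z - m)"
      by (intro mult_left_mono exp_ge_add_one_self) auto
    then show "exp m * (1 + a z - m) \<le> exp (a z)"
      by (simp add: algebra_simps flip: exp_add)
  qed (use a in simp)
  also have "\<dots> = exp (- log_heat h f x)"
    using sh(2) by (simp add: exp_log_heat[OF f nn h])
  finally have "log_heat h f x \<le> - m" by simp
  then have "log_heat h f x \<le> (\<integral>z. f (y + z) \<partial>gaussian h) + (norm (x - y))\<^sup>2 / (2 * h)"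
    by (simp add: m_def a norm_minus_commute)
  then have "ennreal (log_heat h f x) \<le> ennreal ((\<integral>z. f (y + z) \<partial>gaussian h) + (norm (x - y))\<^sup>2 / (2 * h))"
    by (rule ennreal_leI)
  also have "\<dots> = (\<integral>\<^sup>+z. ennreal (f (y + z)) \<partial>gaussian h) + ennreal ((norm (x - y))\<^sup>2 / (2 * h))"
    using int nn h by (simp add: nn_integral_eq_integral)
  finally show ?thesis .
qed simp

text \<open>A derivative-free form of -L \<le> Hessian \<le> L. It speaks of three values only, so
  it can be followed through logarithms of integrals without differentiating under them.\<close>

definition second_diff_bounded :: "real \<Rightarrow> ('a::real_normed_vector \<Rightarrow> real) \<Rightarrow> bool" where
  "second_diff_bounded L v \<longleftrightarrow> (\<forall>x y. \<bar>v (x + y) + v (x - y) - 2 * v x\<bar> \<le> L * (norm y)\<^sup>2)"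

text \<open>The base point \<open>w\<close> is the minimiser of \<open>v + \<bar>\<cdot> - x\<bar>\<^sup>2 / 2h\<close>, an implicit Euler step. Minimality
  gives a quadratic lower bound with constant \<open>1 / 2h\<close>, and repeated halving improves the constant
  to one that depends on \<open>L\<close> only.\<close>

lemma proximal_point:
  fixes v :: "'a::euclidean_space \<Rightarrow> real"
  assumes cont: "continuous_on UNIV v" and nn: "\<And>x. v x \<ge> 0" and h: "h > 0" and L: "second_diff_bounded L v"
  obtains w where "\<And>z. \<bar>v (w + z) - v w - (z \<bullet> (x - w)) / h\<bar> \<le> 3 / 2 * L * (norm z)\<^sup>2"
proof -
  define \<phi> where "\<phi> y = v y + (norm (y - x))\<^sup>2 / (2 * h)" for y
  \<comment> \<open>Outside the ball of this radius the quadratic term alone is at least v x + 1,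
    which exceeds the value \<phi> x = v x at the centre; so a minimum over the ball is
    global.\<close>
  define R where "R = sqrt (2 * h * (v x + 1))"
  have R: "R\<^sup>2 = 2 * h * (v x + 1)" "R > 0"
    using h nn[of x] by (auto simp: R_def intro!: mult_nonneg_nonneg)
  have "\<exists>w\<in>cball x R. \<forall>y\<in>cball x R. \<phi> w \<le> \<phi> y"
    by (rule continuous_attains_inf)
      (use R h in \<open>auto simp: \<phi>_def intro!: continuous_intros continuous_on_subset[OF cont]\<close>)
  then obtain w where w: "\<And>y. y \<in> cball x R \<Longrightarrow> \<phi> w \<le> \<phi> y" by blast
  have min: "\<phi> w \<le> \<phi> y" for y
  proof (cases "y \<in> cball x R")
    case False
    then have "R \<le> norm (y - x)" by (simp add: dist_norm norm_minus_commute)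
    then have "2 * h * (v x + 1) \<le> (norm (y - x))\<^sup>2"
      using R power_mono[of R "norm (y - x)" 2] by simp
    then have "v x + 1 \<le> (norm (y - x))\<^sup>2 / (2 * h)"
      using h by (simp add: field_simps)
    then have "\<phi> x \<le> \<phi> y"
      using nn[of y] by (simp add: \<phi>_def)
    then show ?thesis using w[of x] R by simp
  qed (rule w)
  \<comment> \<open>\<open>v\<close> around \<open>w\<close> minus its expected tangent: (x - w) / h
    is the slope that stationarity of \<phi> at \<open>w\<close> would give, were \<open>v\<close>
    differentiable.\<close>
  define \<psi> where "\<psi> z = v (w + z) - v w - (z \<bullet> (x - w)) / h" for z
  have low: "\<psi> z \<ge> - (norm z)\<^sup>2 / (2 * h)" for z
  proof -
    have "(norm (w + z - x))\<^sup>2 = (norm (w - x))\<^sup>2 - 2 * (z \<bullet> (x - w)) + (norm z)\<^sup>2"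
      by (simp add: power2_norm_eq_inner algebra_simps inner_commute)
    then have "(norm (w + z - x))\<^sup>2 / (2 * h) = (norm (w - x))\<^sup>2 / (2 * h) - (z \<bullet> (x - w)) / h + (norm z)\<^sup>2 / (2 * h)"
      using h by (simp add: field_simps)
    with min[of "w + z"] show ?thesis
      by (simp add: \<phi>_def \<psi>_def)
  qed
  have sd: "\<bar>\<psi> (y + z) + \<psi> (y - z) - 2 * \<psi> y\<bar> \<le> L * (norm z)\<^sup>2" for y z
  proof -
    have "\<psi> (y + z) + \<psi> (y - z) - 2 * \<psi> y = v ((w + y) + z) + v ((w + y) - z) - 2 * v (w + y)"
      by (simp add: \<psi>_def inner_add_left inner_diff_left add_divide_distrib diff_divide_distrib algebra_simps)
    then show ?thesis using L unfolding second_diff_bounded_def by metis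
  qed
  have \<psi>0: "\<psi> 0 = 0" by (simp add: \<psi>_def)
  have halve: "\<psi> z \<ge> 2 * \<psi> ((1/2) *\<^sub>R z) - L * (norm z)\<^sup>2 / 4" for z
  proof -
    have "(1/2) *\<^sub>R z + (1/2) *\<^sub>R z = z" by (simp flip: scaleR_left_distrib)
    then have "\<bar>\<psi> z - 2 * \<psi> ((1/2) *\<^sub>R z)\<bar> \<le> L * (norm z)\<^sup>2 / 4"
      using sd[of "(1/2) *\<^sub>R z" "(1/2) *\<^sub>R z"] by (simp add: \<psi>0 power_divide)
    from abs_le_D2[OF this] show ?thesis
      by simp
  qed
  have iter: "\<psi> z \<ge> 2 ^ k * \<psi> ((1 / 2 ^ k) *\<^sub>R z) - L * (norm z)\<^sup>2 / 2 * (1 - 1 / 2 ^ k)" for k z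
  proof (induction k)
    case (Suc k)
    have "2 ^ k * (2 * \<psi> ((1/2) *\<^sub>R ((1 / 2 ^ k) *\<^sub>R z)) - L * (norm ((1 / 2 ^ k) *\<^sub>R z))\<^sup>2 / 4) \<le> 2 ^ k * \<psi> ((1 / 2 ^ k) *\<^sub>R z)"
      by (intro mult_left_mono halve) auto
    moreover define q where "q = L * (norm z)\<^sup>2 / 2 ^ k"
    have "2 ^ k * (L * (norm ((1 / 2 ^ k) *\<^sub>R z))\<^sup>2 / 4) = q / 4"
      by (simp add: q_def power2_eq_square field_simps)
    moreover have "2 ^ k * (2 * \<psi> ((1/2) *\<^sub>R ((1 / 2 ^ k) *\<^sub>R z))) = 2 ^ Suc k * \<psi> ((1 / 2 ^ Suc k) *\<^sub>R z)"
      by simp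
    moreover have "L * (norm z)\<^sup>2 / 2 * (1 - 1 / 2 ^ k) = L * (norm z)\<^sup>2 / 2 - q / 2"
      "L * (norm z)\<^sup>2 / 2 * (1 - 1 / 2 ^ Suc k) = L * (norm z)\<^sup>2 / 2 - q / 4"
      by (simp_all add: q_def field_simps)
    ultimately show ?case
      using Suc unfolding right_diff_distrib by linarith
  qed simp
  \<comment> \<open>In the limit of infinitely many halvings the crude bound with 1 / (2h) is
    multiplied by 2^-k and disappears. What stays is the geometric series of the halving errors, L/4
    + L/8 + ... = L/2.\<close>
  have lower: "\<psi> z \<ge> - (L * (norm z)\<^sup>2 / 2)" for z
  proof (rule LIMSEQ_le_const2)
    show "(\<lambda>k. - ((norm z)\<^sup>2 / (2 * h)) * (1 / 2) ^ k - L * (norm z)\<^sup>2 / 2 * (1 - (1 / 2) ^ k)) \<longlonglongrightarrow> - (L * (norm z)\<^sup>2 / 2)"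
      by (rule tendsto_eq_intros LIMSEQ_power_zero refl | simp)+
    have "- ((norm z)\<^sup>2 / (2 * h)) * (1 / 2) ^ k - L * (norm z)\<^sup>2 / 2 * (1 - (1 / 2) ^ k) \<le> \<psi> z" for k
    proof -
      have "2 ^ k * (- (norm ((1 / 2 ^ k) *\<^sub>R z))\<^sup>2 / (2 * h)) \<le> 2 ^ k * \<psi> ((1 / 2 ^ k) *\<^sub>R z)"
        by (intro mult_left_mono low) auto
      moreover have "2 ^ k * (- (norm ((1 / 2 ^ k) *\<^sub>R z))\<^sup>2 / (2 * h)) = - ((norm z)\<^sup>2 / (2 * h)) * (1 / 2) ^ k"
        using h by (simp add: power2_eq_square field_simps)
      ultimately show ?thesis
        using iter[of k z] by (simp add: power_one_over)
    qed
    then show "\<exists>N. \<forall>k\<ge>N. - ((norm z)\<^sup>2 / (2 * h)) * (1 / 2) ^ k - L * (norm z)\<^sup>2 / 2 * (1 - (1 / 2) ^ k) \<le> \<psi> z"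
      by blast
  qed
  \<comment> \<open>From above, the second difference at 0 contributes L and the lower bound at
    \<open>- z\<close> contributes L/2.\<close>
  have "\<bar>\<psi> z\<bar> \<le> 3 / 2 * L * (norm z)\<^sup>2" for z
    using lower[of z] lower[of "- z"] sd[of 0 z] \<psi>0 by (auto simp: abs_le_iff)
  then show thesis
    using that[of w] unfolding \<psi>_def by blast
qed

lemma exp_neg_le: "exp (- a) \<le> 1 - a + a\<^sup>2 * exp \<bar>a\<bar> / 2" for a :: real
proof -
  obtain t where t: "\<bar>t\<bar> \<le> \<bar>- a\<bar>" "exp (- a) = (\<Sum>m<2. (- a) ^ m / fact m) + exp t / fact 2 * (- a) ^ 2"
    using Maclaurin_exp_le[of "- a" 2] by blast
  have "exp t * a\<^sup>2 \<le> exp \<bar>a\<bar> * a\<^sup>2"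
    using t(1) by (intro mult_right_mono) auto
  then show ?thesis
    unfolding t(2) by (simp add: numeral_2_eq_2 mult_ac)
qed

lemma integrable_gaussian_continuous:
  fixes v :: "real ^ 'n::finite \<Rightarrow> real"
  assumes cont: "continuous_on UNIV v" and h: "h > 0" and bd: "\<And>x. \<bar>v x\<bar> \<le> a + b * (norm x)\<^sup>2" and b: "b \<ge> 0"
  shows "integrable (gaussian h) (\<lambda>z. v (y + z))" and "continuous_on UNIV (\<lambda>y. \<integral>z. v (y + z) \<partial>gaussian h)"
proof -
  have [measurable]: "v \<in> borel_measurable borel"
    using cont by (rule borel_measurable_continuous_onI)
  interpret prob_space "gaussian h :: (real ^ 'n) measure" by (rule prob_space_gaussian[OF h])
  have bd': "\<bar>v (y + z)\<bar> \<le> a + b * (2 * B\<^sup>2 + 2 * (norm z)\<^sup>2)" if "norm y \<le> B" for y z B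
  proof -
    have "(norm (y + z))\<^sup>2 \<le> (B + norm z)\<^sup>2"
      using norm_triangle_ineq[of y z] that by (intro power_mono) auto
    also have "\<dots> \<le> 2 * B\<^sup>2 + 2 * (norm z)\<^sup>2"
      using zero_le_power2[of "B - norm z"] by (simp add: power2_eq_square algebra_simps)
    finally show ?thesis
      using bd[of "y + z"] mult_left_mono[OF _ b] by fastforce
  qed
  have int: "integrable (gaussian h :: (real ^ 'n) measure) (\<lambda>z. a + b * (2 * B\<^sup>2 + 2 * (norm z)\<^sup>2))" for B
    by (intro Bochner_Integration.integrable_add integrable_const integrable_mult_right integrable_gaussian_norm_square h)
  show "integrable (gaussian h) (\<lambda>z. v (y + z))"
    by (rule Bochner_Integration.integrable_bound[OF int[of "norm y"]])
      (auto intro: order_trans[OF bd'[OF order_refl] abs_ge_self])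
  show "continuous_on UNIV (\<lambda>y. \<integral>z. v (y + z) \<partial>gaussian h)"
    unfolding continuous_on_eq_continuous_at[OF open_UNIV]
  proof (intro ballI continuous_at_sequentiallyI)
    fix y :: "real ^ 'n" and u :: "nat \<Rightarrow> real ^ 'n" assume u: "u \<longlonglongrightarrow> y"
    then have "Bseq u" using convergent_imp_Bseq convergentI by blast
    then obtain B where B: "\<And>n. norm (u n) \<le> B" unfolding Bseq_def by blast
    show "(\<lambda>n. \<integral>z. v (u n + z) \<partial>gaussian h) \<longlonglongrightarrow> (\<integral>z. v (y + z) \<partial>gaussian h)"
    proof (rule integral_dominated_convergence[OF _ _ int[of B]])
      show "AE z in gaussian h. (\<lambda>n. v (u n + z)) \<longlonglongrightarrow> v (y + z)"
        using cont u by (auto intro!: tendsto_intros continuous_on_tendsto_compose[where f=v])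
      show "AE z in gaussian h. norm (v (u n + z)) \<le> a + b * (2 * B\<^sup>2 + 2 * (norm z)\<^sup>2)" for n
        using bd'[OF B] by auto
    qed auto
  qed
qed

text \<open>Recentring at the proximal point \<open>w\<close> makes the linear part of
  \<open>v\<close> cancel against the linear part of the Cameron-Martin weight, which leaves exp (-
  \<psi>) with \<psi> at most quadratic. Its first-order expansion yields the average of
  \<open>v\<close> around \<open>w\<close>. The remainder has order \<psi>^2, hence h^2, because
  |z|^2 has size h under \<open>gaussian h\<close>.\<close>

lemma log_heat_ge:
  fixes v :: "real ^ 'n::finite \<Rightarrow> real"
  assumes cont: "continuous_on UNIV v" and nn: "\<And>x. v x \<ge> 0" and h: "h > 0" and L: "second_diff_bounded L v"
    and L0: "L \<ge> 0" and small: "12 * L * h \<le> 1"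
  obtains w where "\<And>y. integrable (gaussian h) (\<lambda>z. v (y + z))"
    and "continuous_on UNIV (\<lambda>y. \<integral>z. v (y + z) \<partial>gaussian h)"
    and "(\<integral>z. v (w + z) \<partial>gaussian h) + (norm (x - w))\<^sup>2 / (2 * h)
      \<le> log_heat h v x + 144 * L\<^sup>2 * 2 powr (real CARD('n) / 2) * h\<^sup>2"
proof -
  have v[measurable]: "v \<in> borel_measurable borel"
    using cont by (rule borel_measurable_continuous_onI)
  interpret prob_space "gaussian h :: (real ^ 'n) measure" by (rule prob_space_gaussian[OF h])
  obtain w where w: "\<And>z. \<bar>v (w + z) - v w - (z \<bullet> (x - w)) / h\<bar> \<le> 3 / 2 * L * (norm z)\<^sup>2"
    using proximal_point[OF cont nn h L] by blast
  define p where "p = (1 / h) *\<^sub>R (x - w)"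
  define \<psi> where "\<psi> z = v (w + z) - v w - z \<bullet> p" for z
  have \<psi>: "\<bar>\<psi> z\<bar> \<le> 3 / 2 * L * (norm z)\<^sup>2" for z
    using w[of z] by (simp add: \<psi>_def p_def)
  \<comment> \<open>Quadratic growth of \<open>v\<close>, read off from its expansion at
    \<open>w\<close>; it makes all Gaussian averages of \<open>v\<close> finite and continuous in
    their centre.\<close>
  have "\<bar>v y\<bar> \<le> (\<bar>v w\<bar> + norm p + (norm p + 3 / 2 * L) * 2 * (norm w)\<^sup>2) + (norm p + 3 / 2 * L) * 2 * (norm y)\<^sup>2" for y
  proof -
    define z where "z = y - w"
    have "\<bar>z \<bullet> p\<bar> \<le> norm p * norm z"
      using Cauchy_Schwarz_ineq2[of z p] by (simp add: mult.commute)
    also have "\<dots> \<le> norm p * (1 + (norm z)\<^sup>2)"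
      using zero_le_power2[of "norm z - 1/2"] by (intro mult_left_mono) (auto simp: power2_eq_square algebra_simps)
    finally have zp: "\<bar>z \<bullet> p\<bar> \<le> norm p * (1 + (norm z)\<^sup>2)" .
    define T where "T = 3 / 2 * L * (norm z)\<^sup>2"
    have "\<bar>v y - v w - z \<bullet> p\<bar> \<le> T"
      using \<psi>[of z] by (simp add: \<psi>_def z_def T_def)
    then have "\<bar>v y\<bar> \<le> \<bar>v w\<bar> + norm p * (1 + (norm z)\<^sup>2) + T"
      using zp by linarith
    then have "\<bar>v y\<bar> \<le> \<bar>v w\<bar> + norm p + (norm p + 3 / 2 * L) * (norm z)\<^sup>2"
      by (simp add: T_def algebra_simps)
    moreover have "(norm z)\<^sup>2 \<le> 2 * (norm w)\<^sup>2 + 2 * (norm y)\<^sup>2"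
    proof -
      have "(norm z)\<^sup>2 \<le> (norm y + norm w)\<^sup>2"
        unfolding z_def by (intro power_mono norm_triangle_ineq4) auto
      also have "\<dots> \<le> 2 * (norm w)\<^sup>2 + 2 * (norm y)\<^sup>2"
        using zero_le_power2[of "norm y - norm w"] by (simp add: power2_eq_square algebra_simps)
      finally show ?thesis .
    qed
    then have "(norm p + 3 / 2 * L) * (norm z)\<^sup>2 \<le> (norm p + 3 / 2 * L) * (2 * (norm w)\<^sup>2 + 2 * (norm y)\<^sup>2)"
      using L0 by (intro mult_left_mono) auto
    ultimately show ?thesis by (simp add: algebra_simps)
  qed
  note int = integrable_gaussian_continuous[OF cont h this, simplified]
  have int_v: "integrable (gaussian h) (\<lambda>z. v (y + z))" for y using int(1) L0 by simp
  have cont_v: "continuous_on UNIV (\<lambda>y. \<integral>z. v (y + z) \<partial>gaussian h)" using int(2) L0 by simp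
  have \<psi>_int: "integrable (gaussian h) \<psi>" "(\<integral>z. \<psi> z \<partial>gaussian h) = (\<integral>z. v (w + z) \<partial>gaussian h) - v w"
    unfolding \<psi>_def using int_v[of w] gaussian_inner[OF h, of p] by (simp_all add: prob_space[simplified])
  define c where "c = - (norm (w - x))\<^sup>2 / (2 * h) - v w"
  have *: "exp (- (z \<bullet> (w - x)) / h - (norm (w - x))\<^sup>2 / (2 * h)) * exp (- v (w + z)) = exp c * exp (- \<psi> z)" for z
    using h unfolding \<psi>_def c_def p_def exp_add[symmetric] by (simp add: field_simps inner_diff_right)
  have me: "(\<lambda>z. exp (- v z)) \<in> borel_measurable borel" by measurable
  note sh = integral_gaussian_shift[OF me exp_ge_zero h integrable_exp_neg[OF v nn h], where x=x and y=w, unfolded *]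
  have int_exp: "integrable (gaussian h) (\<lambda>z. exp (- \<psi> z))"
    using sh(1) by simp
  have "exp (- log_heat h v x) = exp c * (\<integral>z. exp (- \<psi> z) \<partial>gaussian h)"
    using sh(2) by (simp add: exp_log_heat[OF v nn h])
  then have eq: "exp (- log_heat h v x - c) = (\<integral>z. exp (- \<psi> z) \<partial>gaussian h)"
    by (simp add: exp_diff)
  have pt: "exp (- \<psi> z) \<le> 1 - \<psi> z + 144 * L\<^sup>2 * h\<^sup>2 * exp ((norm z)\<^sup>2 / (4 * h))" for z
  proof -
    define N where "N = (norm z)\<^sup>2"
    have N0: "N \<ge> 0" by (simp add: N_def)
    \<comment> \<open>The exponent N / (4h) of the integrable weight is 2X: one X pays for X^2 \<le>
      2 exp X, the other for exp |\<psi>|. The condition 12 L h \<le> 1 is what gives |\<psi>| \<le>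
      X, and 144 is the square of this 12.\<close>
    define X where "X = N / (8 * h)"
    have X0: "X \<ge> 0" and NX: "N = 8 * h * X" using h N0 by (auto simp: X_def)
    have A: "\<bar>\<psi> z\<bar> \<le> 3 / 2 * L * N" using \<psi>[of z] by (simp add: N_def)
    have "3 / 2 * L * N = 12 * L * h * X" by (simp add: NX)
    also have "\<dots> \<le> X" using mult_right_mono[OF small X0] by simp
    finally have B: "\<bar>\<psi> z\<bar> \<le> X" using A by linarith
    have X2: "X\<^sup>2 \<le> 2 * exp X"
      using exp_lower_Taylor_quadratic[OF X0] X0 by simp
    have "(\<psi> z)\<^sup>2 \<le> (3 / 2 * L * N)\<^sup>2" using power_mono[OF A, of 2] by simp
    also have "\<dots> = 144 * L\<^sup>2 * h\<^sup>2 * X\<^sup>2" by (simp add: NX power_mult_distrib)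
    also have "\<dots> \<le> 144 * L\<^sup>2 * h\<^sup>2 * (2 * exp X)" by (intro mult_left_mono X2) auto
    finally have C: "(\<psi> z)\<^sup>2 \<le> 144 * L\<^sup>2 * h\<^sup>2 * (2 * exp X)" .
    have "(\<psi> z)\<^sup>2 * exp \<bar>\<psi> z\<bar> \<le> 144 * L\<^sup>2 * h\<^sup>2 * (2 * exp X) * exp X"
      using B by (intro mult_mono C) auto
    also have "\<dots> = 2 * (144 * L\<^sup>2 * h\<^sup>2 * exp (N / (4 * h)))"
      using h by (simp add: X_def flip: exp_add)
    finally show ?thesis
      using exp_neg_le[of "\<psi> z"] by (simp add: N_def)
  qed
  \<comment> \<open>This is ln r \<le> r - 1, where r is the integral of exp (- \<psi>).\<close>
  have "- log_heat h v x - c \<le> exp (- log_heat h v x - c) - 1"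
    using exp_ge_add_one_self[of "- log_heat h v x - c"] by linarith
  also have "exp (- log_heat h v x - c) \<le> (\<integral>z. 1 - \<psi> z + 144 * L\<^sup>2 * h\<^sup>2 * exp ((norm z)\<^sup>2 / (4 * h)) \<partial>gaussian h)"
    unfolding eq by (rule integral_mono) (use int_exp \<psi>_int pt integrable_gaussian_exp_square[OF h] in auto)
  also have "\<dots> = 1 - (\<integral>z. \<psi> z \<partial>gaussian h) + 144 * L\<^sup>2 * h\<^sup>2 * 2 powr (real CARD('n) / 2)"
    using \<psi>_int(1) integrable_gaussian_exp_square[OF h, where ?'n='n] by (simp add: prob_space[simplified])
  finally have "(\<integral>z. v (w + z) \<partial>gaussian h) + (norm (x - w))\<^sup>2 / (2 * h)
      \<le> log_heat h v x + 144 * L\<^sup>2 * 2 powr (real CARD('n) / 2) * h\<^sup>2"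
    unfolding \<psi>_int(2) c_def by (simp add: norm_minus_commute mult_ac)
  then show thesis
    using that[of w] int_v cont_v by blast
qed

text \<open>An enumeration instead of a dense set: near-minimisers can then be chosen by least
  index, which makes the choice measurable in a parameter.\<close>

definition dense_seq :: "(nat \<Rightarrow> 'a::topological_space) \<Rightarrow> bool" where
  "dense_seq e \<longleftrightarrow> (\<forall>U. open U \<longrightarrow> U \<noteq> {} \<longrightarrow> (\<exists>i. e i \<in> U))"

lemma ex_dense_seq: "\<exists>e :: nat \<Rightarrow> 'a::second_countable_topology. dense_seq e"
proof -
  obtain D :: "'a set" where D: "countable D" "\<And>X. open X \<Longrightarrow> X \<noteq> {} \<Longrightarrow> \<exists>d\<in>D. d \<in> X"
    using countable_dense_setE by blast
  then have "D \<noteq> {}" by (metis open_UNIV UNIV_not_empty empty_iff)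
  then have "range (from_nat_into D) = D"
    using D(1) by (simp add: range_from_nat_into)
  then have "dense_seq (from_nat_into D)"
    using D(2) unfolding dense_seq_def by (metis imageE)
  then show ?thesis by blast
qed

lemma dense_seq_less:
  fixes F :: "'a::topological_space \<Rightarrow> real"
  assumes "dense_seq e" "continuous_on UNIV F" "F w < c"
  shows "\<exists>i. F (e i) < c"
proof -
  have "open {y. F y < c}"
    using assms(2) by (intro open_Collect_less) auto
  then show ?thesis
    using assms(1,3) unfolding dense_seq_def by (metis (mono_tags, lifting) empty_iff mem_Collect_eq)
qed

text \<open>The quantity bounded in \<open>log_heat_ge\<close> is continuous in the centre, so
  \<open>w\<close> may be replaced by a nearby member of the sequence; the summand 1 in the constant
  pays for the move.\<close>

lemma log_heat_ge_dense:
  fixes v :: "real ^ 'n::finite \<Rightarrow> real"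
  assumes e: "dense_seq e" and cont: "continuous_on UNIV v" and nn: "\<And>x. v x \<ge> 0" and h: "h > 0"
    and L: "second_diff_bounded L v" and L0: "L \<ge> 0" and small: "12 * L * h \<le> 1"
  shows "\<exists>i. (\<integral>\<^sup>+z. ennreal (v (e i + z)) \<partial>gaussian h) + ennreal ((norm (x - e i))\<^sup>2 / (2 * h))
    \<le> ennreal (log_heat h v x + (144 * L\<^sup>2 * 2 powr (real CARD('n) / 2) + 1) * h\<^sup>2)"
proof -
  obtain w where int: "\<And>y. integrable (gaussian h) (\<lambda>z. v (y + z))"
    and cont': "continuous_on UNIV (\<lambda>y. \<integral>z. v (y + z) \<partial>gaussian h)"
    and w: "(\<integral>z. v (w + z) \<partial>gaussian h) + (norm (x - w))\<^sup>2 / (2 * h)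
      \<le> log_heat h v x + 144 * L\<^sup>2 * 2 powr (real CARD('n) / 2) * h\<^sup>2"
    using log_heat_ge[OF cont nn h L L0 small] by blast
  have "h\<^sup>2 > 0" using h by simp
  have "\<exists>i. (\<integral>z. v (e i + z) \<partial>gaussian h) + (norm (x - e i))\<^sup>2 / (2 * h)
      < log_heat h v x + (144 * L\<^sup>2 * 2 powr (real CARD('n) / 2) + 1) * h\<^sup>2"
  proof (rule dense_seq_less[OF e, where w=w])
    show "(\<integral>z. v (w + z) \<partial>gaussian h) + (norm (x - w))\<^sup>2 / (2 * h)
      < log_heat h v x + (144 * L\<^sup>2 * 2 powr (real CARD('n) / 2) + 1) * h\<^sup>2"
      unfolding distrib_right using w \<open>h\<^sup>2 > 0\<close> by linarith
  qed (use h cont' in \<open>auto intro!: continuous_intros\<close>)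
  then obtain i where i: "(\<integral>z. v (e i + z) \<partial>gaussian h) + (norm (x - e i))\<^sup>2 / (2 * h)
      < log_heat h v x + (144 * L\<^sup>2 * 2 powr (real CARD('n) / 2) + 1) * h\<^sup>2" ..
  have "(\<integral>\<^sup>+z. ennreal (v (e i + z)) \<partial>gaussian h) + ennreal ((norm (x - e i))\<^sup>2 / (2 * h))
    = ennreal ((\<integral>z. v (e i + z) \<partial>gaussian h) + (norm (x - e i))\<^sup>2 / (2 * h))"
    using int nn h by (simp add: nn_integral_eq_integral)
  also have "\<dots> \<le> ennreal (log_heat h v x + (144 * L\<^sup>2 * 2 powr (real CARD('n) / 2) + 1) * h\<^sup>2)"
    using i by (intro ennreal_leI) simp
  finally show ?thesis ..
qed

subsection \<open>Second differences along the flow\<close>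

text \<open>Convexity of w \<mapsto> ln of the integral of exp (- w), that is, the Cauchy-Schwarz
  inequality. Once each exponential is divided by its integral, it becomes the pointwise inequality
  of arithmetic and geometric means.\<close>

lemma log_integral_second_diff_ge:
  fixes w0 w1 w2 :: "'a \<Rightarrow> real"
  assumes int: "integrable M (\<lambda>z. exp (- w0 z))" "integrable M (\<lambda>z. exp (- w1 z))" "integrable M (\<lambda>z. exp (- w2 z))"
    and pos: "(\<integral>z. exp (- w0 z) \<partial>M) > 0" "(\<integral>z. exp (- w1 z) \<partial>M) > 0" "(\<integral>z. exp (- w2 z) \<partial>M) > 0"
    and le: "\<And>z. z \<in> space M \<Longrightarrow> w1 z + w2 z - 2 * w0 z \<le> c"
  shows "ln (\<integral>z. exp (- w1 z) \<partial>M) + ln (\<integral>z. exp (- w2 z) \<partial>M) - 2 * ln (\<integral>z. exp (- w0 z) \<partial>M) \<ge> - c"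
proof -
  define k0 k1 k2 where "k0 = ln (\<integral>z. exp (- w0 z) \<partial>M)" and "k1 = ln (\<integral>z. exp (- w1 z) \<partial>M)"
    and "k2 = ln (\<integral>z. exp (- w2 z) \<partial>M)"
  have k: "exp (- k0) * (\<integral>z. exp (- w0 z) \<partial>M) = 1" "exp (- k1) * (\<integral>z. exp (- w1 z) \<partial>M) = 1"
    "exp (- k2) * (\<integral>z. exp (- w2 z) \<partial>M) = 1"
    using pos by (simp_all add: k0_def k1_def k2_def exp_minus)
  define d where "d = c + k1 + k2 - 2 * k0"
  have pt: "exp (- k0) * exp (- w0 z) \<le> exp (d / 2) * ((exp (- k1) * exp (- w1 z) + exp (- k2) * exp (- w2 z)) / 2)"
    if z: "z \<in> space M" for z
  proof -
    have sq: "(exp (r / 2))\<^sup>2 = exp r" for r :: real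
      by (simp add: power2_eq_square flip: exp_add)
    have "- k0 - w0 z \<le> d / 2 + ((- k1 - w1 z) / 2 + (- k2 - w2 z) / 2)"
      using le[OF z] unfolding d_def by (simp add: field_simps)
    then have "exp (- k0) * exp (- w0 z) \<le> exp (d / 2) * (exp ((- k1 - w1 z) / 2) * exp ((- k2 - w2 z) / 2))"
      unfolding exp_add[symmetric] exp_le_cancel_iff by simp
    also have "exp ((- k1 - w1 z) / 2) * exp ((- k2 - w2 z) / 2) \<le> ((exp ((- k1 - w1 z) / 2))\<^sup>2 + (exp ((- k2 - w2 z) / 2))\<^sup>2) / 2"
      using sum_squares_bound[of "exp ((- k1 - w1 z) / 2)" "exp ((- k2 - w2 z) / 2)"] by simp
    also have "\<dots> = (exp (- k1) * exp (- w1 z) + exp (- k2) * exp (- w2 z)) / 2"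
      using exp_add[of "- k1" "- w1 z"] exp_add[of "- k2" "- w2 z"] by (simp add: sq)
    finally show ?thesis by simp
  qed
  have "(\<integral>z. exp (- k0) * exp (- w0 z) \<partial>M)
    \<le> (\<integral>z. exp (d / 2) * ((exp (- k1) * exp (- w1 z) + exp (- k2) * exp (- w2 z)) / 2) \<partial>M)"
    by (rule integral_mono) (use int pt in auto)
  also have "\<dots> = exp (d / 2) * ((exp (- k1) * (\<integral>z. exp (- w1 z) \<partial>M) + exp (- k2) * (\<integral>z. exp (- w2 z) \<partial>M)) / 2)"
    using int by simp
  finally have "1 \<le> exp (d / 2)" by (simp add: k)
  then show ?thesis by (simp add: d_def k0_def k1_def k2_def)
qed

text \<open>Under the probability measure with density proportional to exp (- w0), the differences
  of logarithms are logarithmic moment generating functions of \<open>w0 - w1\<close> and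
  \<open>w0 - w2\<close>. Hoeffding's lemma bounds each by its mean plus a variance term, and the
  means add up to at most \<open>c\<close>.\<close>

lemma log_integral_second_diff_le:
  fixes w0 w1 w2 :: "'a \<Rightarrow> real"
  assumes [measurable]: "w0 \<in> borel_measurable M" "w1 \<in> borel_measurable M" "w2 \<in> borel_measurable M"
    and int: "integrable M (\<lambda>z. exp (- w0 z))" "integrable M (\<lambda>z. exp (- w1 z))" "integrable M (\<lambda>z. exp (- w2 z))"
    and pos: "(\<integral>z. exp (- w0 z) \<partial>M) > 0" "(\<integral>z. exp (- w1 z) \<partial>M) > 0" "(\<integral>z. exp (- w2 z) \<partial>M) > 0"
    and ge: "\<And>z. z \<in> space M \<Longrightarrow> w1 z + w2 z - 2 * w0 z \<ge> - c"
    and bd: "\<And>z. z \<in> space M \<Longrightarrow> \<bar>w1 z - w0 z\<bar> \<le> \<kappa>" "\<And>z. z \<in> space M \<Longrightarrow> \<bar>w2 z - w0 z\<bar> \<le> \<kappa>"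
  shows "ln (\<integral>z. exp (- w1 z) \<partial>M) + ln (\<integral>z. exp (- w2 z) \<partial>M) - 2 * ln (\<integral>z. exp (- w0 z) \<partial>M) \<le> c + \<kappa>\<^sup>2"
proof -
  define I where "I = (\<integral>z. exp (- w0 z) \<partial>M)"
  have I: "I > 0" using pos by (simp add: I_def)
  define Q where "Q = density M (\<lambda>z. ennreal (exp (- w0 z) / I))"
  have [measurable_cong, simp]: "sets Q = sets M" "space Q = space M" by (auto simp: Q_def)
  have eint: "(\<integral>z. F z \<partial>Q) = (\<integral>z. exp (- w0 z) * F z \<partial>M) / I" if [measurable]: "F \<in> borel_measurable M" for F :: "'a \<Rightarrow> real"
  proof -
    have "(\<integral>z. F z \<partial>Q) = (\<integral>z. exp (- w0 z) * F z / I \<partial>M)"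
      using I by (simp add: Q_def integral_real_density)
    then show ?thesis by simp
  qed
  interpret Q: prob_space Q
  proof (rule prob_spaceI)
    have "(\<integral>\<^sup>+z. ennreal (exp (- w0 z) / I) \<partial>M) = ennreal (\<integral>z. exp (- w0 z) / I \<partial>M)"
      using int I by (intro nn_integral_eq_integral) auto
    also have "\<dots> = 1" using I by (simp add: I_def)
    finally show "emeasure Q (space Q) = 1"
      by (simp add: Q_def emeasure_density cong: nn_integral_cong)
  qed
  have step: "ln (\<integral>z. exp (- w z) \<partial>M) - ln I \<le> - (\<integral>z. w z - w0 z \<partial>Q) + \<kappa>\<^sup>2 / 2"
    and int_Q: "integrable Q (\<lambda>z. w z - w0 z)"
    if [measurable]: "w \<in> borel_measurable M" and b: "\<And>z. z \<in> space M \<Longrightarrow> \<bar>w z - w0 z\<bar> \<le> \<kappa>"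
      and pos': "(\<integral>z. exp (- w z) \<partial>M) > 0" for w
  proof -
    show i: "integrable Q (\<lambda>z. w z - w0 z)"
      by (rule Q.integrable_const_bound[where B=\<kappa>]) (auto intro!: AE_I2 b)
    define \<mu> where "\<mu> = (\<integral>z. w0 z - w z \<partial>Q)"
    have \<mu>: "\<mu> = - (\<integral>z. w z - w0 z \<partial>Q)"
      unfolding \<mu>_def by (subst Bochner_Integration.integral_minus[symmetric]) simp
    \<comment> \<open>The range has length 2\<kappa>, so Hoeffding's term is (2\<kappa>)^2 / 8 =
      \<kappa>^2 / 2 for each of the two functions.\<close>
    interpret interval_bounded_random_variable Q "\<lambda>z. w0 z - w z" "- \<kappa>" "\<kappa>"
    proof unfold_locales
      show "AE z in Q. w0 z - w z \<in> {- \<kappa>..\<kappa>}"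
      proof (rule AE_I2)
        fix z assume "z \<in> space Q"
        then have "\<bar>w z - w0 z\<bar> \<le> \<kappa>" using b by simp
        then show "w0 z - w z \<in> {- \<kappa>..\<kappa>}" by (simp add: abs_le_iff)
      qed
    qed measurable
    have "(\<integral>\<^sup>+z. ennreal (exp (1 * (w0 z - w z - \<mu>))) \<partial>Q) \<le> ennreal (exp (1\<^sup>2 * (\<kappa> - - \<kappa>)\<^sup>2 / 8))"
      unfolding \<mu>_def by (rule Hoeffdings_lemma_nn_integral) simp
    moreover have "integrable Q (\<lambda>z. exp (1 * (w0 z - w z - \<mu>)))"
    proof (rule Q.integrable_const_bound[where B="exp (\<kappa> - \<mu>)"])
      show "AE z in Q. norm (exp (1 * (w0 z - w z - \<mu>))) \<le> exp (\<kappa> - \<mu>)"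
      proof (rule AE_I2)
        fix z assume "z \<in> space Q"
        then have "\<bar>w z - w0 z\<bar> \<le> \<kappa>" using b by simp
        then show "norm (exp (1 * (w0 z - w z - \<mu>))) \<le> exp (\<kappa> - \<mu>)" by (simp add: abs_le_iff)
      qed
    qed simp
    ultimately have "(\<integral>z. exp (w0 z - w z - \<mu>) \<partial>Q) \<le> exp ((2 * \<kappa>)\<^sup>2 / 8)"
      by (simp add: nn_integral_eq_integral)
    also have "(\<integral>z. exp (w0 z - w z - \<mu>) \<partial>Q) = (\<integral>z. exp (- \<mu>) * exp (- w z) \<partial>M) / I"
    proof -
      have *: "exp (- w0 z) * exp (w0 z - w z - \<mu>) = exp (- \<mu>) * exp (- w z)" for z
        unfolding exp_add[symmetric] by simp
      show ?thesis by (subst eint) (simp_all only: *, simp)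
    qed
    also have "\<dots> = exp (- \<mu>) * ((\<integral>z. exp (- w z) \<partial>M) / I)"
      by simp
    finally have "ln (exp (- \<mu>) * ((\<integral>z. exp (- w z) \<partial>M) / I)) \<le> ln (exp ((2 * \<kappa>)\<^sup>2 / 8))"
      using pos' I by (intro ln_mono) auto
    then show "ln (\<integral>z. exp (- w z) \<partial>M) - ln I \<le> - (\<integral>z. w z - w0 z \<partial>Q) + \<kappa>\<^sup>2 / 2"
      using pos' I by (simp add: ln_mult ln_div \<mu> power_mult_distrib)
  qed
  have "- c = (\<integral>z. - c \<partial>Q)" by (simp add: Q.prob_space[simplified])
  also have "\<dots> \<le> (\<integral>z. (w1 z - w0 z) + (w2 z - w0 z) \<partial>Q)"
  proof (rule integral_mono)
    show "integrable Q (\<lambda>z. (w1 z - w0 z) + (w2 z - w0 z))"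
      by (intro Bochner_Integration.integrable_add int_Q bd pos) auto
    show "- c \<le> (w1 z - w0 z) + (w2 z - w0 z)" if "z \<in> space Q" for z
      using ge[of z] that by simp
  qed simp
  also have "\<dots> = (\<integral>z. w1 z - w0 z \<partial>Q) + (\<integral>z. w2 z - w0 z \<partial>Q)"
    by (intro Bochner_Integration.integral_add int_Q bd pos) auto
  finally show ?thesis
    using step[OF _ bd(1) pos(2)] step[OF _ bd(2) pos(3)] by (simp add: I_def)
qed

lemma second_diff_boundedI:
  assumes "\<And>x y. v (x + y) + v (x - y) - 2 * v x \<le> L * (norm y)\<^sup>2"
    and "\<And>x y. v (x + y) + v (x - y) - 2 * v x \<ge> - (L * (norm y)\<^sup>2)"
  shows "second_diff_bounded L v"
  unfolding second_diff_bounded_def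
proof (intro allI abs_leI)
  fix x y
  show "- (v (x + y) + v (x - y) - 2 * v x) \<le> L * (norm y)\<^sup>2"
    using assms(2)[where x=x and y=y] by linarith
qed (rule assms(1))

text \<open>Semiconcavity survives the flow with the same constant. The bound from below has no such
  general reason and is the purpose of the next two lemmas.\<close>

lemma log_heat_second_diff_le:
  fixes f :: "real ^ 'n::finite \<Rightarrow> real"
  assumes f: "f \<in> borel_measurable borel" "\<And>x. f x \<ge> 0" and h: "h > 0"
    and L: "\<And>x y. f (x + y) + f (x - y) - 2 * f x \<le> L * (norm y)\<^sup>2"
  shows "log_heat h f (x + y) + log_heat h f (x - y) - 2 * log_heat h f x \<le> L * (norm y)\<^sup>2"
proof -
  have *: "x + y + z = x + z + y" "x - y + z = x + z - y" for z by (simp_all add: algebra_simps)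
  have "ln (\<integral>z. exp (- f (x + y + z)) \<partial>gaussian h) + ln (\<integral>z. exp (- f (x - y + z)) \<partial>gaussian h)
      - 2 * ln (\<integral>z. exp (- f (x + z)) \<partial>gaussian h) \<ge> - (L * (norm y)\<^sup>2)"
  proof (rule log_integral_second_diff_ge)
    show "f (x + y + z) + f (x - y + z) - 2 * f (x + z) \<le> L * (norm y)\<^sup>2" for z
      unfolding * by (rule L)
  qed (rule integrable_exp_neg[OF f h] exp_log_heat(2)[OF f h])+
  then show ?thesis by (simp add: log_heat_def)
qed

text \<open>exp (- u) is a Gaussian of variance \<delta> around \<open>b\<close> times exp (- l).
  Multiplied by the heat kernel at \<open>x\<close>, the Gaussian factor splits into one that
  depends on \<open>x\<close> alone and one of variance \<sigma> around a convex combination of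
  \<open>x\<close> and \<open>b\<close>. The flow thus keeps an explicit quadratic and acts on
  \<open>l\<close> by a Gaussian average.\<close>

lemma log_heat_quadratic:
  fixes u l :: "real ^ 'n::finite \<Rightarrow> real"
  assumes l[measurable]: "l \<in> borel_measurable borel" and u: "\<And>x. u x = (norm (x - b))\<^sup>2 / (2 * \<delta>) + l x"
    and nn: "\<And>x. u x \<ge> 0" and d: "\<delta> > 0" and t: "t > 0"
  defines "\<theta> \<equiv> \<delta> / (\<delta> + t)" and "\<sigma> \<equiv> \<delta> * t / (\<delta> + t)"
  obtains c where
    "\<And>x. integrable (gaussian \<sigma>) (\<lambda>z. exp (- l (\<theta> *\<^sub>R x + (1 - \<theta>) *\<^sub>R b + z)))"
    "\<And>x. (\<integral>z. exp (- l (\<theta> *\<^sub>R x + (1 - \<theta>) *\<^sub>R b + z)) \<partial>gaussian \<sigma>) > 0"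
    "\<And>x. log_heat t u x = c + (norm (x - b))\<^sup>2 / (2 * (\<delta> + t))
        - ln (\<integral>z. exp (- l (\<theta> *\<^sub>R x + (1 - \<theta>) *\<^sub>R b + z)) \<partial>gaussian \<sigma>)"
proof -
  have u_m[measurable]: "u \<in> borel_measurable borel"
    unfolding u[abs_def] by measurable
  define N where "N s = (2 * pi * s) powr (real CARD('n) / 2)" for s
  have N: "N s > 0" if "s > 0" for s using that by (simp add: N_def)
  define m where "m x = \<theta> *\<^sub>R x + (1 - \<theta>) *\<^sub>R b" for x
  define C where "C x = N \<delta> * gauss_dens (\<delta> + t) (b - x)" for x
  have C: "C x > 0" for x using N[of \<delta>] N[of "\<delta> + t"] d t by (simp add: C_def gauss_dens_def N_def)
  have \<theta>: "1 - \<theta> = t / (\<delta> + t)" using d t by (simp add: \<theta>_def field_simps)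
  have key: "(\<integral>\<^sup>+z. ennreal (exp (- u (x + z))) \<partial>gaussian t) = ennreal (C x) * (\<integral>\<^sup>+z. ennreal (exp (- l (m x + z))) \<partial>gaussian \<sigma>)" for x
  proof -
    have "gauss_dens t (w - x) * exp (- u w) = C x * (gauss_dens \<sigma> (w - m x) * exp (- l w))" for w
    proof -
      \<comment> \<open>The argument of the density is written as a difference with
        \<open>w - x\<close> so that \<open>gauss_dens_mult\<close> applies to the pair
        \<open>b - x\<close>, \<open>w - x\<close>.\<close>
      have "exp (- u w) = N \<delta> * gauss_dens \<delta> (b - x - (w - x)) * exp (- l w)"
      proof -
        have "exp (- u w) = exp (- (norm (w - b))\<^sup>2 / (2 * \<delta>)) * exp (- l w)"
          unfolding exp_add[symmetric] u by simp
        also have "exp (- (norm (w - b))\<^sup>2 / (2 * \<delta>)) = N \<delta> * gauss_dens \<delta> (w - b)"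
          using N[OF d] by (simp add: gauss_dens_def flip: N_def)
        also have "gauss_dens \<delta> (w - b) = gauss_dens \<delta> (b - x - (w - x))"
          by (simp add: gauss_dens_def norm_minus_commute)
        finally show ?thesis .
      qed
      moreover have m_eq: "w - x - (t / (\<delta> + t)) *\<^sub>R (b - x) = w - m x"
      proof -
        have "\<theta> = 1 - t / (\<delta> + t)" using \<theta> by simp
        then show ?thesis unfolding m_def by (simp only:) (simp add: algebra_simps)
      qed
      ultimately show ?thesis
        using gauss_dens_mult[OF d t, of "b - x" "w - x", unfolded m_eq] by (simp add: C_def \<sigma>_def mult_ac)
    qed
    then have "(\<integral>\<^sup>+w. ennreal (gauss_dens t (w - x)) * ennreal (exp (- u w)) \<partial>lborel)
      = (\<integral>\<^sup>+w. ennreal (C x) * (ennreal (gauss_dens \<sigma> (w - m x)) * ennreal (exp (- l w))) \<partial>lborel)"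
      using C[of x] by (simp flip: ennreal_mult)
    also have "\<dots> = ennreal (C x) * (\<integral>\<^sup>+w. ennreal (gauss_dens \<sigma> (w - m x)) * ennreal (exp (- l w)) \<partial>lborel)"
      by (rule nn_integral_cmult) measurable
    finally show ?thesis
      using nn_integral_gaussian_translate[where \<phi>="\<lambda>w. ennreal (exp (- u w))" and x=x and \<tau>=t]
        nn_integral_gaussian_translate[where \<phi>="\<lambda>w. ennreal (exp (- l w))" and x="m x" and \<tau>=\<sigma>] by simp
  qed
  have E: "(\<integral>\<^sup>+z. ennreal (exp (- u (x + z))) \<partial>gaussian t) = ennreal (exp (- log_heat t u x))" for x
    using t nn u_m by (subst exp_log_heat) (auto simp: integrable_exp_neg nn_integral_eq_integral)
  have int: "integrable (gaussian \<sigma>) (\<lambda>z. exp (- l (m x + z)))" for x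
  proof (rule integrableI_bounded)
    have "ennreal (C x) * (\<integral>\<^sup>+z. ennreal (exp (- l (m x + z))) \<partial>gaussian \<sigma>) < \<infinity>"
      unfolding key[symmetric] E by simp
    then show "(\<integral>\<^sup>+z. ennreal (norm (exp (- l (m x + z)))) \<partial>gaussian \<sigma>) < \<infinity>"
      using C[of x] by (auto simp: ennreal_mult_less_top)
  qed measurable
  have eq: "exp (- log_heat t u x) = C x * (\<integral>z. exp (- l (m x + z)) \<partial>gaussian \<sigma>)" for x
  proof -
    have "ennreal (exp (- log_heat t u x)) = ennreal (C x * (\<integral>z. exp (- l (m x + z)) \<partial>gaussian \<sigma>))"
      using key[of x] C[of x] int by (simp add: E nn_integral_eq_integral ennreal_mult)
    then show ?thesis
      using C[of x] by (subst (asm) ennreal_inj) (auto intro!: mult_nonneg_nonneg integral_nonneg_AE)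
  qed
  have pos: "(\<integral>z. exp (- l (m x + z)) \<partial>gaussian \<sigma>) > 0" for x
    using eq[of x] C[of x] by (metis exp_gt_zero zero_less_mult_pos)
  have "log_heat t u x = (ln (N (\<delta> + t)) - ln (N \<delta>)) + (norm (x - b))\<^sup>2 / (2 * (\<delta> + t))
        - ln (\<integral>z. exp (- l (m x + z)) \<partial>gaussian \<sigma>)" for x
  proof -
    have "- log_heat t u x = ln (C x * (\<integral>z. exp (- l (m x + z)) \<partial>gaussian \<sigma>))"
      by (simp flip: eq)
    also have "\<dots> = ln (C x) + ln (\<integral>z. exp (- l (m x + z)) \<partial>gaussian \<sigma>)"
      using C[of x] pos[of x] by (simp add: ln_mult)
    also have "ln (C x) = ln (N \<delta>) - (norm (x - b))\<^sup>2 / (2 * (\<delta> + t)) - ln (N (\<delta> + t))"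
      using N[of \<delta>] N[of "\<delta> + t"] d t
      by (simp add: C_def gauss_dens_def ln_mult ln_div norm_minus_commute flip: N_def)
    finally show ?thesis by simp
  qed
  then show thesis
    using that int pos unfolding m_def by blast
qed

text \<open>From above \<open>l\<close> is concave and the quadratic contributes 1 / \<delta>. From
  below the quadratic only helps, \<open>l\<close> contributes B, and the logarithm of the average
  contributes K^2 by \<open>log_integral_second_diff_le\<close>. None of these grows with
  \<open>t\<close>, so one L serves the whole flow.\<close>

lemma second_diff_bounded_log_heat_quadratic:
  fixes u l :: "real ^ 'n::finite \<Rightarrow> real"
  assumes l[measurable]: "l \<in> borel_measurable borel" and u: "\<And>x. u x = (norm (x - b))\<^sup>2 / (2 * \<delta>) + l x"
    and nn: "\<And>x. u x \<ge> 0" and d: "\<delta> > 0" and t: "t > 0"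
    and Lip: "\<And>x y. \<bar>l x - l y\<bar> \<le> K * norm (x - y)" and K: "K \<ge> 0"
    and sd: "\<And>x y. l (x + y) + l (x - y) - 2 * l x \<le> 0"
      "\<And>x y. l (x + y) + l (x - y) - 2 * l x \<ge> - (B * (norm y)\<^sup>2)" and B: "B \<ge> 0"
    and L: "L \<ge> 1 / \<delta>" "L \<ge> B + K\<^sup>2"
  shows "second_diff_bounded L u" "second_diff_bounded L (log_heat t u)"
proof -
  have q: "(norm (x + y - b))\<^sup>2 / (2 * s) + (norm (x - y - b))\<^sup>2 / (2 * s) - 2 * ((norm (x - b))\<^sup>2 / (2 * s)) = (norm y)\<^sup>2 / s"
    if "s > 0" for s :: real and x y :: "real ^ 'n"
  proof -
    have "(norm (x + y - b))\<^sup>2 + (norm (x - y - b))\<^sup>2 - 2 * (norm (x - b))\<^sup>2 = 2 * (norm y)\<^sup>2"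
      by (simp add: power2_norm_eq_inner algebra_simps inner_commute)
    then show ?thesis using that by (simp add: field_simps)
  qed
  have Bn: "B * (norm y)\<^sup>2 \<le> L * (norm y)\<^sup>2" "1 / \<delta> * (norm y)\<^sup>2 \<le> L * (norm y)\<^sup>2"
      "(B + K\<^sup>2) * (norm y)\<^sup>2 \<le> L * (norm y)\<^sup>2" for y :: "real ^ 'n"
    using L K by (intro mult_right_mono; simp add: order_trans[OF _ L(2)])+
  have uu: "u (x + y) + u (x - y) - 2 * u x = (norm y)\<^sup>2 / \<delta> + (l (x + y) + l (x - y) - 2 * l x)" for x y
    using q[OF d, of x y] by (simp add: u algebra_simps)
  have up: "u (x + y) + u (x - y) - 2 * u x \<le> L * (norm y)\<^sup>2" for x y
    using uu[of x y] sd(1)[of x y] Bn(2)[of y] by simp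
  have lo: "u (x + y) + u (x - y) - 2 * u x \<ge> - (L * (norm y)\<^sup>2)" for x y
  proof -
    have "(norm y)\<^sup>2 / \<delta> \<ge> 0" using d by simp
    then show ?thesis using uu[of x y] sd(2)[where x=x and y=y] Bn(1)[of y] by linarith
  qed
  show "second_diff_bounded L u"
    by (intro second_diff_boundedI up lo)
  define \<theta> \<sigma> where "\<theta> = \<delta> / (\<delta> + t)" and "\<sigma> = \<delta> * t / (\<delta> + t)"
  have \<theta>: "0 \<le> \<theta>" "\<theta> \<le> 1" using d t by (auto simp: \<theta>_def)
  obtain c where
    int: "\<And>x. integrable (gaussian \<sigma>) (\<lambda>z. exp (- l (\<theta> *\<^sub>R x + (1 - \<theta>) *\<^sub>R b + z)))" and
    pos: "\<And>x. (\<integral>z. exp (- l (\<theta> *\<^sub>R x + (1 - \<theta>) *\<^sub>R b + z)) \<partial>gaussian \<sigma>) > 0" and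
    eq: "\<And>x. log_heat t u x = c + (norm (x - b))\<^sup>2 / (2 * (\<delta> + t))
        - ln (\<integral>z. exp (- l (\<theta> *\<^sub>R x + (1 - \<theta>) *\<^sub>R b + z)) \<partial>gaussian \<sigma>)"
    using log_heat_quadratic[OF l u nn d t] unfolding \<theta>_def \<sigma>_def by metis
  have lo': "log_heat t u (x + y) + log_heat t u (x - y) - 2 * log_heat t u x \<ge> - (L * (norm y)\<^sup>2)" for x y
  proof -
    define m where "m x = \<theta> *\<^sub>R x + (1 - \<theta>) *\<^sub>R b" for x
    \<comment> \<open>Moving \<open>x\<close> by \<open>y\<close> moves the centre
      \<open>m x\<close> by \<theta> y only, with \<theta> \<le> 1, so \<open>l\<close> changes by
      at most this amount.\<close>
    define \<kappa> where "\<kappa> = K * norm y"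
    have my: "m (x + y) + z = (m x + z) + \<theta> *\<^sub>R y" "m (x - y) + z = (m x + z) - \<theta> *\<^sub>R y" for z
      by (simp_all add: m_def algebra_simps)
    have ty: "norm (\<theta> *\<^sub>R y) \<le> norm y" using \<theta> by (simp add: mult_left_le_one_le)
    have lip: "\<bar>l (z + v) - l z\<bar> \<le> \<kappa>" "\<bar>l (z - v) - l z\<bar> \<le> \<kappa>" if "norm v \<le> norm y" for z v
      using order_trans[OF Lip[of "z + v" z], of \<kappa>] order_trans[OF Lip[of "z - v" z], of \<kappa>] mult_left_mono[OF that K]
      by (simp_all add: \<kappa>_def)
    have "ln (\<integral>z. exp (- l (m (x + y) + z)) \<partial>gaussian \<sigma>) + ln (\<integral>z. exp (- l (m (x - y) + z)) \<partial>gaussian \<sigma>)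
      - 2 * ln (\<integral>z. exp (- l (m x + z)) \<partial>gaussian \<sigma>) \<le> B * (norm y)\<^sup>2 + \<kappa>\<^sup>2"
    proof (rule log_integral_second_diff_le)
      fix z
      have "(norm (\<theta> *\<^sub>R y))\<^sup>2 \<le> (norm y)\<^sup>2" using ty by (intro power_mono) auto
      then have "B * (norm (\<theta> *\<^sub>R y))\<^sup>2 \<le> B * (norm y)\<^sup>2" using B by (intro mult_left_mono)
      then show "- (B * (norm y)\<^sup>2) \<le> l (m (x + y) + z) + l (m (x - y) + z) - 2 * l (m x + z)"
        using sd(2)[where x="m x + z" and y="\<theta> *\<^sub>R y"] unfolding my by linarith
      show "\<bar>l (m (x + y) + z) - l (m x + z)\<bar> \<le> \<kappa>" "\<bar>l (m (x - y) + z) - l (m x + z)\<bar> \<le> \<kappa>"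
        unfolding my using lip ty by blast+
    qed (use int pos in \<open>auto simp: m_def\<close>)
    also have "\<dots> \<le> L * (norm y)\<^sup>2" using Bn(3)[of y] by (simp add: \<kappa>_def power_mult_distrib algebra_simps)
    finally have "ln (\<integral>z. exp (- l (m (x + y) + z)) \<partial>gaussian \<sigma>) + ln (\<integral>z. exp (- l (m (x - y) + z)) \<partial>gaussian \<sigma>)
      - 2 * ln (\<integral>z. exp (- l (m x + z)) \<partial>gaussian \<sigma>) \<le> L * (norm y)\<^sup>2" .
    moreover have "(norm y)\<^sup>2 / (\<delta> + t) \<ge> 0" using d t by simp
    moreover have "\<delta> + t > 0" using d t by simp
    ultimately show ?thesis
      using q[where s="\<delta> + t" and x=x and y=y] unfolding eq m_def[symmetric] by argo
  qed
  have up': "log_heat t u (x + y) + log_heat t u (x - y) - 2 * log_heat t u x \<le> L * (norm y)\<^sup>2" for x y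
  proof (rule log_heat_second_diff_le[OF _ nn t up])
    show "u \<in> borel_measurable borel" unfolding u[abs_def] by measurable
  qed
  show "second_diff_bounded L (log_heat t u)"
    by (intro second_diff_boundedI up' lo')
qed

subsection \<open>Smoothed minima of quadratics\<close>

text \<open>The exponent carries the factor \<open>m\<close> so that the error \<open>ln m / m\<close> of the approximation of the
  minimum vanishes as \<open>m\<close> grows.\<close>

definition soft_min :: "nat \<Rightarrow> (nat \<Rightarrow> real) \<Rightarrow> real" where
  "soft_min m a = - (ln (\<Sum>i<m. exp (- (real m * a i))) - ln (real m)) / real m"

lemma soft_min_sum_pos: "m > 0 \<Longrightarrow> (\<Sum>i<m. exp (- (real m * a i))) > 0"
  by (rule sum_pos) auto

lemma soft_min_le:
  assumes "i < m"
  shows "soft_min m a \<le> a i + ln (real m) / real m"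
proof -
  have "exp (- (real m * a i)) \<le> (\<Sum>i<m. exp (- (real m * a i)))"
    using assms by (intro member_le_sum) auto
  then have "- (real m * a i) \<le> ln (\<Sum>i<m. exp (- (real m * a i)))"
    using soft_min_sum_pos[of m a] assms by (subst ln_ge_iff) auto
  then have "- (ln (\<Sum>i<m. exp (- (real m * a i))) - ln (real m)) / real m \<le> (real m * a i + ln (real m)) / real m"
    by (intro divide_right_mono) auto
  then show ?thesis
    using assms by (simp add: soft_min_def add_divide_distrib)
qed

text \<open>Dividing the sum by \<open>m\<close> inside the logarithm puts the soft minimum above
  the minimum. This direction is needed: \<open>dominated_inf_convolution\<close> asks for an upper
  bound of some F (e i) plus cost.\<close>

lemma soft_min_ge:
  assumes "m > 0"
  shows "\<exists>i<m. a i \<le> soft_min m a"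
proof -
  have "finite (a ` {..<m})" "a ` {..<m} \<noteq> {}" using assms by auto
  then obtain i where i: "i < m" "\<And>j. j < m \<Longrightarrow> a i \<le> a j"
    using Min_in[of "a ` {..<m}"] Min_le[of "a ` {..<m}"] by fastforce
  have "(\<Sum>j<m. exp (- (real m * a j))) \<le> (\<Sum>j<m. exp (- (real m * a i)))"
    using i(2) by (intro sum_mono) (auto intro: mult_left_mono)
  then have "ln (\<Sum>j<m. exp (- (real m * a j))) \<le> ln (real m * exp (- (real m * a i)))"
    using soft_min_sum_pos[OF assms, of a] assms by (intro ln_mono) auto
  also have "\<dots> = ln (real m) - real m * a i"
    using assms by (simp add: ln_mult)
  finally have "real m * a i \<le> - (ln (\<Sum>j<m. exp (- (real m * a j))) - ln (real m))"
    by simp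
  then have "a i \<le> soft_min m a"
    using assms unfolding soft_min_def by (subst le_divide_eq) (simp add: mult.commute)
  then show ?thesis using i(1) by blast
qed

lemma soft_min_add_const:
  assumes "m > 0"
  shows "soft_min m (\<lambda>i. c + a i) = c + soft_min m a"
proof -
  have "exp (- (real m * (c + a i))) = exp (- (real m * c)) * exp (- (real m * a i))" for i
    unfolding exp_add[symmetric] by (simp add: algebra_simps)
  then have "(\<Sum>i<m. exp (- (real m * (c + a i)))) = exp (- (real m * c)) * (\<Sum>i<m. exp (- (real m * a i)))"
    by (simp add: sum_distrib_left)
  then have "ln (\<Sum>i<m. exp (- (real m * (c + a i)))) = - (real m * c) + ln (\<Sum>i<m. exp (- (real m * a i)))"
    using soft_min_sum_pos[OF assms, of a] by (simp add: ln_mult)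
  then show ?thesis
    using assms by (simp add: soft_min_def field_simps)
qed

lemma soft_min_mono:
  assumes "m > 0" and "\<And>i. i < m \<Longrightarrow> a i \<le> b i"
  shows "soft_min m a \<le> soft_min m b"
proof -
  have "(\<Sum>i<m. exp (- (real m * b i))) \<le> (\<Sum>i<m. exp (- (real m * a i)))"
    using assms by (intro sum_mono) (auto intro: mult_left_mono)
  then have "ln (\<Sum>i<m. exp (- (real m * b i))) \<le> ln (\<Sum>i<m. exp (- (real m * a i)))"
    using soft_min_sum_pos[OF assms(1), of b] by (intro ln_mono) auto
  then show ?thesis
    using assms(1) unfolding soft_min_def by (intro divide_right_mono) auto
qed

text \<open>Changing the argument changes every affine piece by at most K |x - y|, and the soft
  minimum is monotone and commutes with adding constants.\<close>

lemma soft_min_affine_Lipschitz: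
  fixes p :: "nat \<Rightarrow> 'a::real_inner"
  assumes m: "m > 0" and p: "\<And>i. i < m \<Longrightarrow> norm (p i) \<le> K"
  shows "\<bar>soft_min m (\<lambda>i. A i + x \<bullet> p i) - soft_min m (\<lambda>i. A i + y \<bullet> p i)\<bar> \<le> K * norm (x - y)"
proof -
  have le: "soft_min m (\<lambda>i. A i + x \<bullet> p i) \<le> K * norm (x - y) + soft_min m (\<lambda>i. A i + y \<bullet> p i)" for x y
  proof -
    have "x \<bullet> p i - y \<bullet> p i \<le> K * norm (x - y)" if "i < m" for i
    proof -
      have "(x - y) \<bullet> p i \<le> norm (x - y) * norm (p i)" by (rule norm_cauchy_schwarz)
      also have "\<dots> \<le> norm (x - y) * K" by (intro mult_left_mono p that) auto
      finally show ?thesis by (simp add: inner_diff_left mult.commute)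
    qed
    then have "soft_min m (\<lambda>i. A i + x \<bullet> p i) \<le> soft_min m (\<lambda>i. K * norm (x - y) + (A i + y \<bullet> p i))"
      by (intro soft_min_mono[OF m]) (simp add: algebra_simps)
    then show ?thesis by (simp add: soft_min_add_const[OF m])
  qed
  show ?thesis
    using le[of x y] le[of y x] by (simp add: abs_le_iff norm_minus_commute)
qed

text \<open>The sum of exponentials is an integral over a finite counting measure, so both estimates
  for logarithms of integrals apply. The exponents are affine, so their own second differences
  vanish; the factor m is what remains of (m K |y|)^2 after division by m. Its growth is harmless
  since m is fixed while the time step tends to 0.\<close>

lemma soft_min_affine_second_diff:
  fixes p :: "nat \<Rightarrow> 'a::real_inner" and A :: "nat \<Rightarrow> real"
  assumes m: "m > 0" and p: "\<And>i. i < m \<Longrightarrow> norm (p i) \<le> K"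
  defines "l \<equiv> \<lambda>x. soft_min m (\<lambda>i. A i + x \<bullet> p i)"
  shows "l (x + y) + l (x - y) - 2 * l x \<le> 0"
    and "l (x + y) + l (x - y) - 2 * l x \<ge> - (real m * K\<^sup>2 * (norm y)\<^sup>2)"
proof -
  define M where "M = count_space {..<m}"
  define w where "w z i = real m * (A i + z \<bullet> p i)" for z i
  define I where "I z = ln (\<integral>i. exp (- w z i) \<partial>M)" for z
  have int: "integrable M (\<lambda>i. exp (- w z i))" for z
    unfolding M_def by (rule integrable_count_space) simp
  have eq: "(\<integral>i. exp (- w z i) \<partial>M) = (\<Sum>i<m. exp (- (real m * (A i + z \<bullet> p i))))" for z
    unfolding M_def w_def by (rule lebesgue_integral_count_space_finite) simp
  have pos: "(\<integral>i. exp (- w z i) \<partial>M) > 0" for z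
    unfolding eq by (rule soft_min_sum_pos[OF m])
  have l: "l z = (ln (real m) - I z) / real m" for z
    unfolding l_def soft_min_def I_def eq by simp
  have ll: "l (x + y) + l (x - y) - 2 * l x = - (I (x + y) + I (x - y) - 2 * I x) / real m"
    unfolding l using m by (simp add: field_simps)
  have aff: "w (x + y) i + w (x - y) i - 2 * w x i = 0" for i
    unfolding w_def by (simp add: algebra_simps)
  have "I (x + y) + I (x - y) - 2 * I x \<ge> - 0"
    unfolding I_def by (rule log_integral_second_diff_ge[OF int int int pos pos pos]) (simp add: aff)
  then show "l (x + y) + l (x - y) - 2 * l x \<le> 0"
    unfolding ll using m by (intro divide_nonpos_nonneg) auto
  define \<kappa> where "\<kappa> = real m * (K * norm y)"
  have b: "\<bar>w (x + y) i - w x i\<bar> \<le> \<kappa>" "\<bar>w (x - y) i - w x i\<bar> \<le> \<kappa>" if "i < m" for i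
  proof -
    have "\<bar>y \<bullet> p i\<bar> \<le> norm y * norm (p i)" by (rule Cauchy_Schwarz_ineq2)
    also have "\<dots> \<le> norm y * K" by (intro mult_left_mono p that) auto
    finally have *: "real m * \<bar>y \<bullet> p i\<bar> \<le> \<kappa>"
      unfolding \<kappa>_def by (intro mult_left_mono) (auto simp: mult.commute)
    have "w (x + y) i - w x i = real m * (y \<bullet> p i)" "w (x - y) i - w x i = - (real m * (y \<bullet> p i))"
      unfolding w_def by (simp_all add: algebra_simps)
    with * show "\<bar>w (x + y) i - w x i\<bar> \<le> \<kappa>" "\<bar>w (x - y) i - w x i\<bar> \<le> \<kappa>"
      by (simp_all add: abs_mult)
  qed
  have "I (x + y) + I (x - y) - 2 * I x \<le> 0 + \<kappa>\<^sup>2"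
    unfolding I_def
    by (rule log_integral_second_diff_le[OF _ _ _ int int int pos pos pos])
      (use b in \<open>simp_all add: aff M_def\<close>)
  then have "- (I (x + y) + I (x - y) - 2 * I x) / real m \<ge> - \<kappa>\<^sup>2 / real m"
    by (intro divide_right_mono) auto
  also have "- \<kappa>\<^sup>2 / real m = - (real m * K\<^sup>2 * (norm y)\<^sup>2)"
    using m by (simp add: \<kappa>_def power2_eq_square)
  finally show "l (x + y) + l (x - y) - 2 * l x \<ge> - (real m * K\<^sup>2 * (norm y)\<^sup>2)"
    unfolding ll .
qed

text \<open>A smooth upper approximation of \<open>INF i. F i + \<bar>x - e i\<bar>\<^sup>2 / 2\<delta>\<close> built from the first \<open>m\<close> quadratics;
  when the prescribed index \<open>j\<close> is not among them, the \<open>j\<close>-th quadratic alone is used, so that the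
  result is always controlled by that quadratic.\<close>

definition quad_env ::
  "(nat \<Rightarrow> 'a::real_inner) \<Rightarrow> real \<Rightarrow> nat \<Rightarrow> nat \<Rightarrow> (nat \<Rightarrow> real) \<Rightarrow> 'a \<Rightarrow> real" where
  "quad_env e \<delta> m j F x =
     (if j < m then soft_min m (\<lambda>i. F i + (norm (x - e i))\<^sup>2 / (2 * \<delta>)) else F j + (norm (x - e j))\<^sup>2 / (2 * \<delta>))"

lemma quad_env_ge: "\<exists>i. F i + (norm (x - e i))\<^sup>2 / (2 * \<delta>) \<le> quad_env e \<delta> m j F x"
proof (cases "j < m")
  case True
  then show ?thesis
    using soft_min_ge[of m "\<lambda>i. F i + (norm (x - e i))\<^sup>2 / (2 * \<delta>)"] by (auto simp: quad_env_def)
qed (auto simp: quad_env_def)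

lemma quad_env_le: "j < m \<Longrightarrow> i < m \<Longrightarrow> quad_env e \<delta> m j F x \<le> F i + (norm (x - e i))\<^sup>2 / (2 * \<delta>) + ln (real m) / real m"
  using soft_min_le[of i m "\<lambda>i. F i + (norm (x - e i))\<^sup>2 / (2 * \<delta>)"] by (simp add: quad_env_def)

text \<open>The bound is uniform in \<open>m\<close> since ln m \<le> m; this uniformity is what the
  index \<open>j\<close> is for.\<close>

lemma quad_env_le_quadratic: "quad_env e \<delta> m j F x \<le> F j + (norm (x - e j))\<^sup>2 / (2 * \<delta>) + 1"
proof (cases "j < m")
  case True
  have "ln (real m) / real m \<le> 1"
    using True ln_less_self[of "real m"] by (simp add: divide_le_eq less_imp_le)
  then show ?thesis
    using quad_env_le[OF True True, of e \<delta> F x] by simp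
qed (simp add: quad_env_def)

lemma quad_env_nonneg:
  assumes "\<And>i. F i \<ge> 0" "\<delta> > 0"
  shows "quad_env e \<delta> m j F x \<ge> 0"
proof -
  obtain i where "F i + (norm (x - e i))\<^sup>2 / (2 * \<delta>) \<le> quad_env e \<delta> m j F x"
    using quad_env_ge by blast
  moreover have "F i + (norm (x - e i))\<^sup>2 / (2 * \<delta>) \<ge> 0"
    using assms by simp
  ultimately show ?thesis by linarith
qed

lemma continuous_on_quad_env:
  assumes "\<delta> > 0"
  shows "continuous_on UNIV (quad_env e \<delta> m j F)"
proof (cases "j < m")
  case True
  then have "m > 0" by simp
  have "(\<Sum>i<m. exp (- (real m * (F i + (norm (x - e i))\<^sup>2 / (2 * \<delta>))))) \<noteq> 0" for x
    using soft_min_sum_pos[OF \<open>m > 0\<close>, of "\<lambda>i. F i + (norm (x - e i))\<^sup>2 / (2 * \<delta>)"] by linarith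
  then show ?thesis
    using True assms unfolding quad_env_def[abs_def] soft_min_def by (auto intro!: continuous_intros)
next
  case False
  then show ?thesis
    using assms unfolding quad_env_def[abs_def] by (auto intro!: continuous_intros)
qed

lemma borel_measurable_quad_env [measurable (raw)]:
  fixes F :: "'b \<Rightarrow> nat \<Rightarrow> real" and e :: "nat \<Rightarrow> 'a::euclidean_space"
  assumes [measurable]: "\<And>i. (\<lambda>s. F s i) \<in> borel_measurable M" "j \<in> measurable M (count_space UNIV)" "x \<in> borel_measurable M"
  shows "(\<lambda>s. quad_env e \<delta> m (j s) (F s) (x s)) \<in> borel_measurable M"
proof -
  have [measurable]: "(\<lambda>s. F s (j s)) \<in> borel_measurable M"
    by (rule measurable_compose_countable[of "\<lambda>i s. F s i" M borel j]) auto
  show ?thesis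
    unfolding quad_env_def soft_min_def by measurable
qed

text \<open>All the quadratics share the term |x|^2 / (2\<delta>), which the soft minimum lets out,
  and the affine rests have slopes - e i / \<delta>. The values F i enter only through constants, so
  L depends on the first m points and on \<delta> but not on F or j, hence not on the parameter s.
  For \<open>j \<ge> m\<close> there is one quadratic and \<open>l\<close> is constant.\<close>

lemma quad_env_second_diff_bounded:
  fixes e :: "nat \<Rightarrow> real ^ 'n::finite"
  assumes d: "\<delta> > 0"
  obtains L where "L \<ge> 0" and "\<And>j F. (\<And>i. F i \<ge> 0) \<Longrightarrow> second_diff_bounded L (quad_env e \<delta> m j F)"
    and "\<And>j F t. (\<And>i. F i \<ge> 0) \<Longrightarrow> t > 0 \<Longrightarrow> second_diff_bounded L (log_heat t (quad_env e \<delta> m j F))"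
proof -
  define K where "K = (\<Sum>i<m. norm (e i)) / \<delta>"
  define L where "L = 1 / \<delta> + (real m * K\<^sup>2 + K\<^sup>2)"
  have K0: "K \<ge> 0" using d unfolding K_def by (intro divide_nonneg_nonneg sum_nonneg) auto
  have L0: "L \<ge> 0" "L \<ge> 1 / \<delta>" "L \<ge> real m * K\<^sup>2 + K\<^sup>2" using d K0 by (auto simp: L_def)
  have "second_diff_bounded L (quad_env e \<delta> m j F) \<and> second_diff_bounded L (log_heat t (quad_env e \<delta> m j F))"
    if F: "\<And>i. F i \<ge> 0" and t: "t > 0" for j F t
  proof (cases "j < m")
    case True
    then have m: "m > 0" by simp
    define A where "A i = F i + (norm (e i))\<^sup>2 / (2 * \<delta>)" for i
    define p where "p i = - (1 / \<delta>) *\<^sub>R e i" for i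
    have p: "norm (p i) \<le> K" if "i < m" for i
    proof -
      have "norm (e i) \<le> (\<Sum>i<m. norm (e i))" using that by (intro member_le_sum) auto
      then show ?thesis using d by (simp add: p_def K_def divide_right_mono)
    qed
    define l where "l x = soft_min m (\<lambda>i. A i + x \<bullet> p i)" for x
    have lm: "l \<in> borel_measurable borel"
      unfolding l_def[abs_def] soft_min_def by measurable
    have u: "quad_env e \<delta> m j F x = (norm (x - 0))\<^sup>2 / (2 * \<delta>) + l x" for x
    proof -
      have "F i + (norm (x - e i))\<^sup>2 / (2 * \<delta>) = (norm x)\<^sup>2 / (2 * \<delta>) + (A i + x \<bullet> p i)" for i
      proof -
        have "(norm (x - e i))\<^sup>2 = (norm x)\<^sup>2 - 2 * (x \<bullet> e i) + (norm (e i))\<^sup>2"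
          by (simp add: power2_norm_eq_inner algebra_simps inner_commute)
        then have "(norm (x - e i))\<^sup>2 / (2 * \<delta>) = (norm x)\<^sup>2 / (2 * \<delta>) - x \<bullet> e i / \<delta> + (norm (e i))\<^sup>2 / (2 * \<delta>)"
          using d by (simp add: field_simps)
        then show ?thesis by (simp add: A_def p_def)
      qed
      then show ?thesis
        using True by (simp add: quad_env_def l_def soft_min_add_const[OF m])
    qed
    have B: "real m * K\<^sup>2 \<ge> 0" by simp
    note sd = soft_min_affine_second_diff[where p=p and A=A, OF m p, folded l_def]
    have lip: "\<bar>l x - l y\<bar> \<le> K * norm (x - y)" for x y
      unfolding l_def by (rule soft_min_affine_Lipschitz[OF m p])
    show ?thesis
      using second_diff_bounded_log_heat_quadratic[OF lm u quad_env_nonneg[OF F d] d t lip K0 sd B L0(2,3)] by blast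
  next
    case False
    have u: "quad_env e \<delta> m j F x = (norm (x - e j))\<^sup>2 / (2 * \<delta>) + F j" for x
      using False by (simp add: quad_env_def)
    show ?thesis
      by (rule conjI)
        (rule second_diff_bounded_log_heat_quadratic[OF _ u quad_env_nonneg[OF F d] d t, where K=0 and B=0],
          use L0 in auto)+
  qed
  then show thesis
    using that[OF L0(1)] zero_less_one by blast
qed

subsection \<open>Transfer through the contraction\<close>

lemma L2_fun_iff_nn_integral:
  fixes \<alpha> :: "'a \<Rightarrow> 'v::euclidean_space"
  shows "\<alpha> \<in> L2_fun M \<longleftrightarrow> \<alpha> \<in> borel_measurable M \<and> (\<integral>\<^sup>+x. ennreal ((norm (\<alpha> x))\<^sup>2) \<partial>M) < \<infinity>"
  unfolding L2_fun_def by (auto simp: integrable_iff_bounded)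

lemma L2_fun_measurable [measurable_dest]: "\<alpha> \<in> L2_fun M \<Longrightarrow> \<alpha> \<in> borel_measurable M"
  by (simp add: L2_fun_def)

lemma L2_fun_bound:
  fixes \<alpha> :: "'a \<Rightarrow> 'v::euclidean_space" and \<beta> :: "'a \<Rightarrow> 'w::euclidean_space"
  assumes "\<beta> \<in> L2_fun M" and \<gamma>: "\<gamma> \<in> borel_measurable M"
    and "\<alpha> \<in> L2_fun M" and le: "\<And>x. x \<in> space M \<Longrightarrow> norm (\<gamma> x) \<le> norm (\<alpha> x) + norm (\<beta> x)"
  shows "\<gamma> \<in> L2_fun M"
proof -
  have "integrable M (\<lambda>x. (norm (\<gamma> x))\<^sup>2)"
  proof (rule Bochner_Integration.integrable_bound)
    show "integrable M (\<lambda>x. 2 * (norm (\<alpha> x))\<^sup>2 + 2 * (norm (\<beta> x))\<^sup>2)"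
      using assms by (simp add: L2_fun_def)
    show "AE x in M. norm ((norm (\<gamma> x))\<^sup>2) \<le> norm (2 * (norm (\<alpha> x))\<^sup>2 + 2 * (norm (\<beta> x))\<^sup>2)"
    proof (rule AE_I2)
      fix x assume "x \<in> space M"
      then have "(norm (\<gamma> x))\<^sup>2 \<le> (norm (\<alpha> x) + norm (\<beta> x))\<^sup>2"
        by (intro power_mono le) auto
      also have "\<dots> \<le> 2 * (norm (\<alpha> x))\<^sup>2 + 2 * (norm (\<beta> x))\<^sup>2"
        using zero_le_power2[of "norm (\<alpha> x) - norm (\<beta> x)"] by (simp add: power2_eq_square algebra_simps)
      finally show "norm ((norm (\<gamma> x))\<^sup>2) \<le> norm (2 * (norm (\<alpha> x))\<^sup>2 + 2 * (norm (\<beta> x))\<^sup>2)"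
        by simp
    qed
  qed (use \<gamma> in measurable)
  then show ?thesis using \<gamma> by (simp add: L2_fun_def)
qed

lemma L2_fun_add: "\<alpha> \<in> L2_fun M \<Longrightarrow> \<beta> \<in> L2_fun M \<Longrightarrow> (\<lambda>x. \<alpha> x + \<beta> x) \<in> L2_fun M"
  by (rule L2_fun_bound[of \<beta> M _ \<alpha>]) (auto intro: norm_triangle_ineq)

lemma L2_fun_diff: "\<alpha> \<in> L2_fun M \<Longrightarrow> \<beta> \<in> L2_fun M \<Longrightarrow> (\<lambda>x. \<alpha> x - \<beta> x) \<in> L2_fun M"
  by (rule L2_fun_bound[of \<beta> M _ \<alpha>]) (auto intro: norm_triangle_ineq4)

lemma L2_fun_const: "finite_measure M \<Longrightarrow> (\<lambda>x. v) \<in> L2_fun M"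
  by (simp add: L2_fun_def finite_measure.integrable_const)

locale constant_preserving_contraction =
  fixes M1 :: "'a measure" and M2 :: "'b measure"
    and A :: "('a \<Rightarrow> real ^ 'n::finite) \<Rightarrow> ('b \<Rightarrow> real ^ 'n)"
  assumes fin1: "finite_measure M1" and fin2: "finite_measure M2"
    and bl: "bounded_linear_L2 M1 M2 A" and onorm: "onorm_L2 M1 M2 A \<le> 1"
    and const: "\<And>v. AE t in M2. A (\<lambda>s. v) t = v"
begin

sublocale M1: finite_measure M1 by (rule fin1)
sublocale M2: finite_measure M2 by (rule fin2)

lemma A_L2: "\<alpha> \<in> L2_fun M1 \<Longrightarrow> A \<alpha> \<in> L2_fun M2"
  using bl by (simp add: bounded_linear_L2_def)

lemma A_add:
  "\<alpha> \<in> L2_fun M1 \<Longrightarrow> \<beta> \<in> L2_fun M1 \<Longrightarrow> AE t in M2. A (\<lambda>s. \<alpha> s + \<beta> s) t = A \<alpha> t + A \<beta> t"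
  using bl by (simp add: bounded_linear_L2_def)

lemma norm_L2_A_le:
  assumes \<alpha>: "\<alpha> \<in> L2_fun M1"
  shows "norm_L2 M2 (A \<alpha>) \<le> norm_L2 M1 \<alpha>"
proof -
  obtain K where K: "\<And>\<beta>. \<beta> \<in> L2_fun M1 \<Longrightarrow> norm_L2 M2 (A \<beta>) \<le> norm_L2 M1 \<beta> * K"
    using bl unfolding bounded_linear_L2_def by blast
  have nn: "norm_L2 M1 \<beta> \<ge> 0" "norm_L2 M2 (A \<beta>) \<ge> 0" for \<beta> :: "'a \<Rightarrow> real ^ 'n"
    by (simp_all add: norm_L2_def)
  have "norm_L2 M2 (A \<beta>) / norm_L2 M1 \<beta> \<le> \<bar>K\<bar>" if "\<beta> \<in> L2_fun M1" for \<beta>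
  proof (cases "norm_L2 M1 \<beta> = 0")
    case False
    have "norm_L2 M1 \<beta> * K \<le> norm_L2 M1 \<beta> * \<bar>K\<bar>" using nn by (intro mult_left_mono) auto
    then show ?thesis
      using order_trans[OF K[OF that]] nn(1)[of \<beta>] False by (simp add: divide_le_eq mult.commute less_le)
  qed simp
  \<comment> \<open>A supremum of reals bounds its members only if the set is bounded above, so the
    finiteness of \<open>onorm_L2\<close> comes first.\<close>
  then have "bdd_above ((\<lambda>\<beta>. norm_L2 M2 (A \<beta>) / norm_L2 M1 \<beta>) ` L2_fun M1)"
    by (intro bdd_aboveI2)
  then have "norm_L2 M2 (A \<alpha>) / norm_L2 M1 \<alpha> \<le> onorm_L2 M1 M2 A"
    unfolding onorm_L2_def using \<alpha> by (intro cSUP_upper)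
  with onorm have le: "norm_L2 M2 (A \<alpha>) / norm_L2 M1 \<alpha> \<le> 1" by simp
  show ?thesis
  proof (cases "norm_L2 M1 \<alpha> = 0")
    case True
    \<comment> \<open>The quotient has the default value 0 here and carries no information; the
      boundedness of \<open>A\<close> settles the case.\<close>
    then show ?thesis using K[OF \<alpha>] by simp
  next
    case False
    then show ?thesis using le nn(1)[of \<alpha>] by (simp add: divide_le_eq less_le)
  qed
qed

lemma nn_integral_A_le:
  assumes \<alpha>: "\<alpha> \<in> L2_fun M1"
  shows "(\<integral>\<^sup>+t. ennreal ((norm (A \<alpha> t))\<^sup>2) \<partial>M2) \<le> (\<integral>\<^sup>+s. ennreal ((norm (\<alpha> s))\<^sup>2) \<partial>M1)"
proof -
  have "(\<integral>t. (norm (A \<alpha> t))\<^sup>2 \<partial>M2) \<le> (\<integral>s. (norm (\<alpha> s))\<^sup>2 \<partial>M1)"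
    using norm_L2_A_le[OF \<alpha>] by (simp add: norm_L2_def)
  then show ?thesis
    using \<alpha> A_L2[OF \<alpha>] by (simp add: L2_fun_def nn_integral_eq_integral ennreal_leI)
qed

lemma A_diff:
  assumes "\<alpha> \<in> L2_fun M1" "\<beta> \<in> L2_fun M1"
  shows "AE t in M2. A (\<lambda>s. \<alpha> s - \<beta> s) t = A \<alpha> t - A \<beta> t"
proof -
  have "AE t in M2. A (\<lambda>s. (\<alpha> s - \<beta> s) + \<beta> s) t = A (\<lambda>s. \<alpha> s - \<beta> s) t + A \<beta> t"
    by (intro A_add L2_fun_diff assms)
  then show ?thesis by eventually_elim simp
qed

lemma A_add_const:
  assumes "\<alpha> \<in> L2_fun M1"
  shows "AE t in M2. A (\<lambda>s. \<alpha> s + v) t = A \<alpha> t + v"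
  using A_add[OF assms L2_fun_const[OF fin1, of v]] const[of v] by eventually_elim simp

text \<open>The constants absorb the lower bounds of the two families and the errors of the time
  discretisation.\<close>

definition dominated ::
  "('b \<Rightarrow> real ^ 'n \<Rightarrow> ennreal) \<Rightarrow> ennreal \<Rightarrow> ('a \<Rightarrow> real ^ 'n \<Rightarrow> ennreal) \<Rightarrow> ennreal \<Rightarrow> bool" where
  "dominated G c1 F c2 \<longleftrightarrow>
     (\<forall>\<alpha>\<in>L2_fun M1. (\<integral>\<^sup>+t. G t (A \<alpha> t) \<partial>M2) + c1 \<le> (\<integral>\<^sup>+s. F s (\<alpha> s) \<partial>M1) + c2)"

text \<open>Choose \<beta> s close to optimal for \<alpha> s and apply the domination to \<beta>.
  The cost of passing from \<open>A \<beta>\<close> to \<open>A \<alpha>\<close> is at most that of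
  passing from \<beta> to \<alpha>, because \<open>A\<close> is linear and contractive. One-sided
  bounds on \<open>G1\<close> and \<open>F1\<close> suffice, which leaves room for the approximate
  minimisers and for the error of a time step.\<close>

lemma dominated_inf_convolution:
  assumes dom: "dominated G0 c1 F0 c2"
    and [measurable]: "case_prod G0 \<in> borel_measurable (M2 \<Otimes>\<^sub>M borel)"
      "case_prod F0 \<in> borel_measurable (M1 \<Otimes>\<^sub>M borel)" "case_prod F1 \<in> borel_measurable (M1 \<Otimes>\<^sub>M borel)"
    and h: "h > 0"
    and G1: "\<And>t x y. t \<in> space M2 \<Longrightarrow> G1 t x \<le> G0 t y + ennreal ((norm (x - y))\<^sup>2 / (2 * h))"
    and F1: "\<And>s x. s \<in> space M1 \<Longrightarrow> \<exists>i::nat. F0 s (e i) + ennreal ((norm (x - e i))\<^sup>2 / (2 * h)) \<le> F1 s x"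
  shows "dominated G1 c1 F1 c2"
  unfolding dominated_def
proof
  fix \<alpha> :: "'a \<Rightarrow> real ^ 'n" assume \<alpha>: "\<alpha> \<in> L2_fun M1"
  then have [measurable]: "\<alpha> \<in> borel_measurable M1" by (rule L2_fun_measurable)
  show "(\<integral>\<^sup>+t. G1 t (A \<alpha> t) \<partial>M2) + c1 \<le> (\<integral>\<^sup>+s. F1 s (\<alpha> s) \<partial>M1) + c2"
  proof (cases "(\<integral>\<^sup>+s. F1 s (\<alpha> s) \<partial>M1) = \<infinity>")
    case False
    define j where "j s = (LEAST i. F0 s (e i) + ennreal ((norm (\<alpha> s - e i))\<^sup>2 / (2 * h)) \<le> F1 s (\<alpha> s))" for s
    have [measurable]: "j \<in> measurable M1 (count_space UNIV)"
      unfolding j_def[abs_def] by measurable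
    define \<beta> where "\<beta> s = e (j s)" for s
    have [measurable]: "\<beta> \<in> borel_measurable M1"
      unfolding \<beta>_def[abs_def] by measurable
    have \<beta>: "F0 s (\<beta> s) + ennreal ((norm (\<alpha> s - \<beta> s))\<^sup>2 / (2 * h)) \<le> F1 s (\<alpha> s)" if "s \<in> space M1" for s
      unfolding \<beta>_def j_def by (rule LeastI_ex) (rule F1[OF that])
    have sq: "ennreal ((norm v)\<^sup>2 / (2 * h)) = ennreal (1 / (2 * h)) * ennreal ((norm v)\<^sup>2)" for v :: "real ^ 'n"
      using h by (subst ennreal_mult[symmetric]) auto
    have "(\<integral>\<^sup>+s. ennreal ((norm (\<alpha> s - \<beta> s))\<^sup>2 / (2 * h)) \<partial>M1) \<le> (\<integral>\<^sup>+s. F1 s (\<alpha> s) \<partial>M1)"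
      by (intro nn_integral_mono) (use \<beta> in \<open>auto intro: order_trans[OF _ \<beta>]\<close>)
    also have "\<dots> < \<infinity>" using False by (simp add: top.not_eq_extremum)
    finally have "ennreal (1 / (2 * h)) * (\<integral>\<^sup>+s. ennreal ((norm (\<alpha> s - \<beta> s))\<^sup>2) \<partial>M1) < \<infinity>"
      unfolding sq by (subst (asm) nn_integral_cmult) auto
    then have "(\<integral>\<^sup>+s. ennreal ((norm (\<alpha> s - \<beta> s))\<^sup>2) \<partial>M1) < \<infinity>"
      using h by (auto simp: ennreal_mult_less_top)
    \<comment> \<open>The quadratic cost lies below the integrable \<open>F1 s (\<alpha> s)\<close>;
      this is why the selected \<beta> is square-integrable and \<open>A\<close> may be applied to
      it.\<close>
    then have ab: "(\<lambda>s. \<alpha> s - \<beta> s) \<in> L2_fun M1"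
      by (simp add: L2_fun_iff_nn_integral)
    have bL: "\<beta> \<in> L2_fun M1"
      using L2_fun_diff[OF \<alpha> ab] by simp
    note [measurable] = L2_fun_measurable[OF A_L2[OF \<alpha>]] L2_fun_measurable[OF A_L2[OF bL]]
    have "(\<integral>\<^sup>+t. G1 t (A \<alpha> t) \<partial>M2) + c1
      \<le> (\<integral>\<^sup>+t. G0 t (A \<beta> t) + ennreal (1 / (2 * h)) * ennreal ((norm (A \<alpha> t - A \<beta> t))\<^sup>2) \<partial>M2) + c1"
      unfolding sq[symmetric] by (intro add_right_mono nn_integral_mono G1)
    also have "\<dots> = ((\<integral>\<^sup>+t. G0 t (A \<beta> t) \<partial>M2) + c1) + ennreal (1 / (2 * h)) * (\<integral>\<^sup>+t. ennreal ((norm (A \<alpha> t - A \<beta> t))\<^sup>2) \<partial>M2)"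
      by (simp add: nn_integral_add nn_integral_cmult ac_simps)
    also have "(\<integral>\<^sup>+t. ennreal ((norm (A \<alpha> t - A \<beta> t))\<^sup>2) \<partial>M2) = (\<integral>\<^sup>+t. ennreal ((norm (A (\<lambda>s. \<alpha> s - \<beta> s) t))\<^sup>2) \<partial>M2)"
      by (rule nn_integral_cong_AE[OF eventually_mono[OF A_diff[OF \<alpha> bL]]]) simp
    also have "((\<integral>\<^sup>+t. G0 t (A \<beta> t) \<partial>M2) + c1) + ennreal (1 / (2 * h)) * \<dots>
      \<le> ((\<integral>\<^sup>+s. F0 s (\<beta> s) \<partial>M1) + c2) + ennreal (1 / (2 * h)) * (\<integral>\<^sup>+s. ennreal ((norm (\<alpha> s - \<beta> s))\<^sup>2) \<partial>M1)"
      by (rule add_mono[OF dom[unfolded dominated_def, rule_format, OF bL] mult_left_mono[OF nn_integral_A_le[OF ab]]]) simp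
    also have "\<dots> = (\<integral>\<^sup>+s. F0 s (\<beta> s) + ennreal (1 / (2 * h)) * ennreal ((norm (\<alpha> s - \<beta> s))\<^sup>2) \<partial>M1) + c2"
      by (simp add: nn_integral_add nn_integral_cmult ac_simps)
    also have "\<dots> \<le> (\<integral>\<^sup>+s. F1 s (\<alpha> s) \<partial>M1) + c2"
      unfolding sq[symmetric] by (intro add_right_mono nn_integral_mono \<beta>)
    finally show ?thesis .
  qed simp
qed

text \<open>The domination is applied to \<alpha> + z and averaged over \<open>z\<close>:
  \<open>A\<close> maps it to A \<alpha> + z almost everywhere, and Tonelli exchanges the integrals.
  The additive constants survive because the Gaussian has mass one.\<close>

lemma dominated_heat:
  assumes dom: "dominated G c1 F c2"
    and [measurable]: "case_prod G \<in> borel_measurable (M2 \<Otimes>\<^sub>M borel)" "case_prod F \<in> borel_measurable (M1 \<Otimes>\<^sub>M borel)"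
    and h: "h > 0"
  shows "dominated (\<lambda>t x. \<integral>\<^sup>+z. G t (x + z) \<partial>gaussian h) c1 (\<lambda>s x. \<integral>\<^sup>+z. F s (x + z) \<partial>gaussian h) c2"
  unfolding dominated_def
proof
  fix \<alpha> :: "'a \<Rightarrow> real ^ 'n" assume \<alpha>: "\<alpha> \<in> L2_fun M1"
  note [measurable] = L2_fun_measurable[OF \<alpha>] L2_fun_measurable[OF A_L2[OF \<alpha>]]
  interpret \<gamma>: prob_space "gaussian h :: (real ^ 'n) measure" by (rule prob_space_gaussian[OF h])
  interpret p1: pair_sigma_finite M1 "gaussian h :: (real ^ 'n) measure" by unfold_locales
  interpret p2: pair_sigma_finite M2 "gaussian h :: (real ^ 'n) measure" by unfold_locales
  have c: "(\<integral>\<^sup>+z. H z + c \<partial>gaussian h) = (\<integral>\<^sup>+z. H z \<partial>gaussian h) + c"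
    if "H \<in> borel_measurable borel" for H :: "real ^ 'n \<Rightarrow> ennreal" and c
    using that \<gamma>.emeasure_space_1 by (simp add: nn_integral_add)
  have "(\<integral>\<^sup>+t. \<integral>\<^sup>+z. G t (A \<alpha> t + z) \<partial>gaussian h \<partial>M2) + c1 = (\<integral>\<^sup>+z. (\<integral>\<^sup>+t. G t (A \<alpha> t + z) \<partial>M2) + c1 \<partial>gaussian h)"
  proof -
    have "(\<integral>\<^sup>+t. \<integral>\<^sup>+z. G t (A \<alpha> t + z) \<partial>gaussian h \<partial>M2) = (\<integral>\<^sup>+z. \<integral>\<^sup>+t. G t (A \<alpha> t + z) \<partial>M2 \<partial>gaussian h)"
      by (rule p2.Fubini'[symmetric]) measurable
    then show ?thesis by (subst c) auto
  qed
  also have "\<dots> \<le> (\<integral>\<^sup>+z. (\<integral>\<^sup>+s. F s (\<alpha> s + z) \<partial>M1) + c2 \<partial>gaussian h)"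
  proof (intro nn_integral_mono)
    fix z :: "real ^ 'n"
    have "(\<integral>\<^sup>+t. G t (A \<alpha> t + z) \<partial>M2) = (\<integral>\<^sup>+t. G t (A (\<lambda>s. \<alpha> s + z) t) \<partial>M2)"
      by (rule nn_integral_cong_AE[OF eventually_mono[OF A_add_const[OF \<alpha>, of z]]]) simp
    then show "(\<integral>\<^sup>+t. G t (A \<alpha> t + z) \<partial>M2) + c1 \<le> (\<integral>\<^sup>+s. F s (\<alpha> s + z) \<partial>M1) + c2"
      using dom L2_fun_add[OF \<alpha> L2_fun_const[OF fin1, of z]] by (simp add: dominated_def)
  qed
  also have "\<dots> = (\<integral>\<^sup>+s. \<integral>\<^sup>+z. F s (\<alpha> s + z) \<partial>gaussian h \<partial>M1) + c2"
  proof -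
    have "(\<integral>\<^sup>+s. \<integral>\<^sup>+z. F s (\<alpha> s + z) \<partial>gaussian h \<partial>M1) = (\<integral>\<^sup>+z. \<integral>\<^sup>+s. F s (\<alpha> s + z) \<partial>M1 \<partial>gaussian h)"
      by (rule p1.Fubini'[symmetric]) measurable
    then show ?thesis by (subst c) auto
  qed
  finally show "(\<integral>\<^sup>+t. \<integral>\<^sup>+z. G t (A \<alpha> t + z) \<partial>gaussian h \<partial>M2) + c1
    \<le> (\<integral>\<^sup>+s. \<integral>\<^sup>+z. F s (\<alpha> s + z) \<partial>gaussian h \<partial>M1) + c2" .
qed

text \<open>One step of the scheme, averaging and then infimal convolution. \<open>log_heat\<close>
  lies below the result for \<open>G\<close> by \<open>log_heat_le\<close>, and above that for
  \<open>u\<close> up to C h^2 by \<open>log_heat_ge_dense\<close>; the latter error is integrated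
  over \<open>M1\<close>.\<close>

lemma dominated_log_heat_step:
  fixes G :: "'b \<Rightarrow> real ^ 'n \<Rightarrow> real" and u :: "'a \<Rightarrow> real ^ 'n \<Rightarrow> real"
  assumes dom: "dominated (\<lambda>t x. ennreal (G t x)) c1 (\<lambda>s x. ennreal (u s x)) c2"
    and G[measurable]: "case_prod G \<in> borel_measurable (M2 \<Otimes>\<^sub>M borel)" and G0: "\<And>t x. t \<in> space M2 \<Longrightarrow> G t x \<ge> 0"
    and u[measurable]: "case_prod u \<in> borel_measurable (M1 \<Otimes>\<^sub>M borel)" and u0: "\<And>s x. s \<in> space M1 \<Longrightarrow> u s x \<ge> 0"
    and cont: "\<And>s. s \<in> space M1 \<Longrightarrow> continuous_on UNIV (u s)"
    and L: "\<And>s. s \<in> space M1 \<Longrightarrow> second_diff_bounded L (u s)" "L \<ge> 0"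
    and h: "h > 0" "12 * L * h \<le> 1"
  defines "C \<equiv> 144 * L\<^sup>2 * 2 powr (real CARD('n) / 2) + 1"
  shows "dominated (\<lambda>t x. ennreal (log_heat h (G t) x)) c1 (\<lambda>s x. ennreal (log_heat h (u s) x))
    (c2 + ennreal (C * h\<^sup>2) * emeasure M1 (space M1))"
proof -
  obtain e :: "nat \<Rightarrow> real ^ 'n" where e: "dense_seq e" using ex_dense_seq by blast
  interpret \<gamma>: prob_space "gaussian h :: (real ^ 'n) measure" by (rule prob_space_gaussian[OF h(1)])
  have Gt[measurable]: "G t \<in> borel_measurable borel" if "t \<in> space M2" for t
    using measurable_Pair2[OF G that] by simp
  have us: "u s \<in> borel_measurable borel" if "s \<in> space M1" for s
    using measurable_Pair2[OF u that] by simp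
  have C0: "C \<ge> 0" by (simp add: C_def)
  have m[measurable]: "(\<lambda>(s, x). log_heat h (u s) x) \<in> borel_measurable (M1 \<Otimes>\<^sub>M borel)"
    using h by measurable
  have step: "dominated (\<lambda>t x. ennreal (log_heat h (G t) x)) c1 (\<lambda>s x. ennreal (log_heat h (u s) x + C * h\<^sup>2)) c2"
  proof (rule dominated_inf_convolution[OF dominated_heat[OF dom _ _ h(1)], where e=e and h=h])
    show "\<exists>i. (\<integral>\<^sup>+z. ennreal (u s (e i + z)) \<partial>gaussian h) + ennreal ((norm (x - e i))\<^sup>2 / (2 * h))
        \<le> ennreal (log_heat h (u s) x + C * h\<^sup>2)" if "s \<in> space M1" for s x
      unfolding C_def using that by (intro log_heat_ge_dense[OF e cont u0 h(1) L h(2)]) auto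
    show "ennreal (log_heat h (G t) x) \<le> (\<integral>\<^sup>+z. ennreal (G t (y + z)) \<partial>gaussian h) + ennreal ((norm (x - y))\<^sup>2 / (2 * h))"
      if "t \<in> space M2" for t x y
      using that by (intro log_heat_le Gt G0 h)
  qed (use h in measurable)
  show ?thesis
    unfolding dominated_def
  proof
    fix \<alpha> :: "'a \<Rightarrow> real ^ 'n" assume \<alpha>: "\<alpha> \<in> L2_fun M1"
    note [measurable] = L2_fun_measurable[OF \<alpha>]
    have [measurable]: "(\<lambda>s. log_heat h (u s) (\<alpha> s)) \<in> borel_measurable M1"
      using h by measurable
    have "(\<integral>\<^sup>+s. ennreal (log_heat h (u s) (\<alpha> s) + C * h\<^sup>2) \<partial>M1)
      = (\<integral>\<^sup>+s. ennreal (log_heat h (u s) (\<alpha> s)) + ennreal (C * h\<^sup>2) \<partial>M1)"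
      using C0 us u0 h by (intro nn_integral_cong ennreal_plus log_heat_nonneg) auto
    also have "\<dots> = (\<integral>\<^sup>+s. ennreal (log_heat h (u s) (\<alpha> s)) \<partial>M1) + ennreal (C * h\<^sup>2) * emeasure M1 (space M1)"
      by (simp add: nn_integral_add)
    finally have eq: "(\<integral>\<^sup>+s. ennreal (log_heat h (u s) (\<alpha> s) + C * h\<^sup>2) \<partial>M1)
      = (\<integral>\<^sup>+s. ennreal (log_heat h (u s) (\<alpha> s)) \<partial>M1) + ennreal (C * h\<^sup>2) * emeasure M1 (space M1)" .
    show "(\<integral>\<^sup>+t. ennreal (log_heat h (G t) (A \<alpha> t)) \<partial>M2) + c1
      \<le> (\<integral>\<^sup>+s. ennreal (log_heat h (u s) (\<alpha> s)) \<partial>M1) + (c2 + ennreal (C * h\<^sup>2) * emeasure M1 (space M1))"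
      using step[unfolded dominated_def, rule_format, OF \<alpha>] unfolding eq by (simp add: ac_simps)
  qed
qed

lemma dominated_log_heat:
  fixes G :: "'b \<Rightarrow> real ^ 'n \<Rightarrow> real" and u :: "'a \<Rightarrow> real ^ 'n \<Rightarrow> real"
  assumes dom: "dominated (\<lambda>t x. ennreal (G t x)) c1 (\<lambda>s x. ennreal (u s x)) c2"
    and G[measurable]: "case_prod G \<in> borel_measurable (M2 \<Otimes>\<^sub>M borel)" and G0: "\<And>t x. t \<in> space M2 \<Longrightarrow> G t x \<ge> 0"
    and u[measurable]: "case_prod u \<in> borel_measurable (M1 \<Otimes>\<^sub>M borel)" and u0: "\<And>s x. s \<in> space M1 \<Longrightarrow> u s x \<ge> 0"
    and cont: "\<And>s. s \<in> space M1 \<Longrightarrow> continuous_on UNIV (u s)"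
    and L: "\<And>s. s \<in> space M1 \<Longrightarrow> second_diff_bounded L (u s)" "L \<ge> 0"
    and L': "\<And>s t. s \<in> space M1 \<Longrightarrow> t > 0 \<Longrightarrow> second_diff_bounded L (log_heat t (u s))"
    and \<tau>: "\<tau> > 0"
  shows "dominated (\<lambda>t x. ennreal (log_heat \<tau> (G t) x)) c1 (\<lambda>s x. ennreal (log_heat \<tau> (u s) x)) c2"
proof -
  define C where "C = 144 * L\<^sup>2 * 2 powr (real CARD('n) / 2) + 1"
  have C0: "C \<ge> 0" by (simp add: C_def)
  define \<mu> where "\<mu> = measure M1 (space M1)"
  have \<mu>: "emeasure M1 (space M1) = ennreal \<mu>" "\<mu> \<ge> 0"
    by (simp_all add: \<mu>_def M1.emeasure_eq_measure)
  have Gt: "G t \<in> borel_measurable borel" if "t \<in> space M2" for t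
    using measurable_Pair2[OF G that] by simp
  have us: "u s \<in> borel_measurable borel" if "s \<in> space M1" for s
    using measurable_Pair2[OF u that] by simp
  \<comment> \<open>The count starts at one step because \<open>gaussian 0\<close> is the null
    measure, so \<open>log_heat 0\<close> is not the identity.\<close>
  have iter: "dominated (\<lambda>t x. ennreal (log_heat (real (Suc k) * h) (G t) x)) c1
      (\<lambda>s x. ennreal (log_heat (real (Suc k) * h) (u s) x)) (c2 + ennreal (real (Suc k) * (C * h\<^sup>2 * \<mu>)))"
    if h: "h > 0" "12 * L * h \<le> 1" for h k
  proof (induction k)
    case 0
    show ?case
      using dominated_log_heat_step[OF dom G G0 u u0 cont L h] C0 \<mu>
      by (simp add: C_def ennreal_mult)
  next
    case (Suc k)
    define t where "t = real (Suc k) * h"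
    have t: "t > 0" using h by (simp add: t_def)
    have st: "h + t = real (Suc (Suc k)) * h" by (simp add: t_def algebra_simps)
    have "dominated (\<lambda>s x. ennreal (log_heat h (log_heat t (G s)) x)) c1
      (\<lambda>s x. ennreal (log_heat h (log_heat t (u s)) x))
      ((c2 + ennreal (real (Suc k) * (C * h\<^sup>2 * \<mu>))) + ennreal (C * h\<^sup>2) * emeasure M1 (space M1))"
      unfolding C_def
    proof (rule dominated_log_heat_step[OF Suc[folded t_def, unfolded C_def]])
      show "(\<lambda>(s, x). log_heat t (G s) x) \<in> borel_measurable (M2 \<Otimes>\<^sub>M borel)"
        "(\<lambda>(s, x). log_heat t (u s) x) \<in> borel_measurable (M1 \<Otimes>\<^sub>M borel)"
        using t by measurable
    qed (use t h L L' cont Gt us G0 u0 in \<open>auto intro!: log_heat_nonneg continuous_on_log_heat\<close>)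
    moreover have "dominated (\<lambda>s x. ennreal (log_heat h (log_heat t (G s)) x)) c1
        (\<lambda>s x. ennreal (log_heat h (log_heat t (u s)) x)) c
      \<longleftrightarrow> dominated (\<lambda>s x. ennreal (log_heat (h + t) (G s) x)) c1 (\<lambda>s x. ennreal (log_heat (h + t) (u s) x)) c" for c
      unfolding dominated_def using h t G0 u0
      by (simp add: log_heat_semigroup[OF Gt] log_heat_semigroup[OF us] cong: nn_integral_cong)
    moreover have "(c2 + ennreal (real (Suc k) * (C * h\<^sup>2 * \<mu>))) + ennreal (C * h\<^sup>2) * emeasure M1 (space M1)
      = c2 + ennreal (real (Suc (Suc k)) * (C * h\<^sup>2 * \<mu>))"
    proof -
      have "ennreal (C * h\<^sup>2) * emeasure M1 (space M1) = ennreal (C * h\<^sup>2 * \<mu>)"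
        using C0 \<mu> by (simp add: ennreal_mult)
      moreover have "ennreal (real (Suc k) * (C * h\<^sup>2 * \<mu>)) + ennreal (C * h\<^sup>2 * \<mu>) = ennreal (real (Suc (Suc k)) * (C * h\<^sup>2 * \<mu>))"
        using C0 \<mu> by (subst ennreal_plus[symmetric]) (auto simp: algebra_simps)
      ultimately show ?thesis by (simp add: add.assoc)
    qed
    ultimately show ?case unfolding st by metis
  qed
  show ?thesis
    unfolding dominated_def
  proof
    fix \<alpha> :: "'a \<Rightarrow> real ^ 'n" assume \<alpha>: "\<alpha> \<in> L2_fun M1"
    define X where "X = (\<integral>\<^sup>+t. ennreal (log_heat \<tau> (G t) (A \<alpha> t)) \<partial>M2) + c1"
    define Y where "Y = (\<integral>\<^sup>+s. ennreal (log_heat \<tau> (u s) (\<alpha> s)) \<partial>M1)"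
    \<comment> \<open>With k + 1 steps of length \<tau> / (k + 1), errors of order h^2 add up to
      order 1 / (k + 1); the lower bound on k ensures the smallness of each step.\<close>
    have le: "X \<le> Y + (c2 + ennreal (C * \<tau>\<^sup>2 * \<mu> / real (Suc k)))" if k: "real (Suc k) \<ge> 12 * L * \<tau>" for k
    proof -
      define h where "h = \<tau> / real (Suc k)"
      have h: "h > 0" "12 * L * h \<le> 1" "real (Suc k) * h = \<tau>"
        using k \<tau> by (auto simp: h_def divide_le_eq)
      have "real (Suc k) * (C * h\<^sup>2 * \<mu>) = C * \<tau>\<^sup>2 * \<mu> / real (Suc k)"
        by (simp add: h_def power2_eq_square field_simps del: of_nat_Suc)
      then show ?thesis
        using iter[OF h(1,2), of k] \<alpha> unfolding h(3) dominated_def X_def Y_def by simp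
    qed
    have "(\<lambda>k. Y + (c2 + ennreal (C * \<tau>\<^sup>2 * \<mu> / real (Suc k)))) \<longlonglongrightarrow> Y + (c2 + ennreal 0)"
      by (intro tendsto_add tendsto_const tendsto_ennrealI LIMSEQ_Suc lim_const_over_n)
    moreover obtain N where "12 * L * \<tau> \<le> real N" using real_arch_simple by blast
    then have "\<forall>k\<ge>N. X \<le> Y + (c2 + ennreal (C * \<tau>\<^sup>2 * \<mu> / real (Suc k)))"
      by (intro allI impI le) simp
    ultimately show "X \<le> Y + c2"
      using LIMSEQ_le_const by fastforce
  qed
qed

end

subsection \<open>Passage to the limit\<close>

lemma log_heat_tendsto:
  fixes f :: "real ^ 'n::finite \<Rightarrow> real" and u :: "nat \<Rightarrow> real ^ 'n \<Rightarrow> real"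
  assumes [measurable]: "f \<in> borel_measurable borel" "\<And>k. u k \<in> borel_measurable borel"
    and f0: "\<And>x. f x \<ge> 0" and u0: "\<And>k x. u k x \<ge> 0" and h: "h > 0"
    and lim: "\<And>x. (\<lambda>k. u k x) \<longlonglongrightarrow> f x"
  shows "(\<lambda>k. log_heat h (u k) x) \<longlonglongrightarrow> log_heat h f x"
proof -
  interpret prob_space "gaussian h :: (real ^ 'n) measure" by (rule prob_space_gaussian[OF h])
  have "(\<lambda>k. \<integral>z. exp (- u k (x + z)) \<partial>gaussian h) \<longlonglongrightarrow> (\<integral>z. exp (- f (x + z)) \<partial>gaussian h)"
  proof (rule integral_dominated_convergence[where w="\<lambda>_. 1"])
    show "AE z in (gaussian h :: (real ^ 'n) measure). (\<lambda>k. exp (- u k (x + z))) \<longlonglongrightarrow> exp (- f (x + z))"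
      using lim by (auto intro!: tendsto_intros)
  qed (use u0 in auto)
  moreover have "(\<integral>z. exp (- f (x + z)) \<partial>gaussian h) \<noteq> 0"
    using exp_log_heat(2)[of f h x] f0 h by simp
  ultimately show ?thesis
    unfolding log_heat_def by (intro tendsto_intros)
qed

text \<open>A countable infimum, hence measurable in a parameter of \<open>g\<close>; for continuous
  nonnegative \<open>g\<close> and positive \<delta> it agrees with the infimum over the whole
  space, as \<open>inf_conv_le\<close> shows.\<close>

definition inf_conv :: "(nat \<Rightarrow> 'a::real_normed_vector) \<Rightarrow> real \<Rightarrow> ('a \<Rightarrow> real) \<Rightarrow> 'a \<Rightarrow> real" where
  "inf_conv e \<delta> g x = (INF i. g (e i) + (norm (x - e i))\<^sup>2 / (2 * \<delta>))"

lemma inf_conv_nonneg: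
  assumes "\<And>x. g x \<ge> 0" "\<delta> > 0"
  shows "inf_conv e \<delta> g x \<ge> 0"
  unfolding inf_conv_def using assms by (intro cINF_greatest) auto

lemma inf_conv_le:
  assumes e: "dense_seq e" and g: "continuous_on UNIV g" "\<And>x. g x \<ge> 0" and d: "\<delta> > 0"
  shows "inf_conv e \<delta> g x \<le> g y + (norm (x - y))\<^sup>2 / (2 * \<delta>)"
proof (rule field_le_epsilon)
  fix \<epsilon> :: real assume "\<epsilon> > 0"
  then have "\<exists>i. g (e i) + (norm (x - e i))\<^sup>2 / (2 * \<delta>) < g y + (norm (x - y))\<^sup>2 / (2 * \<delta>) + \<epsilon>"
    using d by (intro dense_seq_less[OF e, where w=y]) (auto intro!: continuous_intros g)
  then obtain i where i: "g (e i) + (norm (x - e i))\<^sup>2 / (2 * \<delta>) < g y + (norm (x - y))\<^sup>2 / (2 * \<delta>) + \<epsilon>" ..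
  have "bdd_below (range (\<lambda>i. g (e i) + (norm (x - e i))\<^sup>2 / (2 * \<delta>)))"
    using g d by (intro bdd_belowI2[where m=0]) auto
  then have "inf_conv e \<delta> g x \<le> g (e i) + (norm (x - e i))\<^sup>2 / (2 * \<delta>)"
    unfolding inf_conv_def by (intro cINF_lower) auto
  with i show "inf_conv e \<delta> g x \<le> g y + (norm (x - y))\<^sup>2 / (2 * \<delta>) + \<epsilon>" by simp
qed

lemma inf_conv_tendsto:
  assumes e: "dense_seq e" and g: "continuous_on UNIV g" "\<And>x. g x \<ge> 0"
  shows "(\<lambda>k. inf_conv e (1 / real (Suc k)) g x) \<longlonglongrightarrow> g x"
proof (rule LIMSEQ_I)
  fix \<epsilon> :: real assume eps: "\<epsilon> > 0"
  have "isCont g x" using g(1) by (simp add: continuous_on_eq_continuous_at)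
  then obtain \<rho> where \<rho>: "\<rho> > 0" "\<And>y. dist y x < \<rho> \<Longrightarrow> dist (g y) (g x) < \<epsilon> / 2"
    using eps unfolding continuous_at_eps_delta by (meson half_gt_zero)
  \<comment> \<open>From this index on, the cost of leaving the \<rho>-ball is at least
    \<open>g x\<close>, so distant points cannot lower the infimum below \<open>g x\<close>.\<close>
  obtain N where N: "2 * g x / \<rho>\<^sup>2 \<le> real N" using real_arch_simple by blast
  have "norm (inf_conv e (1 / real (Suc k)) g x - g x) < \<epsilon>" if "k \<ge> N" for k
  proof -
    define \<delta> where "\<delta> = 1 / real (Suc k)"
    have d: "\<delta> > 0" by (simp add: \<delta>_def)
    have "2 * g x / \<rho>\<^sup>2 \<le> real (Suc k)" using N that by simp
    then have big: "g x \<le> \<rho>\<^sup>2 / (2 * \<delta>)"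
      using \<rho>(1) by (simp add: \<delta>_def divide_le_eq mult.commute del: of_nat_Suc)
    have "g x - \<epsilon> / 2 \<le> g y + (norm (x - y))\<^sup>2 / (2 * \<delta>)" for y
    proof (cases "dist y x < \<rho>")
      case True
      then have "g x - \<epsilon> / 2 \<le> g y" using abs_le_D2[OF less_imp_le[OF \<rho>(2)[of y, unfolded dist_real_def]]] by simp
      moreover have "(norm (x - y))\<^sup>2 / (2 * \<delta>) \<ge> 0" using d by simp
      ultimately show ?thesis by simp
    next
      case False
      then have "\<rho>\<^sup>2 \<le> (norm (x - y))\<^sup>2"
        using \<rho>(1) by (intro power_mono) (auto simp: dist_norm norm_minus_commute)
      then have "\<rho>\<^sup>2 / (2 * \<delta>) \<le> (norm (x - y))\<^sup>2 / (2 * \<delta>)"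
        using d by (intro divide_right_mono) auto
      then show ?thesis using big g(2)[of y] eps by linarith
    qed
    then have "g x - \<epsilon> / 2 \<le> inf_conv e \<delta> g x"
      unfolding inf_conv_def by (intro cINF_greatest) auto
    moreover have "inf_conv e \<delta> g x \<le> g x"
      using inf_conv_le[OF e g d, of x x] by simp
    ultimately show ?thesis using eps by (simp add: \<delta>_def abs_if)
  qed
  then show "\<exists>N. \<forall>k\<ge>N. norm (inf_conv e (1 / real (Suc k)) g x - g x) < \<epsilon>" by blast
qed

lemma borel_measurable_inf_conv:
  fixes g :: "'b \<Rightarrow> 'a::euclidean_space \<Rightarrow> real"
  assumes [measurable]: "case_prod g \<in> borel_measurable (M \<Otimes>\<^sub>M borel)"
  shows "(\<lambda>(t, x). inf_conv e \<delta> (g t) x) \<in> borel_measurable (M \<Otimes>\<^sub>M borel)"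
proof -
  have [measurable]: "(\<lambda>p. g (fst p) (e i)) \<in> borel_measurable (M \<Otimes>\<^sub>M borel)" for i
    by measurable
  have "(\<lambda>p. INF i. g (fst p) (e i) + (norm (snd p - e i))\<^sup>2 / (2 * \<delta>)) \<in> borel_measurable (M \<Otimes>\<^sub>M borel)"
    by (intro borel_measurable_cINF_real) auto
  then show ?thesis by (simp add: inf_conv_def case_prod_beta')
qed

text \<open>The envelopes may well stay below \<open>f\<close>; only their upper limit is controlled
  by \<open>f x\<close>. The maximum with \<open>f\<close> turns this one-sided bound into a limit,
  as dominated convergence requires.\<close>

lemma quad_env_tendsto:
  assumes e: "dense_seq e" and f: "continuous_on UNIV f" and d: "\<delta> > 0"
  shows "(\<lambda>m. max (quad_env e \<delta> m j (\<lambda>i. f (e i)) x) (f x)) \<longlonglongrightarrow> f x"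
proof (rule LIMSEQ_I)
  fix \<epsilon> :: real assume eps: "\<epsilon> > 0"
  have "\<exists>i. f (e i) + (norm (x - e i))\<^sup>2 / (2 * \<delta>) < f x + \<epsilon> / 2"
    using d eps by (intro dense_seq_less[OF e, where w=x]) (auto intro!: continuous_intros f)
  then obtain i where i: "f (e i) + (norm (x - e i))\<^sup>2 / (2 * \<delta>) < f x + \<epsilon> / 2" ..
  have "\<forall>\<^sub>F m in sequentially. ln (real m) / real m < \<epsilon> / 2"
    using order_tendstoD(2)[OF lim_ln_over_n, of "\<epsilon> / 2"] eps by simp
  moreover have "\<forall>\<^sub>F m in sequentially. max i j < m" by (rule eventually_gt_at_top)
  ultimately have "\<forall>\<^sub>F m in sequentially. norm (max (quad_env e \<delta> m j (\<lambda>i. f (e i)) x) (f x) - f x) < \<epsilon>"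
  proof eventually_elim
    case (elim m)
    then have "quad_env e \<delta> m j (\<lambda>i. f (e i)) x \<le> f (e i) + (norm (x - e i))\<^sup>2 / (2 * \<delta>) + ln (real m) / real m"
      by (intro quad_env_le) auto
    then have "quad_env e \<delta> m j (\<lambda>i. f (e i)) x < f x + \<epsilon>" using i elim by linarith
    then show ?case using eps by (simp add: max_def)
  qed
  then show "\<exists>N. \<forall>m\<ge>N. norm (max (quad_env e \<delta> m j (\<lambda>i. f (e i)) x) (f x) - f x) < \<epsilon>"
    by (simp add: eventually_sequentially)
qed

text \<open>By monotonicity the maximum of the two flows lies between the flow of \<open>f\<close>
  and the flow of the maximum, and the latter converges.\<close>

lemma log_heat_quad_env_tendsto:
  fixes f :: "real ^ 'n::finite \<Rightarrow> real"
  assumes e: "dense_seq e" and f: "continuous_on UNIV f" "\<And>x. f x \<ge> 0" and d: "\<delta> > 0" and h: "h > 0"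
  shows "(\<lambda>m. max (log_heat h (quad_env e \<delta> m j (\<lambda>i. f (e i))) x) (log_heat h f x)) \<longlonglongrightarrow> log_heat h f x"
proof -
  define u where "u m = quad_env e \<delta> m j (\<lambda>i. f (e i))" for m
  have um[measurable]: "u m \<in> borel_measurable borel" for m
    unfolding u_def by (intro borel_measurable_continuous_onI continuous_on_quad_env d)
  have fm[measurable]: "f \<in> borel_measurable borel"
    using f(1) by (rule borel_measurable_continuous_onI)
  have u0: "u m x \<ge> 0" for m x unfolding u_def by (intro quad_env_nonneg f d)
  have lim: "(\<lambda>m. log_heat h (\<lambda>x. max (u m x) (f x)) x) \<longlonglongrightarrow> log_heat h f x"
  proof (rule log_heat_tendsto[OF fm _ f(2) _ h])
    show "(\<lambda>x. max (u m x) (f x)) \<in> borel_measurable borel" for m by measurable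
    show "max (u m x) (f x) \<ge> 0" for m x using f(2)[of x] by (simp add: le_max_iff_disj)
    show "(\<lambda>m. max (u m x) (f x)) \<longlonglongrightarrow> f x" for x
      unfolding u_def by (rule quad_env_tendsto[OF e f(1) d])
  qed
  have "max (log_heat h (u m) x) (log_heat h f x) \<le> log_heat h (\<lambda>x. max (u m x) (f x)) x" for m
  proof (rule max.boundedI)
    show "log_heat h (u m) x \<le> log_heat h (\<lambda>x. max (u m x) (f x)) x"
      by (rule log_heat_mono[OF um u0 h]) auto
    show "log_heat h f x \<le> log_heat h (\<lambda>x. max (u m x) (f x)) x"
      by (rule log_heat_mono[OF fm f(2) h]) auto
  qed
  then have bd: "\<forall>\<^sub>F m in sequentially. max (log_heat h (u m) x) (log_heat h f x) \<le> log_heat h (\<lambda>x. max (u m x) (f x)) x"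
    by simp
  show ?thesis
    unfolding u_def[symmetric] by (rule tendsto_sandwich[OF _ bd tendsto_const lim]) simp
qed

text \<open>If f x + |x|^2 / (4h) were large everywhere, the integral of exp (- f) would be smaller
  than the value that \<open>log_heat h f 0\<close> records. The index found here has both value and
  distance bounded in terms of that number.\<close>

lemma log_heat_concentration:
  fixes f :: "real ^ 'n::finite \<Rightarrow> real"
  assumes e: "dense_seq e" and f: "continuous_on UNIV f" "\<And>x. f x \<ge> 0" and h: "h > 0"
  shows "\<exists>i. f (e i) + (norm (e i))\<^sup>2 / (4 * h) \<le> log_heat h f 0 + (real CARD('n) + 2)"
proof -
  have fm[measurable]: "f \<in> borel_measurable borel"
    using f(1) by (rule borel_measurable_continuous_onI)
  \<comment> \<open>The logarithm of the integral of the weight exp (|z|^2 / (4h)). It is at most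
    the dimension; of the added 2, one unit makes the contradiction strict and the other pays for
    moving to the dense sequence.\<close>
  define D where "D = ln (2 powr (real CARD('n) / 2))"
  have D: "exp D = 2 powr (real CARD('n) / 2)" unfolding D_def by (rule exp_ln) simp
  have "\<exists>x. f x + (norm x)\<^sup>2 / (4 * h) \<le> log_heat h f 0 + D + 1"
  proof (rule ccontr)
    assume "\<nexists>x. f x + (norm x)\<^sup>2 / (4 * h) \<le> log_heat h f 0 + D + 1"
    then have *: "- f x \<le> - (log_heat h f 0 + D + 1) + (norm x)\<^sup>2 / (4 * h)" for x
    proof -
      have "\<not> f x + (norm x)\<^sup>2 / (4 * h) \<le> log_heat h f 0 + D + 1"
        using \<open>\<nexists>x. f x + (norm x)\<^sup>2 / (4 * h) \<le> log_heat h f 0 + D + 1\<close> by blast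
      then show ?thesis by argo
    qed
    have "(\<integral>z. exp (- f (0 + z)) \<partial>gaussian h) \<le> (\<integral>z. exp (- (log_heat h f 0 + D + 1)) * exp ((norm z)\<^sup>2 / (4 * h)) \<partial>(gaussian h :: (real ^ 'n) measure))"
    proof (rule integral_mono)
      show "integrable (gaussian h) (\<lambda>z. exp (- f (0 + z)))"
        by (rule integrable_exp_neg[OF fm f(2) h])
      show "integrable (gaussian h :: (real ^ 'n) measure) (\<lambda>z. exp (- (log_heat h f 0 + D + 1)) * exp ((norm z)\<^sup>2 / (4 * h)))"
        by (intro integrable_mult_right integrable_gaussian_exp_square h)
      show "exp (- f (0 + z)) \<le> exp (- (log_heat h f 0 + D + 1)) * exp ((norm z)\<^sup>2 / (4 * h))" for z
        unfolding exp_add[symmetric] exp_le_cancel_iff using *[of z] by simp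
    qed
    also have "\<dots> = exp (- (log_heat h f 0 + D + 1)) * exp D"
      using integrable_gaussian_exp_square(2)[OF h, where ?'n='n] by (simp add: D)
    finally have "exp (- log_heat h f 0) \<le> exp (- (log_heat h f 0 + D + 1)) * exp D"
      by (simp only: exp_log_heat(1)[OF fm f(2) h])
    then show False
      unfolding exp_add[symmetric] exp_le_cancel_iff by simp
  qed
  then obtain w where "f w + (norm w)\<^sup>2 / (4 * h) \<le> log_heat h f 0 + D + 1" ..
  then have "\<exists>i. f (e i) + (norm (e i))\<^sup>2 / (4 * h) < log_heat h f 0 + D + 2"
    using h by (intro dense_seq_less[OF e, where w=w]) (auto intro!: continuous_intros f)
  then obtain i where "f (e i) + (norm (e i))\<^sup>2 / (4 * h) < log_heat h f 0 + D + 2" ..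
  moreover have "D \<le> real CARD('n)"
  proof -
    have "real CARD('n) / 2 * ln 2 \<le> real CARD('n) / 2 * 1"
      using ln_2_less_1 by (intro mult_left_mono) auto
    then show ?thesis by (simp add: D_def ln_powr)
  qed
  ultimately have "f (e i) + (norm (e i))\<^sup>2 / (4 * h) \<le> log_heat h f 0 + (real CARD('n) + 2)"
    by argo
  then show ?thesis ..
qed

text \<open>Gibbs' bound without translation estimates the flow by the average of the j-th
  quadratic, whose value and centre are bounded through V. The result is linear in V and independent
  of \<open>m\<close>, so it gives an integrable majorant.\<close>

lemma log_heat_quad_env_le:
  fixes e :: "nat \<Rightarrow> real ^ 'n::finite"
  assumes F: "\<And>i. F i \<ge> 0" and d: "\<delta> > 0" and h: "h > 0" and V: "V \<ge> F j + (norm (e j))\<^sup>2 / (4 * h)"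
  shows "log_heat h (quad_env e \<delta> m j F) 0
    \<le> (1 + 4 * h / \<delta>) * V + (1 + (\<integral>z. (norm z)\<^sup>2 \<partial>(gaussian h :: (real ^ 'n) measure)) / \<delta>)"
proof -
  interpret prob_space "gaussian h :: (real ^ 'n) measure" by (rule prob_space_gaussian[OF h])
  define u where "u = quad_env e \<delta> m j F"
  have [measurable]: "u \<in> borel_measurable borel"
    unfolding u_def by (intro borel_measurable_continuous_onI continuous_on_quad_env d)
  have u0: "u x \<ge> 0" for x unfolding u_def by (intro quad_env_nonneg F d)
  define S where "S = (\<integral>z. (norm z)\<^sup>2 \<partial>(gaussian h :: (real ^ 'n) measure))"
  have S0: "S \<ge> 0" unfolding S_def by (rule integral_nonneg_AE) simp
  have bd: "u z \<le> (F j + 1 + (norm (e j))\<^sup>2 / \<delta>) + (1 / \<delta>) * (norm z)\<^sup>2" for z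
  proof -
    have "(norm (z - e j))\<^sup>2 \<le> (norm z + norm (e j))\<^sup>2"
      by (intro power_mono norm_triangle_ineq4) auto
    also have "\<dots> \<le> 2 * (norm z)\<^sup>2 + 2 * (norm (e j))\<^sup>2"
      using zero_le_power2[of "norm z - norm (e j)"] by (simp add: power2_eq_square algebra_simps)
    finally have "(norm (z - e j))\<^sup>2 / (2 * \<delta>) \<le> (2 * (norm z)\<^sup>2 + 2 * (norm (e j))\<^sup>2) / (2 * \<delta>)"
      using d by (intro divide_right_mono) auto
    also have "\<dots> = (1 / \<delta>) * (norm z)\<^sup>2 + (norm (e j))\<^sup>2 / \<delta>"
      using d by (simp add: field_simps)
    finally show ?thesis
      using quad_env_le_quadratic[of e \<delta> m j F z] unfolding u_def by linarith
  qed
  have int: "integrable (gaussian h :: (real ^ 'n) measure) (\<lambda>z. (F j + 1 + (norm (e j))\<^sup>2 / \<delta>) + (1 / \<delta>) * (norm z)\<^sup>2)"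
    by (intro Bochner_Integration.integrable_add integrable_const integrable_mult_right integrable_gaussian_norm_square h)
  have nn: "F j + 1 + (norm (e j))\<^sup>2 / \<delta> \<ge> 0" using F[of j] d by simp
  have "ennreal (log_heat h u 0) \<le> (\<integral>\<^sup>+z. ennreal (u (0 + z)) \<partial>gaussian h) + ennreal ((norm (0 - 0 :: real ^ 'n))\<^sup>2 / (2 * h))"
    by (rule log_heat_le) (auto intro: u0 h)
  also have "\<dots> \<le> (\<integral>\<^sup>+z. ennreal ((F j + 1 + (norm (e j))\<^sup>2 / \<delta>) + (1 / \<delta>) * (norm z)\<^sup>2) \<partial>(gaussian h :: (real ^ 'n) measure))"
    by (simp del: times_divide_eq_left) (intro nn_integral_mono ennreal_leI bd)
  also have "\<dots> = ennreal (\<integral>z. (F j + 1 + (norm (e j))\<^sup>2 / \<delta>) + (1 / \<delta>) * (norm z)\<^sup>2 \<partial>(gaussian h :: (real ^ 'n) measure))"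
    using nn d by (intro nn_integral_eq_integral int AE_I2) simp
  also have "(\<integral>z. (F j + 1 + (norm (e j))\<^sup>2 / \<delta>) + (1 / \<delta>) * (norm z)\<^sup>2 \<partial>(gaussian h :: (real ^ 'n) measure))
    = (F j + 1 + (norm (e j))\<^sup>2 / \<delta>) + (1 / \<delta>) * S"
    using integrable_gaussian_norm_square[OF h, where ?'n='n] by (simp add: S_def prob_space[simplified])
  finally have "log_heat h u 0 \<le> (F j + 1 + (norm (e j))\<^sup>2 / \<delta>) + (1 / \<delta>) * S"
    using nn S0 d by (subst (asm) ennreal_le_iff) auto
  also have "\<dots> \<le> (1 + 4 * h / \<delta>) * V + (1 + S / \<delta>)"
  proof -
    have "(norm (e j))\<^sup>2 / (4 * h) \<le> V" and FV: "F j \<le> V"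
      using V F[of j] h by (auto intro: order_trans[rotated])
    then have "(norm (e j))\<^sup>2 / \<delta> \<le> 4 * h / \<delta> * V"
      using h d by (simp add: field_simps)
    then show ?thesis using FV by (simp add: algebra_simps)
  qed
  finally show ?thesis unfolding u_def S_def .
qed

section \<open>Removing the regularisations\<close>

context constant_preserving_contraction
begin

lemma log_heat_inf_conv_le:
  fixes f :: "'a \<Rightarrow> real ^ 'n \<Rightarrow> real" and g :: "'b \<Rightarrow> real ^ 'n \<Rightarrow> real"
  assumes dom: "dominated (\<lambda>t x. ennreal (g t x)) c1 (\<lambda>s x. ennreal (f s x)) c2"
    and g[measurable]: "case_prod g \<in> borel_measurable (M2 \<Otimes>\<^sub>M borel)" and g0: "\<And>t x. t \<in> space M2 \<Longrightarrow> g t x \<ge> 0"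
    and gc: "\<And>t. t \<in> space M2 \<Longrightarrow> continuous_on UNIV (g t)"
    and f[measurable]: "case_prod f \<in> borel_measurable (M1 \<Otimes>\<^sub>M borel)" and f0: "\<And>s x. s \<in> space M1 \<Longrightarrow> f s x \<ge> 0"
    and fc: "\<And>s. s \<in> space M1 \<Longrightarrow> continuous_on UNIV (f s)"
    and \<tau>: "\<tau> > 0" and e: "dense_seq e" and d: "\<delta> > 0"
  shows "(\<integral>\<^sup>+t. ennreal (log_heat \<tau> (inf_conv e \<delta> (g t)) 0) \<partial>M2) + c1
    \<le> (\<integral>\<^sup>+s. ennreal (log_heat \<tau> (f s) 0) \<partial>M1) + c2"
proof (cases "(\<integral>\<^sup>+s. ennreal (log_heat \<tau> (f s) 0) \<partial>M1) = \<infinity>")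
  case False
  define W where "W s = log_heat \<tau> (f s) 0" for s
  have Wm[measurable]: "W \<in> borel_measurable M1" unfolding W_def[abs_def] using \<tau> by measurable
  have fs: "f s \<in> borel_measurable borel" if "s \<in> space M1" for s
    using measurable_Pair2[OF f that] by simp
  have W0: "W s \<ge> 0" if "s \<in> space M1" for s
    unfolding W_def using that by (intro log_heat_nonneg fs f0 \<tau>)
  have [measurable]: "(\<lambda>s. f s (e i)) \<in> borel_measurable M1" for i by measurable
  define N where "N = real CARD('n) + 2"
  define j where "j s = (LEAST i. f s (e i) + (norm (e i))\<^sup>2 / (4 * \<tau>) \<le> W s + N)" for s
  have jm[measurable]: "j \<in> measurable M1 (count_space UNIV)"
    unfolding j_def[abs_def] by measurable
  have j: "f s (e (j s)) + (norm (e (j s)))\<^sup>2 / (4 * \<tau>) \<le> W s + N" if "s \<in> space M1" for s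
    unfolding j_def N_def W_def by (rule LeastI_ex) (use log_heat_concentration[OF e fc f0 \<tau>] that in blast)
  define u where "u m s = quad_env e \<delta> m (j s) (\<lambda>i. f s (e i))" for m s
  have u[measurable]: "(\<lambda>(s, x). u m s x) \<in> borel_measurable (M1 \<Otimes>\<^sub>M borel)" for m
    unfolding u_def case_prod_beta' by measurable
  have u0: "u m s x \<ge> 0" if "s \<in> space M1" for m s x
    unfolding u_def using that by (intro quad_env_nonneg f0 d)
  have G[measurable]: "(\<lambda>(t, x). inf_conv e \<delta> (g t) x) \<in> borel_measurable (M2 \<Otimes>\<^sub>M borel)"
    by (rule borel_measurable_inf_conv) measurable
  have le: "(\<integral>\<^sup>+t. ennreal (log_heat \<tau> (inf_conv e \<delta> (g t)) 0) \<partial>M2) + c1 \<le> (\<integral>\<^sup>+s. ennreal (max (log_heat \<tau> (u m s) 0) (W s)) \<partial>M1) + c2" for m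
  proof -
    obtain L where L: "L \<ge> 0" "\<And>j F. (\<And>i. F i \<ge> 0) \<Longrightarrow> second_diff_bounded L (quad_env e \<delta> m j F)"
      "\<And>j F t. (\<And>i. F i \<ge> 0) \<Longrightarrow> t > 0 \<Longrightarrow> second_diff_bounded L (log_heat t (quad_env e \<delta> m j F))"
      using quad_env_second_diff_bounded[OF d] by blast
    have "dominated (\<lambda>t x. ennreal (inf_conv e \<delta> (g t) x)) c1 (\<lambda>s x. ennreal (u m s x)) c2"
    proof (rule dominated_inf_convolution[OF dom _ _ _ d, where e=e])
      show "ennreal (inf_conv e \<delta> (g t) x) \<le> ennreal (g t y) + ennreal ((norm (x - y))\<^sup>2 / (2 * \<delta>))"
        if "t \<in> space M2" for t x y
        using inf_conv_le[OF e gc[OF that] g0[OF that] d, of x y] g0[OF that, of y] d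
        by (simp add: ennreal_leI flip: ennreal_plus)
      show "\<exists>i. ennreal (f s (e i)) + ennreal ((norm (x - e i))\<^sup>2 / (2 * \<delta>)) \<le> ennreal (u m s x)"
        if "s \<in> space M1" for s x
      proof -
        obtain i where "f s (e i) + (norm (x - e i))\<^sup>2 / (2 * \<delta>) \<le> u m s x"
          using quad_env_ge[of "\<lambda>i. f s (e i)" x e \<delta> m "j s"] unfolding u_def by blast
        then show ?thesis
          using that d f0 by (intro exI[of _ i]) (auto simp flip: ennreal_plus intro!: ennreal_leI)
      qed
    qed measurable
    then have "dominated (\<lambda>t x. ennreal (log_heat \<tau> (inf_conv e \<delta> (g t)) x)) c1 (\<lambda>s x. ennreal (log_heat \<tau> (u m s) x)) c2"
    proof (rule dominated_log_heat[where L=L])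
      show "0 \<le> inf_conv e \<delta> (g t) x" if "t \<in> space M2" for t x
        using that by (intro inf_conv_nonneg g0 d)
      show "continuous_on UNIV (u m s)" for s
        unfolding u_def by (rule continuous_on_quad_env[OF d])
      show "second_diff_bounded L (u m s)" if "s \<in> space M1" for s
        unfolding u_def using that by (intro L f0)
      show "second_diff_bounded L (log_heat t (u m s))" if "s \<in> space M1" "t > 0" for s t
        unfolding u_def using that by (intro L f0)
    qed (use u0 L \<tau> in auto)
    \<comment> \<open>From here on only \<alpha> = 0 matters; the domination for all \<alpha> was
      needed to iterate the steps.\<close>
    then have "(\<integral>\<^sup>+t. ennreal (log_heat \<tau> (inf_conv e \<delta> (g t)) (A (\<lambda>s. 0) t)) \<partial>M2) + c1
      \<le> (\<integral>\<^sup>+s. ennreal (log_heat \<tau> (u m s) 0) \<partial>M1) + c2"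
      unfolding dominated_def using L2_fun_const[OF fin1, of 0] by (rule bspec)
    also have "(\<integral>\<^sup>+t. ennreal (log_heat \<tau> (inf_conv e \<delta> (g t)) (A (\<lambda>s. 0) t)) \<partial>M2)
      = (\<integral>\<^sup>+t. ennreal (log_heat \<tau> (inf_conv e \<delta> (g t)) 0) \<partial>M2)"
      by (rule nn_integral_cong_AE[OF eventually_mono[OF const[of 0]]]) simp
    also have "(\<integral>\<^sup>+s. ennreal (log_heat \<tau> (u m s) 0) \<partial>M1) \<le> (\<integral>\<^sup>+s. ennreal (max (log_heat \<tau> (u m s) 0) (W s)) \<partial>M1)"
      by (intro nn_integral_mono ennreal_leI) simp
    finally show ?thesis by simp
  qed
  define a b where "a = 1 + 4 * \<tau> / \<delta>" and "b = 1 + (\<integral>z. (norm z)\<^sup>2 \<partial>(gaussian \<tau> :: (real ^ 'n) measure)) / \<delta>"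
  have a: "a \<ge> 1" using \<tau> d by (simp add: a_def)
  have b: "b \<ge> 0" unfolding b_def using d by (intro add_nonneg_nonneg divide_nonneg_nonneg integral_nonneg_AE) auto
  have N0: "N \<ge> 0" by (simp add: N_def)
  have "(\<lambda>m. \<integral>\<^sup>+s. ennreal (max (log_heat \<tau> (u m s) 0) (W s)) \<partial>M1) \<longlonglongrightarrow> (\<integral>\<^sup>+s. ennreal (W s) \<partial>M1)"
  \<comment> \<open>The majorant is integrable since W is in the present case and \<open>M1\<close>
    is finite; the coefficients come from \<open>log_heat_quad_env_le\<close> with V = W s +
    N.\<close>
  proof (rule nn_integral_dominated_convergence[where w="\<lambda>s. ennreal a * ennreal (W s) + ennreal (a * N + b)"])
    show "(\<lambda>s. ennreal (max (log_heat \<tau> (u m s) 0) (W s))) \<in> borel_measurable M1" for m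
      using \<tau> by measurable
    show "AE s in M1. ennreal (max (log_heat \<tau> (u m s) 0) (W s)) \<le> ennreal a * ennreal (W s) + ennreal (a * N + b)" for m
    proof (rule AE_I2)
      fix s assume s: "s \<in> space M1"
      have "log_heat \<tau> (u m s) 0 \<le> a * (W s + N) + b"
        unfolding a_def b_def u_def using s by (intro log_heat_quad_env_le f0 d \<tau> j)
      moreover have "W s \<le> a * W s" using mult_right_mono[OF a W0[OF s]] by simp
      moreover have "a * N \<ge> 0" using a N0 by simp
      ultimately have "max (log_heat \<tau> (u m s) 0) (W s) \<le> a * W s + (a * N + b)"
        using b by (simp add: algebra_simps)
      then show "ennreal (max (log_heat \<tau> (u m s) 0) (W s)) \<le> ennreal a * ennreal (W s) + ennreal (a * N + b)"
        using a W0[OF s] N0 b by (simp add: ennreal_leI flip: ennreal_mult ennreal_plus)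
    qed
    show "(\<integral>\<^sup>+s. ennreal a * ennreal (W s) + ennreal (a * N + b) \<partial>M1) < \<infinity>"
      using False[folded W_def]
      by (simp add: nn_integral_add nn_integral_cmult ennreal_mult_eq_top_iff less_top[symmetric])
    show "AE s in M1. (\<lambda>m. ennreal (max (log_heat \<tau> (u m s) 0) (W s))) \<longlonglongrightarrow> ennreal (W s)"
      unfolding u_def W_def
      by (intro AE_I2 tendsto_ennrealI log_heat_quad_env_tendsto e fc f0 d \<tau>)
  qed measurable
  then have "(\<lambda>m. (\<integral>\<^sup>+s. ennreal (max (log_heat \<tau> (u m s) 0) (W s)) \<partial>M1) + c2) \<longlonglongrightarrow> (\<integral>\<^sup>+s. ennreal (W s) \<partial>M1) + c2"
    by (intro tendsto_add tendsto_const)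
  then show ?thesis
    using le unfolding W_def[symmetric] by (intro LIMSEQ_le_const) auto
qed simp

text \<open>The bound from \<open>log_heat_inf_conv_le\<close> no longer contains \<delta> on the
  side of \<open>f\<close>, so only the side of \<open>g\<close> passes to the limit, and Fatou's
  lemma is enough.\<close>

lemma log_heat_integral_le:
  fixes f :: "'a \<Rightarrow> real ^ 'n \<Rightarrow> real" and g :: "'b \<Rightarrow> real ^ 'n \<Rightarrow> real"
  assumes dom: "dominated (\<lambda>t x. ennreal (g t x)) c1 (\<lambda>s x. ennreal (f s x)) c2" and c1: "c1 < \<infinity>"
    and g[measurable]: "case_prod g \<in> borel_measurable (M2 \<Otimes>\<^sub>M borel)" and g0: "\<And>t x. t \<in> space M2 \<Longrightarrow> g t x \<ge> 0"
    and gc: "\<And>t. t \<in> space M2 \<Longrightarrow> continuous_on UNIV (g t)"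
    and f[measurable]: "case_prod f \<in> borel_measurable (M1 \<Otimes>\<^sub>M borel)" and f0: "\<And>s x. s \<in> space M1 \<Longrightarrow> f s x \<ge> 0"
    and fc: "\<And>s. s \<in> space M1 \<Longrightarrow> continuous_on UNIV (f s)"
    and \<tau>: "\<tau> > 0"
  shows "(\<integral>\<^sup>+t. ennreal (log_heat \<tau> (g t) 0) \<partial>M2) + c1 \<le> (\<integral>\<^sup>+s. ennreal (log_heat \<tau> (f s) 0) \<partial>M1) + c2"
proof -
  obtain e :: "nat \<Rightarrow> real ^ 'n" where e: "dense_seq e" using ex_dense_seq by blast
  define G where "G k t = inf_conv e (1 / real (Suc k)) (g t)" for k t
  have G[measurable]: "(\<lambda>(t, x). G k t x) \<in> borel_measurable (M2 \<Otimes>\<^sub>M borel)" for k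
    unfolding G_def by (rule borel_measurable_inf_conv) measurable
  have gt: "g t \<in> borel_measurable borel" and Gt: "G k t \<in> borel_measurable borel" if "t \<in> space M2" for t k
    using measurable_Pair2[OF g that] measurable_Pair2[OF G that, of k] by simp_all
  define Z where "Z = (\<integral>\<^sup>+s. ennreal (log_heat \<tau> (f s) 0) \<partial>M1) + c2"
  have le: "(\<integral>\<^sup>+t. ennreal (log_heat \<tau> (G k t) 0) \<partial>M2) + c1 \<le> Z" for k
    unfolding G_def Z_def by (rule log_heat_inf_conv_le[OF dom g g0 gc f f0 fc \<tau> e]) simp_all
  have lim: "(\<lambda>k. ennreal (log_heat \<tau> (G k t) 0)) \<longlonglongrightarrow> ennreal (log_heat \<tau> (g t) 0)" if t: "t \<in> space M2" for t
  proof (intro tendsto_ennrealI log_heat_tendsto gt Gt t g0 \<tau>)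
    show "(\<lambda>k. G k t x) \<longlonglongrightarrow> g t x" for x
      unfolding G_def using t by (intro inf_conv_tendsto e gc g0)
    show "G k t x \<ge> 0" for k x
      unfolding G_def using t by (intro inf_conv_nonneg g0) auto
  qed
  have "(\<integral>\<^sup>+t. ennreal (log_heat \<tau> (g t) 0) \<partial>M2) = (\<integral>\<^sup>+t. liminf (\<lambda>k. ennreal (log_heat \<tau> (G k t) 0)) \<partial>M2)"
    by (intro nn_integral_cong lim_imp_Liminf[OF _ lim, symmetric]) simp
  also have "\<dots> \<le> liminf (\<lambda>k. \<integral>\<^sup>+t. ennreal (log_heat \<tau> (G k t) 0) \<partial>M2)"
    using \<tau> by (intro nn_integral_liminf) measurable
  \<comment> \<open>The finite constant is moved across to apply Fatou to the integrals alone; the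
    truncated subtraction is undone below because c1 \<le> Z.\<close>
  also have "\<dots> \<le> Z - c1"
  proof -
    have "(\<integral>\<^sup>+t. ennreal (log_heat \<tau> (G k t) 0) \<partial>M2) \<le> Z - c1" for k
      using ennreal_minus_mono[OF le[of k] order_refl[of c1]] c1 by simp
    then show ?thesis by (intro Liminf_le) auto
  qed
  finally have "(\<integral>\<^sup>+t. ennreal (log_heat \<tau> (g t) 0) \<partial>M2) + c1 \<le> Z - c1 + c1"
    by (rule add_right_mono)
  also have "Z - c1 + c1 = Z"
    using le[of 0] by (intro diff_add_cancel_ennreal) (auto intro: order_trans[rotated])
  finally show ?thesis unfolding Z_def .
qed

end

section \<open>Extended integrals and the shift by the lower bounds\<close>

lemma ext_integral_cong:
  "(\<And>x. x \<in> space M \<Longrightarrow> F x = G x) \<Longrightarrow> ext_integral M F = ext_integral M G"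
  unfolding ext_integral_def by (simp cong: nn_integral_cong)

text \<open>Reduces signed integrals to nonnegative ones. The negative part is dominated by
  \<open>l\<close>, so its integral is finite and the identity P + q = p + c may be rearranged even
  when p and P are infinite.\<close>

lemma ext_integral_bounded_below:
  fixes F l :: "'a \<Rightarrow> real"
  assumes [measurable]: "F \<in> borel_measurable M" and l: "integrable M l" "\<And>x. x \<in> space M \<Longrightarrow> l x \<ge> 0"
    and ge: "\<And>x. x \<in> space M \<Longrightarrow> F x \<ge> - l x"
  shows "ext_integral M (\<lambda>x. ereal (F x)) = enn2ereal (\<integral>\<^sup>+x. ennreal (F x + l x) \<partial>M) - ereal (\<integral>x. l x \<partial>M)"
proof -
  define p q P c where "p = (\<integral>\<^sup>+x. ennreal (F x) \<partial>M)" and "q = (\<integral>\<^sup>+x. ennreal (- F x) \<partial>M)"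
    and "P = (\<integral>\<^sup>+x. ennreal (F x + l x) \<partial>M)" and "c = (\<integral>x. l x \<partial>M)"
  have [measurable]: "l \<in> borel_measurable M" using l by auto
  have c: "(\<integral>\<^sup>+x. ennreal (l x) \<partial>M) = ennreal c" "c \<ge> 0"
    unfolding c_def using l by (auto intro!: nn_integral_eq_integral integral_nonneg_AE)
  have "q \<le> (\<integral>\<^sup>+x. ennreal (l x) \<partial>M)"
    unfolding q_def by (intro nn_integral_mono ennreal_leI) (use ge in force)
  then have q: "q < \<infinity>" unfolding c by (auto simp: top.not_eq_extremum intro: order_le_less_trans)
  have "P + q = (\<integral>\<^sup>+x. ennreal (F x + l x) + ennreal (- F x) \<partial>M)"
    unfolding P_def q_def by (rule nn_integral_add[symmetric]) measurable
  also have "\<dots> = (\<integral>\<^sup>+x. ennreal (F x) + ennreal (l x) \<partial>M)"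
  proof (rule nn_integral_cong)
    fix x assume x: "x \<in> space M"
    show "ennreal (F x + l x) + ennreal (- F x) = ennreal (F x) + ennreal (l x)"
    proof (cases "F x \<ge> 0")
      case True
      then show ?thesis using l(2)[OF x] by (simp add: ennreal_neg)
    next
      case False
      then have "ennreal (F x + l x) + ennreal (- F x) = ennreal (F x + l x + - F x)"
        using ge[OF x] by (intro ennreal_plus[symmetric]) auto
      then show ?thesis using False by (simp add: ennreal_neg)
    qed
  qed
  also have "\<dots> = p + ennreal c"
    unfolding p_def c(1)[symmetric] by (rule nn_integral_add) measurable
  finally have "P + q = p + ennreal c" .
  then have "enn2ereal p - enn2ereal q = enn2ereal P - ereal c"
    using q c(2) by (cases p; cases q; cases P) (auto simp: enn2ereal_ennreal simp flip: ennreal_plus)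
  then show ?thesis
    unfolding ext_integral_def p_def q_def P_def c_def by simp
qed

lemma enn2ereal_diff_le_iff:
  assumes "c1 \<ge> 0" "c2 \<ge> 0"
  shows "enn2ereal X - ereal c2 \<le> enn2ereal Y - ereal c1 \<longleftrightarrow> X + ennreal c1 \<le> Y + ennreal c2"
  using assms by (cases X; cases Y) (auto simp: enn2ereal_ennreal algebra_simps top_unique simp flip: ennreal_plus)

text \<open>The integral is positive and at most exp c, so \<open>ln_ennreal\<close> is in its real
  branch; adding \<open>c\<close> to \<open>g\<close> takes a factor exp c out of the
  integral.\<close>

lemma ln_ennreal_gaussian:
  fixes g :: "real ^ 'n::finite \<Rightarrow> real"
  assumes [measurable]: "g \<in> borel_measurable borel" and g: "\<And>x. g x \<ge> - c" and \<tau>: "\<tau> > 0"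
  shows "- ln_ennreal (\<integral>\<^sup>+x. ennreal (exp (- g x)) \<partial>gaussian \<tau>) = ereal (log_heat \<tau> (\<lambda>x. g x + c) 0 - c)"
proof -
  have m: "(\<lambda>x. g x + c) \<in> borel_measurable borel" by measurable
  have nn: "g x + c \<ge> 0" for x using g[of x] by linarith
  have "(\<integral>\<^sup>+x. ennreal (exp (- g x)) \<partial>gaussian \<tau>) = (\<integral>\<^sup>+x. ennreal (exp c) * ennreal (exp (- (g (0 + x) + c))) \<partial>gaussian \<tau>)"
  proof (rule nn_integral_cong)
    fix x
    have "exp (- g x) = exp c * exp (- (g (0 + x) + c))"
      unfolding exp_add[symmetric] by simp
    then show "ennreal (exp (- g x)) = ennreal (exp c) * ennreal (exp (- (g (0 + x) + c)))"
      by (simp add: ennreal_mult)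
  qed
  also have "\<dots> = ennreal (exp c) * ennreal (exp (- log_heat \<tau> (\<lambda>x. g x + c) 0))"
    using integrable_exp_neg[OF m nn \<tau>, of 0]
    by (subst nn_integral_cmult) (auto simp: nn_integral_eq_integral exp_log_heat[OF m nn \<tau>])
  also have "\<dots> = ennreal (exp (c - log_heat \<tau> (\<lambda>x. g x + c) 0))"
    using exp_add[of c "- log_heat \<tau> (\<lambda>x. g x + c) 0"] by (simp flip: ennreal_mult)
  finally show ?thesis by (simp add: ln_ennreal_def)
qed

theorem proposition2p4:
  fixes M1 :: "'a::polish_space measure"
    and M2 :: "'b measure"
    and A :: "('a \<Rightarrow> real ^ 'n::finite) \<Rightarrow> ('b \<Rightarrow> real ^ 'n)"
    and f :: "'a \<Rightarrow> real ^ 'n \<Rightarrow> real"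
    and g :: "'b \<Rightarrow> real ^ 'n \<Rightarrow> real"
    and l1 a b :: "'a \<Rightarrow> real"
    and l2 :: "'b \<Rightarrow> real"
    and \<tau> :: real
  assumes "finite_measure M1" and "sets M1 = sets borel"
    and "finite_measure M2"
    and "bounded_linear_L2 M1 M2 A"
    and "onorm_L2 M1 M2 A \<le> 1"
    and "\<And>v. AE t in M2. A (\<lambda>s. v) t = v"
    and "\<And>s. s \<in> space M1 \<Longrightarrow> continuous_on UNIV (f s)"
    and "\<And>t. t \<in> space M2 \<Longrightarrow> continuous_on UNIV (g t)"
    and "(\<lambda>(s, x). f s x) \<in> borel_measurable (M1 \<Otimes>\<^sub>M borel)"
    and "(\<lambda>(t, x). g t x) \<in> borel_measurable (M2 \<Otimes>\<^sub>M borel)"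
    and "semi_integrable M1 (\<lambda>s. ln_ennreal (\<integral>\<^sup>+x. ennreal (exp (- f s x)) \<partial>lborel))"
    and "semi_integrable M2 (\<lambda>t. ln_ennreal (\<integral>\<^sup>+x. ennreal (exp (- g t x)) \<partial>lborel))"
    and "integrable M1 l1" and "\<And>s. s \<in> space M1 \<Longrightarrow> l1 s \<ge> 0"
    and "integrable M2 l2" and "\<And>t. t \<in> space M2 \<Longrightarrow> l2 t \<ge> 0"
    and "\<And>s x. s \<in> space M1 \<Longrightarrow> f s x \<ge> - l1 s"
    and "\<And>t x. t \<in> space M2 \<Longrightarrow> g t x \<ge> - l2 t"
    and "a \<in> borel_measurable M1" and "\<And>s. s \<in> space M1 \<Longrightarrow> a s \<ge> 0"
    and "b \<in> borel_measurable M1" and "\<And>s. s \<in> space M1 \<Longrightarrow> b s \<ge> 0"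
    and "\<And>s x. s \<in> space M1 \<Longrightarrow> f s x \<le> a s * exp (b s * norm x)"
    and "\<And>\<alpha>. \<alpha> \<in> L2_fun M1 \<Longrightarrow>
           ext_integral M2 (\<lambda>t. ereal (g t (A \<alpha> t))) \<le> ext_integral M1 (\<lambda>s. ereal (f s (\<alpha> s)))"
    and "\<tau> > 0"
  shows "ext_integral M2 (\<lambda>t. - ln_ennreal (\<integral>\<^sup>+x. ennreal (exp (- g t x)) \<partial>gaussian \<tau>))
       \<le> ext_integral M1 (\<lambda>s. - ln_ennreal (\<integral>\<^sup>+x. ennreal (exp (- f s x)) \<partial>gaussian \<tau>))"
proof -
  interpret constant_preserving_contraction M1 M2 A
    by (rule constant_preserving_contraction.intro) (fact assms)+
  note [measurable] = assms(9,10)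
  have [measurable]: "l1 \<in> borel_measurable M1" "l2 \<in> borel_measurable M2"
    using assms(13,15) by auto
  \<comment> \<open>Each family is raised by its own lower bound. Moved across the inequality the
    shifts change sides: the constant of \<open>f\<close> joins the integral of \<open>g'\<close>,
    and conversely.\<close>
  define c1 c2 where "c1 = (\<integral>s. l1 s \<partial>M1)" and "c2 = (\<integral>t. l2 t \<partial>M2)"
  have c: "c1 \<ge> 0" "c2 \<ge> 0"
    unfolding c1_def c2_def using assms(14,16) by (auto intro!: integral_nonneg_AE AE_I2)
  define f' g' where "f' s x = f s x + l1 s" and "g' t x = g t x + l2 t" for s t x
  have f'[measurable]: "case_prod f' \<in> borel_measurable (M1 \<Otimes>\<^sub>M borel)"
    and g'[measurable]: "case_prod g' \<in> borel_measurable (M2 \<Otimes>\<^sub>M borel)"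
    unfolding f'_def[abs_def] g'_def[abs_def] by measurable
  have f'0: "f' s x \<ge> 0" if "s \<in> space M1" for s x using assms(17)[OF that, of x] by (simp add: f'_def)
  have g'0: "g' t x \<ge> 0" if "t \<in> space M2" for t x using assms(18)[OF that, of x] by (simp add: g'_def)
  have fs: "f s \<in> borel_measurable borel" if "s \<in> space M1" for s
    by (rule borel_measurable_continuous_onI[OF assms(7)[OF that]])
  have gt: "g t \<in> borel_measurable borel" if "t \<in> space M2" for t
    by (rule borel_measurable_continuous_onI[OF assms(8)[OF that]])
  have "dominated (\<lambda>t x. ennreal (g' t x)) (ennreal c1) (\<lambda>s x. ennreal (f' s x)) (ennreal c2)"
    unfolding dominated_def
  proof
    fix \<alpha> :: "'a \<Rightarrow> real ^ 'n" assume \<alpha>: "\<alpha> \<in> L2_fun M1"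
    note [measurable] = L2_fun_measurable[OF \<alpha>] L2_fun_measurable[OF A_L2[OF \<alpha>]]
    have "ext_integral M2 (\<lambda>t. ereal (g t (A \<alpha> t))) = enn2ereal (\<integral>\<^sup>+t. ennreal (g' t (A \<alpha> t)) \<partial>M2) - ereal c2"
      unfolding g'_def c2_def by (rule ext_integral_bounded_below) (use assms in auto)
    moreover have "ext_integral M1 (\<lambda>s. ereal (f s (\<alpha> s))) = enn2ereal (\<integral>\<^sup>+s. ennreal (f' s (\<alpha> s)) \<partial>M1) - ereal c1"
      unfolding f'_def c1_def by (rule ext_integral_bounded_below) (use assms in auto)
    ultimately show "(\<integral>\<^sup>+t. ennreal (g' t (A \<alpha> t)) \<partial>M2) + ennreal c1 \<le> (\<integral>\<^sup>+s. ennreal (f' s (\<alpha> s)) \<partial>M1) + ennreal c2"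
      using assms(24)[OF \<alpha>] enn2ereal_diff_le_iff[OF c] by simp
  qed
  then have main: "(\<integral>\<^sup>+t. ennreal (log_heat \<tau> (g' t) 0) \<partial>M2) + ennreal c1 \<le> (\<integral>\<^sup>+s. ennreal (log_heat \<tau> (f' s) 0) \<partial>M1) + ennreal c2"
  proof (rule log_heat_integral_le)
    show "continuous_on UNIV (f' s)" if "s \<in> space M1" for s
      unfolding f'_def using assms(7)[OF that] by (intro continuous_intros)
    show "continuous_on UNIV (g' t)" if "t \<in> space M2" for t
      unfolding g'_def using assms(8)[OF that] by (intro continuous_intros)
  qed (use assms f'0 g'0 in auto)
  have g0: "log_heat \<tau> (g' t) 0 \<ge> 0" if "t \<in> space M2" for t
    using gt[OF that] g'0[OF that] assms(25) unfolding g'_def by (intro log_heat_nonneg) auto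
  have f0: "log_heat \<tau> (f' s) 0 \<ge> 0" if "s \<in> space M1" for s
    using fs[OF that] f'0[OF that] assms(25) unfolding f'_def by (intro log_heat_nonneg) auto
  have "ext_integral M2 (\<lambda>t. - ln_ennreal (\<integral>\<^sup>+x. ennreal (exp (- g t x)) \<partial>gaussian \<tau>))
    = ext_integral M2 (\<lambda>t. ereal (log_heat \<tau> (g' t) 0 - l2 t))"
    unfolding g'_def by (intro ext_integral_cong ln_ennreal_gaussian gt assms(18,25))
  \<comment> \<open>The integrand is a nonnegative function minus \<open>l2\<close>, so the same
    shift applies to the conclusion as to the hypothesis.\<close>
  also have "\<dots> = enn2ereal (\<integral>\<^sup>+t. ennreal (log_heat \<tau> (g' t) 0) \<partial>M2) - ereal c2"
    using ext_integral_bounded_below[of "\<lambda>t. log_heat \<tau> (g' t) 0 - l2 t" M2 l2] assms(15,16,25) g0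
    by (simp add: c2_def)
  also have "\<dots> \<le> enn2ereal (\<integral>\<^sup>+s. ennreal (log_heat \<tau> (f' s) 0) \<partial>M1) - ereal c1"
    using main enn2ereal_diff_le_iff[OF c] by simp
  also have "\<dots> = ext_integral M1 (\<lambda>s. ereal (log_heat \<tau> (f' s) 0 - l1 s))"
    using ext_integral_bounded_below[of "\<lambda>s. log_heat \<tau> (f' s) 0 - l1 s" M1 l1] assms(13,14,25) f0
    by (simp add: c1_def)
  also have "\<dots> = ext_integral M1 (\<lambda>s. - ln_ennreal (\<integral>\<^sup>+x. ennreal (exp (- f s x)) \<partial>gaussian \<tau>))"
    unfolding f'_def by (intro ext_integral_cong ln_ennreal_gaussian[symmetric] fs assms(17,25))
  finally show ?thesis .
qed

end
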